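(* Consider the plant $$\dot{x} = Ax + Bu,\qquad y_i = C_i x + a_i,\quad i\in\mathcal{N}=\{1,\dots,N\},$$ with $x\in\mathbb{R}^n$, input $u\in\mathbb{R}^p$, $A\in\mathbb{R}^{n\times n}$, $B\in\mathbb{R}^{n\times p}$, $C_i\in\mathbb{R}^{m_i\times n}$, and attack signals $a_i(t)\in\mathbb{R}^{m_i}$ which may be arbitrary (not necessarily bounded). Let $q\ge0$ be an integer and assume: (A1) $a_i(t)\equiv 0$ for at least $N-q$ indices $i\in\mathcal{N}$; (A2) for every $\mathcal{N}'\subset\mathcal{N}$ with $|\mathcal{N}'|=N-2q$, the pair $(C',A)$ is observable, where $C'$ stacks $C_i$, $i\in\mathcal{N}'$; (A3) the communication graph on $\mathcal{N}$, with neighbor sets $\mathcal{N}_i$, is undirected and connected; (A4) there is a basis $\{v_1,\dots,v_n\}$ of $\mathbb{R}^n$ such that each unobservable subspace $\mathcal{U}_i$ of $(C_i,A)$, $i\in\mathcal{N}$, is the span of a subset of this basis. Fix such a basis, let $w_1,\dots,w_n\in\mathbb{R}^n$ satisfy $[w_1\,\cdots\,w_n]^T[v_1\,\cdots\,v_n]=I_n$, and set $s_i^l=1$ if $v_l\notin\mathcal{U}_i$, $s_i^l=0$ if $v_l\in\mathcal{U}_i$. Let $o_i=n-\dim\mathcal{U}_i$, let $\mathcal{V}_i\in\mathbb{R}^{n\times o_i}$ be the matrix whose columns are the $v_l$ with $v_l\notin\mathcal{U}_i$, and $\mathcal{W}_i\in\mathbb{R}^{o_i\times n}$ the matrix whose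 rows are the $w_l^T$ with $s_i^l=1$ (in the same order). Let $L_i\in\mathbb{R}^{o_i\times m_i}$ be such that $\mathcal{W}_iA\mathcal{V}_i-L_iC_i\mathcal{V}_i$ is Hurwitz. Consider the distributed observer $$\dot z_i = \mathcal{W}_i (A \mathcal{V}_i z_i + B u) + L_i ( y_i - C_i \mathcal{V}_i z_i )\in\mathbb{R}^{o_i},$$ $$\dot {\hat x}_i = A \hat x_i + B u + \kappa \sum_{l = 1}^n s_i^l\, \mathrm{sgn}(w_l^T\mathcal{V}_iz_i - w_l^T\hat{x}_i)\, v_l + \kappa\gamma\sum_{j \in \mathcal{N}_i} (\hat{x}_j - \hat{x}_i)\in\mathbb{R}^n,$$ $i\in\mathcal{N}$, with gains $\kappa,\gamma>0$. Then for each compact set $K \subset \mathbb{R}^{n + \sum_{i=1}^N (o_i + n)}$ and each $\eta > 0$, there exist $\kappa^*$ and $\gamma^*$ such that, for each $\kappa > \kappa^*$, $\gamma > \gamma^*$, and $\mathrm{col}(x(0), z_1(0), \hat{x}_1(0), \dots, z_N(0), \hat{x}_N(0)) \in K$, the (Filippov) solution of the plant and observer exists for all $t \ge 0$ and satisfies $$\limsup_{t \to \infty} \|\hat{x}_i(t) - x(t)\|_\infty \le \eta\qquad\text{for all } i \in \mathcal{N}.$$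
   Context: $\mathcal{U}_i$ is the unobservable subspace of $(C_i,A)$ (the kernel of $\mathrm{col}(C_i,C_iA,\dots,C_iA^{n-1})$). Such $L_i$ exist since $(C_i\mathcal{V}_i,\mathcal{W}_iA\mathcal{V}_i)$ is observable. $\mathrm{sgn}(s)=s/|s|$ for $s\ne0$ and $\mathrm{sgn}(0)=0$; solutions are in the sense of Filippov. $\|x\|_\infty=\max_i|x_i|$. $\mathrm{col}(a,b)=[a^T,b^T]^T$. The graph has 0/1 adjacency entries.
   Formalization: The input u and the attack signals a_i are assumed to be locally (Lebesgue) integrable on [0,∞), not wholly arbitrary; without this a solution for all t ≥ 0 can fail to exist, e.g. for a_1(t)=1/|t-1|. *)

theory Defs
  imports "HOL-Analysis.Analysis" "Jordan_Normal_Form.Char_Poly"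
begin

section \<open>Linear-algebra notions (matrices via Jordan_Normal_Form)\<close>

text \<open>A real square matrix is Hurwitz iff every (complex) eigenvalue has negative real part.\<close>
definition hurwitz :: "real mat \<Rightarrow> bool" where
  "hurwitz M \<longleftrightarrow> (\<forall>ev. eigenvalue (map_mat complex_of_real M) ev \<longrightarrow> Re ev < 0)"

text \<open>Unobservable subspace of (C,A): kernel of col(C, CA, ..., CA^(n-1)).\<close>
definition unobs_space :: "nat \<Rightarrow> real mat \<Rightarrow> real mat \<Rightarrow> real vec set" where
  "unobs_space n C A = {x \<in> carrier_vec n. \<forall>k<n. C * (A ^\<^sub>m k) *\<^sub>v x = 0\<^sub>v (dim_row C)}"

text \<open>Observability of the pair (C', A), where C' stacks C i for i in S:
  the kernel of the stacked observability matrix is trivial.\<close>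
definition observable_stack :: "nat \<Rightarrow> (nat \<Rightarrow> real mat) \<Rightarrow> nat set \<Rightarrow> real mat \<Rightarrow> bool" where
  "observable_stack n C S A \<longleftrightarrow>
     (\<forall>x \<in> carrier_vec n. (\<forall>i\<in>S. \<forall>k<n. C i * (A ^\<^sub>m k) *\<^sub>v x = 0\<^sub>v (dim_row (C i))) \<longrightarrow> x = 0\<^sub>v n)"

text \<open>Span of the vectors v l, l in S (vectors in R^n).\<close>
definition span_of :: "nat \<Rightarrow> (nat \<Rightarrow> real vec) \<Rightarrow> nat set \<Rightarrow> real vec set" where
  "span_of n v S = {x \<in> carrier_vec n. \<exists>c. \<forall>r<n. x $ r = (\<Sum>l\<in>S. c l * v l $ r)}"

text \<open>v 0, ..., v (n-1) is a basis of R^n (spanning and linearly independent).\<close>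
definition is_basis :: "nat \<Rightarrow> (nat \<Rightarrow> real vec) \<Rightarrow> bool" where
  "is_basis n v \<longleftrightarrow> (\<forall>l<n. v l \<in> carrier_vec n) \<and> span_of n v {..<n} = carrier_vec n \<and>
     (\<forall>c. (\<forall>r<n. (\<Sum>l<n. c l * v l $ r) = 0) \<longrightarrow> (\<forall>l<n. c l = 0))"

text \<open>Connectedness of the undirected graph on {0..<N} with adjacency G.\<close>
definition graph_connected :: "nat \<Rightarrow> (nat \<Rightarrow> nat \<Rightarrow> bool) \<Rightarrow> bool" where
  "graph_connected N G \<longleftrightarrow>
     (\<forall>i<N. \<forall>j<N. (i, j) \<in> {(a, b). a < N \<and> b < N \<and> G a b}\<^sup>*)"

section \<open>Observer data\<close>

text \<open>Indices l (in increasing order) with v l not in U_i, i.e. s_i^l = 1.\<close>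
definition sel :: "nat \<Rightarrow> real vec set \<Rightarrow> (nat \<Rightarrow> real vec) \<Rightarrow> nat list" where
  "sel n U v = filter (\<lambda>l. v l \<notin> U) [0..<n]"

definition sflag :: "real vec set \<Rightarrow> (nat \<Rightarrow> real vec) \<Rightarrow> nat \<Rightarrow> real" where
  "sflag U v l = (if v l \<notin> U then 1 else 0)"

text \<open>V_i: columns v l with v l not in U_i; W_i: rows w l^T with s_i^l = 1 (same order).\<close>
definition Vmat :: "nat \<Rightarrow> real vec set \<Rightarrow> (nat \<Rightarrow> real vec) \<Rightarrow> real mat" where
  "Vmat n U v = mat n (length (sel n U v)) (\<lambda>(r, c). v (sel n U v ! c) $ r)"

definition Wmat :: "nat \<Rightarrow> real vec set \<Rightarrow> (nat \<Rightarrow> real vec) \<Rightarrow> (nat \<Rightarrow> real vec) \<Rightarrow> real mat" where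
  "Wmat n U v w = mat (length (sel n U v)) n (\<lambda>(r, c). w (sel n U v ! r) $ c)"

section \<open>Closed-loop state and vector field\<close>

text \<open>Coordinates of the state col(x, z_1, xhat_1, ..., z_N, xhat_N):
  IX r = x_r, IZ i k = (z_i)_k, IXH i r = (xhat_i)_r (all 0-based).\<close>
datatype idx = IX nat | IZ nat nat | IXH nat nat

definition idxset :: "nat \<Rightarrow> nat \<Rightarrow> (nat \<Rightarrow> nat) \<Rightarrow> idx set" where
  "idxset n N od = {IX r |r. r < n} \<union> {IZ i k |i k. i < N \<and> k < od i} \<union> {IXH i r |i r. i < N \<and> r < n}"

definition xof :: "nat \<Rightarrow> (idx \<Rightarrow> real) \<Rightarrow> real vec" where
  "xof n \<xi> = vec n (\<lambda>r. \<xi> (IX r))"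
definition zof :: "nat \<Rightarrow> nat \<Rightarrow> (idx \<Rightarrow> real) \<Rightarrow> real vec" where
  "zof oi i \<xi> = vec oi (\<lambda>k. \<xi> (IZ i k))"
definition xhof :: "nat \<Rightarrow> nat \<Rightarrow> (idx \<Rightarrow> real) \<Rightarrow> real vec" where
  "xhof n i \<xi> = vec n (\<lambda>r. \<xi> (IXH i r))"

text \<open>Right-hand side of plant + distributed observer. Parameters: n, N, A, B, C, U (unobservable
  subspaces), v, w, L, neighbour relation G, gains kappa gamma, input u, attacks a.\<close>
definition rhs ::
  "nat \<Rightarrow> nat \<Rightarrow> real mat \<Rightarrow> real mat \<Rightarrow> (nat \<Rightarrow> real mat) \<Rightarrow> (nat \<Rightarrow> real vec set)
   \<Rightarrow> (nat \<Rightarrow> real vec) \<Rightarrow> (nat \<Rightarrow> real vec) \<Rightarrow> (nat \<Rightarrow> real mat) \<Rightarrow> (nat \<Rightarrow> nat \<Rightarrow> bool)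
   \<Rightarrow> real \<Rightarrow> real \<Rightarrow> (real \<Rightarrow> real vec) \<Rightarrow> (nat \<Rightarrow> real \<Rightarrow> real vec)
   \<Rightarrow> real \<Rightarrow> (idx \<Rightarrow> real) \<Rightarrow> (idx \<Rightarrow> real)" where
  "rhs n N A B C U v w L G \<kappa> \<gamma> u a t \<xi> = (\<lambda>j. case j of
      IX r \<Rightarrow> if r < n then (A *\<^sub>v xof n \<xi> + B *\<^sub>v u t) $ r else 0
    | IZ i k \<Rightarrow>
        (let oi = length (sel n (U i) v); Vi = Vmat n (U i) v; Wi = Wmat n (U i) v w;
             zi = zof oi i \<xi> in
         if i < N \<and> k < oi then
           (Wi *\<^sub>v (A *\<^sub>v (Vi *\<^sub>v zi) + B *\<^sub>v u t)
            + L i *\<^sub>v (C i *\<^sub>v xof n \<xi> + a i t - C i *\<^sub>v (Vi *\<^sub>v zi))) $ k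
         else 0)
    | IXH i r \<Rightarrow>
        (let oi = length (sel n (U i) v); Vi = Vmat n (U i) v;
             zi = zof oi i \<xi>; xhi = xhof n i \<xi> in
         if i < N \<and> r < n then
           (A *\<^sub>v xhi + B *\<^sub>v u t) $ r
           + \<kappa> * (\<Sum>l<n. sflag (U i) v l * sgn (w l \<bullet> (Vi *\<^sub>v zi) - w l \<bullet> xhi) * v l $ r)
           + \<kappa> * \<gamma> * (\<Sum>j\<in>{j. j < N \<and> G i j}. xhof n j \<xi> $ r - xhi $ r)
         else 0))"

section \<open>Filippov solutions on a finite coordinate set I\<close>

text \<open>g is in the closed convex hull of X (coordinates in I): closure of the set of finite
  convex combinations of points of X.\<close>
definition in_closed_hull :: "idx set \<Rightarrow> (idx \<Rightarrow> real) set \<Rightarrow> (idx \<Rightarrow> real) \<Rightarrow> bool" where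
  "in_closed_hull I X g \<longleftrightarrow> (\<forall>\<epsilon>>0. \<exists>P c. finite P \<and> P \<subseteq> X \<and> (\<forall>p\<in>P. 0 \<le> c p) \<and> sum c P = 1 \<and>
      (\<forall>k\<in>I. \<bar>g k - (\<Sum>p\<in>P. c p * p k)\<bar> < \<epsilon>))"

text \<open>Filippov set-valued map:
  F(t,xi) = INT delta>0. INT (mu S = 0). closed convex hull f(t, B(xi,delta) - S).\<close>
definition filippov_set ::
  "idx set \<Rightarrow> (real \<Rightarrow> (idx \<Rightarrow> real) \<Rightarrow> (idx \<Rightarrow> real)) \<Rightarrow> real \<Rightarrow> (idx \<Rightarrow> real) \<Rightarrow> (idx \<Rightarrow> real) set" where
  "filippov_set I f t \<xi> = {g. \<forall>\<delta>>0. \<forall>S \<in> null_sets (PiM I (\<lambda>_. lborel)).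
      in_closed_hull I (f t ` ({\<zeta> \<in> PiE I (\<lambda>_. UNIV). \<forall>k\<in>I. \<bar>\<zeta> k - \<xi> k\<bar> < \<delta>} - S)) g}"

text \<open>Filippov solution on [0, infinity): absolutely continuous on every [0,T] (written as
  the integral of a locally integrable derivative g) with g(t) in F(t, xi(t)) for a.e. t >= 0.\<close>
definition filippov_solution ::
  "idx set \<Rightarrow> (real \<Rightarrow> (idx \<Rightarrow> real) \<Rightarrow> (idx \<Rightarrow> real)) \<Rightarrow> (real \<Rightarrow> (idx \<Rightarrow> real)) \<Rightarrow> bool" where
  "filippov_solution I f \<xi> \<longleftrightarrow> (\<exists>g.
      (\<forall>T\<ge>0. \<forall>k\<in>I. (\<lambda>s. g s k) absolutely_integrable_on {0..T} \<and>
                    \<xi> T k = \<xi> 0 k + integral {0..T} (\<lambda>s. g s k)) \<and>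
      (AE s in lborel. 0 \<le> s \<longrightarrow> g s \<in> filippov_set I f s (\<xi> s)))"

text \<open>Infinity norm of a vector in R^n.\<close>
definition linf :: "real vec \<Rightarrow> real" where
  "linf x = Max (insert 0 ((\<lambda>r. \<bar>x $ r\<bar>) ` {..<dim_vec x}))"

end

theory Submission
  imports Defs "Jordan_Normal_Form.Schur_Decomposition"
begin

text \<open>
  In coordinates dual to the basis \<open>v\<close> the signum terms decouple: the error
  \<open>x\<^sub>i\<^sup>l = w\<^sub>l\<^sup>T (xhat\<^sub>i - x)\<close> obeys a linear equation plus \<open>\<kappa> s\<^sub>i\<^sup>l Sgn (e\<^sub>i\<^sup>l - x\<^sub>i\<^sup>l)\<close>
  plus diffusive coupling, where \<open>e\<^sub>i\<^sup>l = w\<^sub>l\<^sup>T (V\<^sub>i z\<^sub>i - x)\<close> decays exponentially for every honest node.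
  The disagreement \<open>\<Sum> (x\<^sub>i\<^sup>l - mean\<^sup>l)\<^sup>2\<close> is driven to size \<open>O(\<gamma>\<^sup>-\<^sup>2)\<close>, uniformly in \<open>\<kappa>\<close>.
  By (A2) every coordinate \<open>l\<close> is seen by at least \<open>2 q + 1\<close> nodes, of which at most \<open>q\<close> are attacked;
  hence, once the mean of coordinate \<open>l\<close> dominates the disagreement and the honest \<open>e\<^sub>i\<^sup>l\<close>, the signs of the honest
  nodes outvote the others and push the mean towards zero at rate \<open>\<kappa> / N\<close>, which beats the plant dynamics on the
  a priori bounded set when \<open>\<kappa>\<close> is large.
  Differential inequalities are used in the form of one-sided difference quotients at every time, so no
  a.e. differentiability theorem is needed.
\<close>

section \<open>Comparison by small time steps\<close>

text \<open>Two obstacles shape the proof. The gain \<kappa> must dominate the plant dynamics on a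
  set whose size might itself grow with \<kappa>. It does not: diffusion and signum terms both carry
  the factor \<kappa>, so the disagreement settles at a level fixed by \<gamma>, and the radius of
  the a priori set is built from initial data, honest local errors and the tolerance only. Diffusion
  cancels in the mean, so \<gamma> cannot spoil the estimate of the mean in turn. Secondly, local
  estimates of attacked nodes may be unbounded; they enter \<open>xhat\<close> only through a
  signum, hence as a bounded vote. The two halves of the claim use Filippov sets differently. Bounds
  on every solution need outer estimates, obtained by pairing the set with one dual vector at a
  time. Existence needs inner estimates: a selection must lie in the set although arbitrary null
  sets are removed. Plant and local observers do not see \<open>xhat\<close>, so the signum targets
  are known continuous functions when \<open>xhat\<close> is constructed, and monotonicity of the
  signum takes the place of a Lipschitz condition.\<close>

lemma eventually_at_right_0_iff:
  "eventually P (at_right (0::real)) \<longleftrightarrow> (\<exists>d>0. \<forall>h. 0 < h \<and> h < d \<longrightarrow> P h)"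
  unfolding eventually_at_right_field by blast

text \<open>Continuous induction. Closedness puts the supremum of the good initial segments into
  \<open>S\<close>, and \<open>step\<close> carries membership beyond it, so the supremum cannot lie
  below \<open>b\<close>.\<close>

lemma real_induct_closed:
  fixes S :: "real set"
  assumes "closed S" "a \<in> S" "a \<le> b"
    and step: "\<And>t. t \<in> S \<Longrightarrow> a \<le> t \<Longrightarrow> eventually (\<lambda>h. t + h \<in> S) (at_right 0)"
  shows "b \<in> S"
proof (rule ccontr)
  assume nb: "b \<notin> S"
  define t where "t = Sup {t. a \<le> t \<and> {a..t} \<subseteq> S \<and> t \<le> b}"
  let ?Y = "{t. a \<le> t \<and> {a..t} \<subseteq> S \<and> t \<le> b}"
  have aY: "a \<in> ?Y" using assms by auto
  have bdd: "bdd_above ?Y" by (auto intro: bdd_aboveI[of _ b])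
  have at: "a \<le> t" unfolding t_def by (rule cSup_upper[OF aY bdd])
  have tb: "t \<le> b" unfolding t_def by (rule cSup_least) (use aY in blast, simp)
  have below: "x \<in> S" if "a \<le> x" "x < t" for x
  proof -
    obtain y where "y \<in> ?Y" "x < y" using \<open>x < t\<close> unfolding t_def using less_cSup_iff[OF _ bdd] aY by blast
    then show ?thesis using that by auto
  qed
  have tS: "t \<in> S"
  proof (cases "t = a")
    case False
    have "t \<in> closure {a..<t}" using False at by simp
    moreover have "closure {a..<t} \<subseteq> S" using below \<open>closed S\<close> by (intro closure_minimal) auto
    ultimately show ?thesis by blast
  qed (use assms in auto)
  obtain d where d: "d > 0" "\<And>h. 0 < h \<Longrightarrow> h < d \<Longrightarrow> t + h \<in> S" using step[OF tS at] unfolding eventually_at_right_0_iff by blast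
  have "t < b" using tS nb tb by (metis less_le)
  \<comment> \<open>Halving keeps \<open>h\<close> strictly below \<open>d\<close>; the cap keeps t
    + h inside the set whose supremum is \<open>t\<close>.\<close>
  define h where "h = min (d/2) (b - t)"
  have h: "h > 0" "h < d" "t + h \<le> b" using d \<open>t < b\<close> by (auto simp: h_def min_def)
  have "x \<in> S" if "a \<le> x" "x \<le> t + h" for x
  proof (cases "x \<le> t")
    case True then show ?thesis using below[of x] tS that by (cases "x = t") auto
  next
    case False then show ?thesis using d(2)[of "x - t"] that h by auto
  qed
  then have "t + h \<in> ?Y" using at h by auto
  then have "t + h \<le> t" unfolding t_def by (rule cSup_upper[OF _ bdd])
  then show False using h by simp
qed

text \<open>The rate is demanded only while \<phi> is at least \<open>m\<close>, which is where the
  later estimates hold; below \<open>m\<close>, continuity alone keeps \<phi> under \<open>m\<close>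
  for a short time.\<close>

lemma decay_by_small_steps:
  fixes \<phi> :: "real \<Rightarrow> real"
  assumes cont: "continuous_on {t0..} \<phi>" and c: "c \<ge> 0" and t: "t0 \<le> t"
    and step: "\<And>t. t0 \<le> t \<Longrightarrow> m \<le> \<phi> t \<Longrightarrow>
      eventually (\<lambda>h. \<phi> (t + h) \<le> \<phi> t - c * h) (at_right 0)"
  shows "\<phi> t \<le> max m (\<phi> t0 - c * (t - t0))"
proof -
  define S where "S = {t \<in> {t0..}. \<phi> t \<le> max m (\<phi> t0 - c * (t - t0))}"
  have "t \<in> S"
  proof (rule real_induct_closed[OF _ _ t])
    show "closed S" unfolding S_def
      by (rule continuous_on_closed_Collect_le[OF cont _ closed_atLeast]) (intro continuous_intros)
    show "t0 \<in> S" by (auto simp: S_def)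
    fix t assume tS: "t \<in> S" and t0: "t0 \<le> t"
    show "eventually (\<lambda>h. t + h \<in> S) (at_right 0)"
    proof (cases "m \<le> \<phi> t")
      case True
      obtain d where d: "d > 0" "\<And>h. 0 < h \<Longrightarrow> h < d \<Longrightarrow> \<phi> (t + h) \<le> \<phi> t - c * h" using step[OF t0 True]
        unfolding eventually_at_right_0_iff by blast
      have "t + h \<in> S" if "0 < h" "h < d" for h
      proof -
        have "0 \<le> c * h" using c that by simp
        then show ?thesis using d(2)[OF that] tS t0 that by (auto simp: S_def algebra_simps max_def split: if_splits)
      qed
      then show ?thesis using d(1) unfolding eventually_at_right_0_iff by blast
    next
      case False
      then obtain d where d: "d > 0" "\<And>x. x \<in> {t0..} \<Longrightarrow> dist x t < d \<Longrightarrow> dist (\<phi> x) (\<phi> t) < m - \<phi> t"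
        using cont t0 unfolding continuous_on_iff by (metis atLeast_iff diff_gt_0_iff_gt not_le)
      have "t + h \<in> S" if "0 < h" "h < d" for h
        using d(2)[of "t + h"] that t0 by (auto simp: S_def dist_real_def)
      then show ?thesis using d(1) unfolding eventually_at_right_0_iff by blast
    qed
  qed
  then show ?thesis by (simp add: S_def)
qed

section \<open>A Poincare inequality on connected graphs\<close>

text \<open>Along a path the increments telescope at the cost of (a + b)^2 \<le> 2 a^2 + 2 b^2,
  which turns \<open>C\<close> into \<open>2 * C + 2\<close> at each edge. The constant depends on
  the path and not on \<open>f\<close>.\<close>

lemma rtrancl_sq_bound:
  assumes "(i, j) \<in> {(a, b). a < N \<and> b < N \<and> G a b}\<^sup>*"
  shows "\<exists>C\<ge>0. \<forall>f::nat \<Rightarrow> real. (f j - f i)^2 \<le> C * (\<Sum>i<N. \<Sum>j\<in>{j. j < N \<and> G i j}. (f j - f i)^2)"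
  using assms
proof (induction rule: rtrancl_induct)
  case base then show ?case by (intro exI[of _ 0]) auto
next
  case (step y z)
  let ?E = "\<lambda>f::nat \<Rightarrow> real. (\<Sum>i<N. \<Sum>j\<in>{j. j < N \<and> G i j}. (f j - f i)^2)"
  obtain C where C: "C \<ge> 0" "\<And>f. (f y - f i)^2 \<le> C * ?E f" using step.IH by blast
  have "(f z - f i)^2 \<le> (2 * C + 2) * ?E f" for f :: "nat \<Rightarrow> real"
  proof -
    have "(f z - f y)^2 \<le> (\<Sum>j\<in>{j. j < N \<and> G y j}. (f j - f y)^2)"
      using step.hyps(2) by (intro member_le_sum) auto
    also have "\<dots> \<le> ?E f"
      using step.hyps(2) by (intro member_le_sum[of y "{..<N}" "\<lambda>i. \<Sum>j\<in>{j. j < N \<and> G i j}. (f j - f i)^2"] sum_nonneg) auto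
    finally have 1: "(f z - f y)^2 \<le> ?E f" .
    have "(f z - f i)^2 = ((f z - f y) + (f y - f i))^2" by simp
    also have "\<dots> \<le> 2 * (f z - f y)^2 + 2 * (f y - f i)^2"
      using zero_le_power2[of "(f z - f y) - (f y - f i)"] by (simp add: power2_eq_square algebra_simps)
    finally show ?thesis using 1 C(2)[of f] by (simp add: algebra_simps)
  qed
  then show ?case using C(1) by (intro exI[of _ "2 * C + 2"]) auto
qed

text \<open>For mean-zero \<open>f\<close> the squared differences over all ordered pairs add up to
  2 N times the sum of squares, and each pair is controlled by the edge energy through a path. The
  constant plays the part of the algebraic connectivity.\<close>

lemma connected_graph_poincare:
  assumes "graph_connected N G"
  shows "\<exists>c>0. \<forall>f::nat \<Rightarrow> real. (\<Sum>i<N. f i) = 0 \<longrightarrow>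
           c * (\<Sum>i<N. (f i)^2) \<le> (\<Sum>i<N. \<Sum>j\<in>{j. j < N \<and> G i j}. (f j - f i)^2)"
proof -
  let ?E = "\<lambda>f::nat \<Rightarrow> real. (\<Sum>i<N. \<Sum>j\<in>{j. j < N \<and> G i j}. (f j - f i)^2)"
  have E0: "?E f \<ge> 0" for f by (intro sum_nonneg) auto
  \<comment> \<open>Nonnegativity stands outside the implication, so the chosen constants are
    nonnegative for all index pairs, also those out of range.\<close>
  define P where "P i j C \<longleftrightarrow> C \<ge> 0 \<and> (i < N \<longrightarrow> j < N \<longrightarrow> (\<forall>f::nat \<Rightarrow> real. (f j - f i)^2 \<le> C * ?E f))" for i j C
  have "\<exists>C. P i j C" for i j
  proof (cases "i < N \<and> j < N")
    case True
    then have "(i, j) \<in> {(a, b). a < N \<and> b < N \<and> G a b}\<^sup>*" using assms by (auto simp: graph_connected_def)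
    from rtrancl_sq_bound[OF this] show ?thesis unfolding P_def by blast
  qed (auto simp: P_def intro: exI[of _ 0])
  then have "P i j (SOME C. P i j C)" for i j by (rule someI_ex)
  then obtain C where "\<And>i j. P i j (C i j)" by (rule that)
  then have C: "\<And>i j. C i j \<ge> 0"
      "\<And>i j f. i < N \<Longrightarrow> j < N \<Longrightarrow> ((f::nat \<Rightarrow> real) j - f i)^2 \<le> C i j * ?E f" by (simp_all add: P_def)
  \<comment> \<open>The added 1 keeps \<open>K\<close> positive in degenerate graphs, so that
    \<open>1/K\<close> can serve as the constant.\<close>
  define K where "K = (\<Sum>i<N. \<Sum>j<N. C i j) + 1"
  have K: "K > 0" unfolding K_def using C by (intro add_nonneg_pos sum_nonneg) auto
  have "(\<Sum>i<N. (f i)^2) \<le> K * ?E f" if 0: "(\<Sum>i<N. f i) = 0" for f :: "nat \<Rightarrow> real"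
  proof (cases "N = 0")
    case False
    have "(\<Sum>i<N. \<Sum>j<N. (f j - f i)^2) = (\<Sum>i<N. \<Sum>j<N. (f j)^2 + (f i)^2 - 2 * f i * f j)"
      by (simp add: power2_eq_square algebra_simps)
    also have "\<dots> = (\<Sum>i<N. (\<Sum>j<N. (f j)^2) + real N * (f i)^2 - 2 * f i * (\<Sum>j<N. f j))"
      by (simp add: sum.distrib sum_subtractf sum_distrib_left)
    also have "\<dots> = 2 * real N * (\<Sum>i<N. (f i)^2)" using 0
      by (simp add: sum.distrib flip: sum_distrib_left)
    finally have "2 * real N * (\<Sum>i<N. (f i)^2) = (\<Sum>i<N. \<Sum>j<N. (f j - f i)^2)" by simp
    also have "\<dots> \<le> (\<Sum>i<N. \<Sum>j<N. C i j * ?E f)" using C by (intro sum_mono) auto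
    also have "\<dots> = (\<Sum>i<N. \<Sum>j<N. C i j) * ?E f" unfolding sum_distrib_right ..
    also have "\<dots> \<le> K * ?E f" using E0 by (intro mult_right_mono) (auto simp: K_def)
    finally have "2 * real N * (\<Sum>i<N. (f i)^2) \<le> K * ?E f" .
    moreover have "1 * (\<Sum>i<N. (f i)^2) \<le> (2 * real N) * (\<Sum>i<N. (f i)^2)"
      using False by (intro mult_right_mono sum_nonneg) auto
    ultimately show ?thesis by linarith
  qed simp
  then have "1/K * (\<Sum>i<N. (f i)^2) \<le> ?E f" if "(\<Sum>i<N. f i) = 0" for f :: "nat \<Rightarrow> real"
    using K that by (simp add: pos_divide_le_eq mult.commute)
  then show ?thesis using K by (intro exI[of _ "1/K"]) simp
qed

section \<open>Disagreement and mean under the coupled dynamics\<close>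

text \<open>Discrete Green identity: exchanging i and j in the symmetric edge sum gives a second
  form of it, and the average of the two forms is minus half the square.\<close>

lemma graph_dirichlet_form:
  fixes d :: "nat \<Rightarrow> real"
  assumes sym: "\<forall>i<N. \<forall>j<N. G i j \<longleftrightarrow> G j i"
  shows "(\<Sum>i<N. d i * (\<Sum>j\<in>{j. j < N \<and> G i j}. d j - d i)) =
         - (\<Sum>i<N. \<Sum>j\<in>{j. j < N \<and> G i j}. (d j - d i)^2) / 2"
proof -
  define g where "g i j = (if G i j then 1 else 0 :: real)" for i j
  have gs: "g i j = g j i" if "i < N" "j < N" for i j using sym that by (simp add: g_def)
  have eq: "(\<Sum>j\<in>{j. j < N \<and> G i j}. h j) = (\<Sum>j<N. g i j * h j)" for i and h :: "nat \<Rightarrow> real"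
    by (rule sum.mono_neutral_cong_left) (auto simp: g_def)
  let ?X = "\<Sum>i<N. d i * (\<Sum>j<N. g i j * (d j - d i))"
  have 1: "?X = (\<Sum>i<N. \<Sum>j<N. g i j * d i * (d j - d i))"
    by (simp add: sum_distrib_left ac_simps)
  have 2: "?X = (\<Sum>i<N. \<Sum>j<N. g i j * d j * (d i - d j))"
    unfolding 1 by (subst sum.swap, intro sum.cong refl) (simp add: gs)
  have "2 * ?X = (\<Sum>i<N. \<Sum>j<N. g i j * d i * (d j - d i)) + (\<Sum>i<N. \<Sum>j<N. g i j * d j * (d i - d j))"
    using 1 2 by linarith
  also have "\<dots> = (\<Sum>i<N. \<Sum>j<N. - (g i j * (d j - d i)^2))"
    unfolding sum.distrib[symmetric] by (intro sum.cong refl) (simp add: power2_eq_square algebra_simps)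
  finally show ?thesis unfolding eq by (simp add: sum_negf)
qed

text \<open>Edge differences are antisymmetric; this is why diffusion leaves the node mean
  alone.\<close>

lemma graph_sum_zero:
  fixes d :: "nat \<Rightarrow> real"
  assumes sym: "\<forall>i<N. \<forall>j<N. G i j \<longleftrightarrow> G j i"
  shows "(\<Sum>i<N. \<Sum>j\<in>{j. j < N \<and> G i j}. d j - d i) = 0"
proof -
  define g where "g i j = (if G i j then 1 else 0 :: real)" for i j
  have gs: "g i j = g j i" if "i < N" "j < N" for i j using sym that by (simp add: g_def)
  have eq: "(\<Sum>j\<in>{j. j < N \<and> G i j}. h j) = (\<Sum>j<N. g i j * h j)" for i and h :: "nat \<Rightarrow> real"
    by (rule sum.mono_neutral_cong_left) (auto simp: g_def)
  have "(\<Sum>i<N. \<Sum>j<N. g i j * (d j - d i)) = (\<Sum>i<N. \<Sum>j<N. g i j * d j) - (\<Sum>i<N. \<Sum>j<N. g i j * d i)"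
    by (simp add: sum_subtractf algebra_simps)
  also have "(\<Sum>i<N. \<Sum>j<N. g i j * d j) = (\<Sum>i<N. \<Sum>j<N. g i j * d i)"
    by (subst sum.swap, intro sum.cong refl) (simp add: gs)
  finally show ?thesis unfolding eq by simp
qed

text \<open>In coordinates dual to the basis the error of node \<open>i\<close> is \<open>x i :: nat \<Rightarrow> real\<close>; \<open>a\<close> is
  the plant matrix in these coordinates and \<open>\<tau>\<close> collects the values chosen from the signum terms.\<close>

definition err_rate ::
  "nat \<Rightarrow> nat \<Rightarrow> (nat \<Rightarrow> nat \<Rightarrow> bool) \<Rightarrow> (nat \<Rightarrow> nat \<Rightarrow> real) \<Rightarrow> (nat \<Rightarrow> nat \<Rightarrow> real) \<Rightarrow> real \<Rightarrow> real
   \<Rightarrow> (nat \<Rightarrow> nat \<Rightarrow> real) \<Rightarrow> (nat \<Rightarrow> nat \<Rightarrow> real) \<Rightarrow> nat \<Rightarrow> nat \<Rightarrow> real" where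
  "err_rate N n G s a \<kappa> \<gamma> \<tau> x i l = (\<Sum>k<n. a l k * x i k) + \<kappa> * s i l * \<tau> i l
      + \<kappa> * \<gamma> * (\<Sum>j\<in>{j. j < N \<and> G i j}. x j l - x i l)"

definition node_mean :: "nat \<Rightarrow> (nat \<Rightarrow> nat \<Rightarrow> real) \<Rightarrow> nat \<Rightarrow> real" where
  "node_mean N x l = (\<Sum>i<N. x i l) / real N"

definition disagreement :: "nat \<Rightarrow> nat \<Rightarrow> (nat \<Rightarrow> nat \<Rightarrow> real) \<Rightarrow> real" where
  "disagreement N n x = (\<Sum>l<n. \<Sum>i<N. (x i l - node_mean N x l)^2)"

lemma sum_deviation_zero: "(\<Sum>i<N. x i l - node_mean N x l) = 0"
  by (cases "N = 0") (simp_all add: node_mean_def sum_subtractf)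

text \<open>Diffusion cancels in the sum over nodes, so \<gamma> disappears; the plant matrix is
  common to all nodes and therefore acts on the mean itself. What remains is the total vote.\<close>

lemma mean_rate:
  assumes sym: "\<forall>i<N. \<forall>j<N. G i j \<longleftrightarrow> G j i"
  shows "(\<Sum>i<N. err_rate N n G s a \<kappa> \<gamma> \<tau> x i l) =
    real N * (\<Sum>k<n. a l k * node_mean N x k) + \<kappa> * (\<Sum>i<N. s i l * \<tau> i l)"
proof (cases "N = 0")
  case False
  have "(\<Sum>i<N. \<Sum>k<n. a l k * x i k) = (\<Sum>k<n. a l k * (\<Sum>i<N. x i k))"
    by (subst sum.swap) (simp add: sum_distrib_left)
  also have "\<dots> = (\<Sum>k<n. real N * (a l k * node_mean N x k))"
    using False by (simp add: node_mean_def)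
  finally show ?thesis
    using graph_sum_zero[OF sym, of "\<lambda>j. x j l"]
    by (simp add: err_rate_def sum.distrib sum_distrib_left[symmetric] mult.assoc)
qed simp

text \<open>In units of \<kappa> \<gamma> c V, diffusion contributes -1/2, the plant at most 1/8 by
  the last assumption of \<open>pos\<close>, and the signum terms at most 1/8 plus a constant by
  Young's inequality. That constant is 2 \<kappa> n N / (\<gamma> c), and \<open>m\<close> is a
  level at which another 1/8 pays for it. Diffusion and votes both carry \<kappa>, so this level
  depends on \<gamma> but not on \<kappa>.\<close>

lemma disagreement_rate:
  assumes sym: "\<forall>i<N. \<forall>j<N. G i j \<longleftrightarrow> G j i"
    and poinc: "\<And>f::nat \<Rightarrow> real. (\<Sum>i<N. f i) = 0 \<Longrightarrow>
           c * (\<Sum>i<N. (f i)^2) \<le> (\<Sum>i<N. \<Sum>j\<in>{j. j < N \<and> G i j}. (f j - f i)^2)"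
    and s: "\<And>i l. i < N \<Longrightarrow> l < n \<Longrightarrow> \<bar>s i l * \<tau> i l\<bar> \<le> 1"
    and alpha: "(\<Sum>l<n. \<Sum>k<n. \<bar>a l k\<bar>) \<le> \<alpha>"
    and pos: "\<kappa> > 0" "\<gamma> > 0" "c > 0" "8 * \<alpha> \<le> \<kappa> * \<gamma> * c"
    and m: "16 * real n * real N \<le> m * (\<gamma> * c)^2" "m \<le> disagreement N n x" 
  shows "(\<Sum>l<n. \<Sum>i<N. (x i l - node_mean N x l) * err_rate N n G s a \<kappa> \<gamma> \<tau> x i l)
          \<le> - (\<kappa> * \<gamma> * c / 8) * m"
proof -
  define d where "d i l = x i l - node_mean N x l" for i l
  define V where "V = disagreement N n x"
  have V: "V = (\<Sum>l<n. \<Sum>i<N. (d i l)^2)" by (simp add: V_def disagreement_def d_def)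
  have d0: "(\<Sum>i<N. d i l) = 0" for l unfolding d_def by (rule sum_deviation_zero)
  \<comment> \<open>Deviations sum to zero, so \<open>x\<close> can be replaced by its deviation:
    the mean, which is not yet known to be bounded, drops out.\<close>
  have T1: "(\<Sum>l<n. \<Sum>i<N. d i l * (\<Sum>k<n. a l k * x i k)) \<le> \<alpha> * V"
  proof -
    have eq: "(\<Sum>i<N. d i l * (\<Sum>k<n. a l k * x i k)) = (\<Sum>k<n. a l k * (\<Sum>i<N. d i l * d i k))" for l
    proof -
      have "(\<Sum>i<N. d i l * (\<Sum>k<n. a l k * x i k)) = (\<Sum>k<n. \<Sum>i<N. a l k * (d i l * x i k))"
        by (subst sum.swap) (simp add: sum_distrib_left ac_simps)
      also have "\<dots> = (\<Sum>k<n. a l k * (\<Sum>i<N. d i l * d i k + d i l * node_mean N x k))"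
        by (simp add: sum_distrib_left d_def algebra_simps)
      also have "\<dots> = (\<Sum>k<n. a l k * ((\<Sum>i<N. d i l * d i k) + (\<Sum>i<N. d i l) * node_mean N x k))"
        by (simp add: sum.distrib sum_distrib_right)
      finally show ?thesis using d0 by simp
    qed
    have le: "(\<Sum>k<n. a l k * (\<Sum>i<N. d i l * d i k)) \<le> (\<Sum>k<n. \<bar>a l k\<bar> * V)" if "l < n" for l
    proof (rule sum_mono)
      fix k assume "k \<in> {..<n}"
      have Vl: "(\<Sum>i<N. (d i l)^2) \<le> V" if "l < n" for l
        unfolding V using that by (intro member_le_sum[of l "{..<n}" "\<lambda>l. \<Sum>i<N. (d i l)^2"] sum_nonneg) auto
      have "\<bar>\<Sum>i<N. d i l * d i k\<bar> \<le> (\<Sum>i<N. ((d i l)^2 + (d i k)^2) / 2)"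
      proof (rule order.trans[OF sum_abs], rule sum_mono)
        fix i
        show "\<bar>d i l * d i k\<bar> \<le> ((d i l)^2 + (d i k)^2) / 2"
          using zero_le_power2[of "d i l - d i k"] zero_le_power2[of "d i l + d i k"]
          by (simp add: power2_eq_square algebra_simps abs_le_iff)
      qed
      also have "\<dots> = ((\<Sum>i<N. (d i l)^2) + (\<Sum>i<N. (d i k)^2)) / 2"
        by (simp add: sum.distrib sum_divide_distrib[symmetric])
      also have "\<dots> \<le> V" using Vl[of l] Vl[of k] that \<open>k \<in> {..<n}\<close> by simp
      finally have "\<bar>a l k\<bar> * \<bar>\<Sum>i<N. d i l * d i k\<bar> \<le> \<bar>a l k\<bar> * V" by (intro mult_left_mono) auto
      then show "a l k * (\<Sum>i<N. d i l * d i k) \<le> \<bar>a l k\<bar> * V"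
        unfolding abs_mult[symmetric] by linarith
    qed
    have "(\<Sum>l<n. \<Sum>i<N. d i l * (\<Sum>k<n. a l k * x i k)) \<le> (\<Sum>l<n. \<Sum>k<n. \<bar>a l k\<bar> * V)"
      unfolding eq by (rule sum_mono) (simp add: le)
    also have "\<dots> = (\<Sum>l<n. \<Sum>k<n. \<bar>a l k\<bar>) * V" unfolding sum_distrib_right ..
    also have "\<dots> \<le> \<alpha> * V" using alpha by (intro mult_right_mono) (auto simp: V intro!: sum_nonneg)
    finally show ?thesis .
  qed
  \<comment> \<open>Young's inequality from the square of \<gamma> c |d| - 4, weighted so that the
    quadratic part is an eighth of \<gamma> c.\<close>
  have T2: "(\<Sum>l<n. \<Sum>i<N. d i l * (s i l * \<tau> i l)) \<le> (\<gamma> * c / 8) * V + 2 * real n * real N / (\<gamma> * c)"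
  proof -
    have "d i l * (s i l * \<tau> i l) \<le> (\<gamma> * c / 8) * (d i l)^2 + 2 / (\<gamma> * c)" if "i < N" "l < n" for i l
    proof -
      have p: "\<gamma> * c > 0" using pos by simp
      have "d i l * (s i l * \<tau> i l) \<le> \<bar>d i l\<bar> * \<bar>s i l * \<tau> i l\<bar>" by (metis abs_ge_self abs_mult)
      also have "\<dots> \<le> \<bar>d i l\<bar>" using s[OF that] by (simp add: mult_left_le)
      also have "\<dots> \<le> (\<gamma> * c / 8) * (d i l)^2 + 2 / (\<gamma> * c)"
      proof -
        have "0 \<le> (\<gamma> * c * \<bar>d i l\<bar> - 4)^2 / (8 * (\<gamma> * c))" using p by simp
        also have "\<dots> = (\<gamma> * c / 8) * (d i l)^2 + 2 / (\<gamma> * c) - \<bar>d i l\<bar>"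
        proof -
          have "(g * y - 4)^2 / (8 * g) = (g / 8) * y^2 + 2 / g - y" if "g \<noteq> 0" for g y :: real
            using that by (simp add: power2_eq_square field_simps)
          from this[of "\<gamma> * c" "\<bar>d i l\<bar>"] pos show ?thesis by simp
        qed
        finally show ?thesis by simp
      qed
      finally show ?thesis .
    qed
    then have "(\<Sum>l<n. \<Sum>i<N. d i l * (s i l * \<tau> i l)) \<le> (\<Sum>l<n. \<Sum>i<N. (\<gamma> * c / 8) * (d i l)^2 + 2 / (\<gamma> * c))"
      by (intro sum_mono) auto
    also have "\<dots> = (\<gamma> * c / 8) * V + real n * (real N * (2 / (\<gamma> * c)))"
      by (simp add: sum.distrib V sum_distrib_left)
    finally show ?thesis by (simp add: ac_simps)
  qed
  \<comment> \<open>The factor 1/2 is that of the Dirichlet form, and \<open>c\<close> that of the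
    Poincare inequality.\<close>
  have T3: "(\<Sum>l<n. \<Sum>i<N. d i l * (\<Sum>j\<in>{j. j < N \<and> G i j}. x j l - x i l)) \<le> - (c / 2) * V"
  proof -
    have "(\<Sum>i<N. d i l * (\<Sum>j\<in>{j. j < N \<and> G i j}. x j l - x i l)) \<le> - (c / 2) * (\<Sum>i<N. (d i l)^2)" for l
    proof -
      have "x j l - x i l = d j l - d i l" for i j by (simp add: d_def)
      then show ?thesis
        using graph_dirichlet_form[OF sym, of "\<lambda>i. d i l"] poinc[OF d0, of l] by simp
    qed
    then show ?thesis unfolding V sum_distrib_left by (rule sum_mono)
  qed
  have p: "\<gamma> * c > 0" using pos by simp
  have split: "(\<Sum>l<n. \<Sum>i<N. d i l * (f i l + (\<kappa> * g i l + \<kappa> * (\<gamma> * h i l)))) =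
     (\<Sum>l<n. \<Sum>i<N. d i l * f i l) + (\<kappa> * (\<Sum>l<n. \<Sum>i<N. d i l * g i l)
      + \<kappa> * (\<gamma> * (\<Sum>l<n. \<Sum>i<N. d i l * h i l)))" for f g h :: "nat \<Rightarrow> nat \<Rightarrow> real"
    by (simp add: sum.distrib sum_distrib_left algebra_simps)
  have "(\<Sum>l<n. \<Sum>i<N. d i l * err_rate N n G s a \<kappa> \<gamma> \<tau> x i l) =
     (\<Sum>l<n. \<Sum>i<N. d i l * (\<Sum>k<n. a l k * x i k)) + \<kappa> * (\<Sum>l<n. \<Sum>i<N. d i l * (s i l * \<tau> i l))
      + \<kappa> * \<gamma> * (\<Sum>l<n. \<Sum>i<N. d i l * (\<Sum>j\<in>{j. j < N \<and> G i j}. x j l - x i l))"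
    using split[of "\<lambda>i l. \<Sum>k<n. a l k * x i k" "\<lambda>i l. s i l * \<tau> i l"]
    by (simp only: err_rate_def mult.assoc add.assoc)
  also have "\<dots> \<le> \<alpha> * V + \<kappa> * ((\<gamma> * c / 8) * V + 2 * real n * real N / (\<gamma> * c)) + \<kappa> * \<gamma> * (- (c / 2) * V)"
    using T1 T2 T3 pos by (intro add_mono mult_left_mono) auto
  also have "\<dots> \<le> - (\<kappa> * \<gamma> * c / 4) * V + 2 * \<kappa> * real n * real N / (\<gamma> * c)"
  proof -
    have "V \<ge> 0" by (auto simp: V intro!: sum_nonneg)
    then have "8 * \<alpha> * V \<le> \<kappa> * \<gamma> * c * V" using pos by (intro mult_right_mono) auto
    then show ?thesis by (simp add: algebra_simps)
  qed
  also have "\<dots> \<le> - (\<kappa> * \<gamma> * c / 4) * m + \<kappa> * \<gamma> * c / 8 * m"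
  proof -
    have "(\<kappa> * \<gamma> * c / 4) * m \<le> (\<kappa> * \<gamma> * c / 4) * V" using m(2) pos by (intro mult_left_mono) (auto simp: V_def)
    moreover have "2 * \<kappa> * real n * real N / (\<gamma> * c) = \<kappa> / (8 * (\<gamma> * c)) * (16 * real n * real N)" by simp
    moreover have "\<kappa> / (8 * (\<gamma> * c)) * (16 * real n * real N) \<le> \<kappa> / (8 * (\<gamma> * c)) * (m * (\<gamma> * c)^2)"
      using m(1) p pos by (intro mult_left_mono) auto
    moreover have "\<kappa> / (8 * (\<gamma> * c)) * (m * (\<gamma> * c)^2) = \<kappa> * \<gamma> * c / 8 * m"
      using p by (simp add: power2_eq_square)
    ultimately show ?thesis by linarith
  qed
  also have "\<dots> = - (\<kappa> * \<gamma> * c / 8) * m" by (simp add: algebra_simps)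
  finally show ?thesis unfolding d_def .
qed

text \<open>The inclusion holds in the sense of right difference quotients at every time; \<open>\<tau>\<close> may depend on \<open>h\<close>,
  and only the honest nodes \<open>H\<close> are required to respond to \<open>e\<close>.\<close>

definition err_inclusion ::
  "nat \<Rightarrow> nat \<Rightarrow> (nat \<Rightarrow> nat \<Rightarrow> bool) \<Rightarrow> (nat \<Rightarrow> nat \<Rightarrow> real) \<Rightarrow> (nat \<Rightarrow> nat \<Rightarrow> real) \<Rightarrow> real \<Rightarrow> real
   \<Rightarrow> nat set \<Rightarrow> (nat \<Rightarrow> nat \<Rightarrow> real \<Rightarrow> real) \<Rightarrow> (real \<Rightarrow> nat \<Rightarrow> nat \<Rightarrow> real) \<Rightarrow> bool" where
  "err_inclusion N n G s a \<kappa> \<gamma> H e x \<longleftrightarrow> (\<forall>t\<ge>0. \<forall>\<epsilon>>0. eventually (\<lambda>h. \<exists>\<tau>. \<forall>i<N. \<forall>l<n.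
      \<bar>s i l * \<tau> i l\<bar> \<le> 1 \<and>
      (i \<in> H \<and> s i l = 1 \<and> e i l t \<noteq> x t i l \<longrightarrow> \<tau> i l = sgn (e i l t - x t i l)) \<and>
      \<bar>x (t + h) i l - x t i l - h * err_rate N n G s a \<kappa> \<gamma> \<tau> (x t) i l\<bar> \<le> \<epsilon> * h) (at_right 0))"

section \<open>Decay of the disagreement over a small time step\<close>

lemma node_mean_add: "node_mean N (\<lambda>i l. x i l + y i l) l = node_mean N x l + node_mean N y l"
  by (simp add: node_mean_def sum.distrib add_divide_distrib)

text \<open>The mean minimises the sum of squared distances.\<close>

lemma disagreement_le: "disagreement N n y \<le> (\<Sum>l<n. \<Sum>i<N. (y i l)^2)"
proof -
  have "(\<Sum>i<N. (y i l - node_mean N y l)^2) \<le> (\<Sum>i<N. (y i l)^2)" for l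
  proof -
    have "(\<Sum>i<N. (y i l)^2) = (\<Sum>i<N. (y i l - node_mean N y l)^2 + (node_mean N y l)^2
            + (y i l - node_mean N y l) * (2 * node_mean N y l))"
      by (simp add: power2_eq_square algebra_simps)
    also have "\<dots> = (\<Sum>i<N. (y i l - node_mean N y l)^2) + real N * (node_mean N y l)^2
        + (\<Sum>i<N. y i l - node_mean N y l) * (2 * node_mean N y l)"
      by (simp add: sum.distrib sum_distrib_right)
    finally show ?thesis by (simp add: sum_deviation_zero)
  qed
  then show ?thesis unfolding disagreement_def by (rule sum_mono)
qed

text \<open>Second-order expansion of a quadratic form. Deviations are orthogonal to constants, so
  the increment enters the cross term without its mean. This is the chain rule in a form suited to
  difference quotients.\<close>

lemma disagreement_add_le:
  "disagreement N n (\<lambda>i l. x i l + y i l) \<le> disagreement N n x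
     + 2 * (\<Sum>l<n. \<Sum>i<N. (x i l - node_mean N x l) * y i l) + (\<Sum>l<n. \<Sum>i<N. (y i l)^2)"
proof -
  have "(\<Sum>i<N. (x i l + y i l - node_mean N (\<lambda>i l. x i l + y i l) l)^2) =
     (\<Sum>i<N. (x i l - node_mean N x l)^2) + 2 * (\<Sum>i<N. (x i l - node_mean N x l) * y i l)
     + (\<Sum>i<N. (y i l - node_mean N y l)^2)" for l
  proof -
    define d where "d i = x i l - node_mean N x l" for i
    have "(\<Sum>i<N. (x i l + y i l - node_mean N (\<lambda>i l. x i l + y i l) l)^2) =
      (\<Sum>i<N. (d i)^2 + 2 * (d i * y i l) + (y i l - node_mean N y l)^2 - d i * (2 * node_mean N y l))"
      by (simp add: node_mean_add d_def power2_eq_square algebra_simps)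
    also have "\<dots> = (\<Sum>i<N. (d i)^2) + 2 * (\<Sum>i<N. d i * y i l) + (\<Sum>i<N. (y i l - node_mean N y l)^2)
       - (\<Sum>i<N. d i) * (2 * node_mean N y l)"
      by (simp add: sum.distrib sum_subtractf sum_distrib_left sum_distrib_right)
    finally show ?thesis unfolding d_def by (simp add: sum_deviation_zero)
  qed
  then have "disagreement N n (\<lambda>i l. x i l + y i l) = disagreement N n x
     + 2 * (\<Sum>l<n. \<Sum>i<N. (x i l - node_mean N x l) * y i l) + disagreement N n y"
    by (simp add: disagreement_def sum.distrib sum_distrib_left)
  then show ?thesis using disagreement_le[of N n y] by linarith
qed

text \<open>The bound does not involve \<tau>, as the selection may change with the step
  size.\<close>

lemma abs_err_rate_le:
  assumes "\<bar>s i l * \<tau> i l\<bar> \<le> 1" "\<kappa> > 0"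
  shows "\<bar>err_rate N n G s a \<kappa> \<gamma> \<tau> x i l\<bar> \<le>
    \<bar>\<Sum>k<n. a l k * x i k\<bar> + \<kappa> + \<bar>\<kappa> * \<gamma> * (\<Sum>j\<in>{j. j < N \<and> G i j}. x j l - x i l)\<bar>"
proof -
  have "\<bar>\<kappa> * s i l * \<tau> i l\<bar> = \<kappa> * \<bar>s i l * \<tau> i l\<bar>" using assms by (simp add: abs_mult)
  also have "\<dots> \<le> \<kappa> * 1" using assms by (intro mult_left_mono) auto
  finally show ?thesis unfolding err_rate_def by linarith
qed

text \<open>By \<open>disagreement_rate\<close> the slope is at most -2 c1 to first order. The
  tolerance \<epsilon> costs c1/2 and the quadratic remainder another c1/2, which leaves the claimed
  slope -c1.\<close>

lemma disagreement_step:
  assumes sym: "\<forall>i<N. \<forall>j<N. G i j \<longleftrightarrow> G j i"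
    and poinc: "\<And>f::nat \<Rightarrow> real. (\<Sum>i<N. f i) = 0 \<Longrightarrow>
           c * (\<Sum>i<N. (f i)^2) \<le> (\<Sum>i<N. \<Sum>j\<in>{j. j < N \<and> G i j}. (f j - f i)^2)"
    and alpha: "(\<Sum>l<n. \<Sum>k<n. \<bar>a l k\<bar>) \<le> \<alpha>"
    and pos: "\<kappa> > 0" "\<gamma> > 0" "c > 0" "8 * \<alpha> \<le> \<kappa> * \<gamma> * c"
    and m: "m > 0" "16 * real n * real N \<le> m * (\<gamma> * c)^2" "m \<le> disagreement N n (x t)"
    and incl: "err_inclusion N n G s a \<kappa> \<gamma> H e x" and t: "0 \<le> t"
  shows "eventually (\<lambda>h. disagreement N n (x (t + h)) \<le> disagreement N n (x t) - (\<kappa> * \<gamma> * c / 8 * m) * h) (at_right 0)"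
proof -
  define c1 where "c1 = \<kappa> * \<gamma> * c / 8 * m"
  have c1: "c1 > 0" using pos m by (simp add: c1_def)
  define d where "d i l = x t i l - node_mean N (x t) l" for i l
  define S where "S = (\<Sum>l<n. \<Sum>i<N. \<bar>d i l\<bar>)"
  have S: "S \<ge> 0" unfolding S_def by (intro sum_nonneg) auto
  define b where "b i l = \<bar>\<Sum>k<n. a l k * x t i k\<bar> + \<kappa> + \<bar>\<kappa> * \<gamma> * (\<Sum>j\<in>{j. j < N \<and> G i j}. x t j l - x t i l)\<bar>" for i l
  have b0: "b i l \<ge> 0" for i l using pos by (simp add: b_def)
  define Rb where "Rb = (\<Sum>l<n. \<Sum>i<N. (b i l + 1)^2)"
  have Rb: "Rb \<ge> 0" unfolding Rb_def by (intro sum_nonneg) auto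
  define \<epsilon> where "\<epsilon> = min 1 (c1 / (4 * (S + 1)))"
  have eps: "\<epsilon> > 0" "\<epsilon> \<le> 1" using c1 S by (auto simp: \<epsilon>_def)
  have "\<epsilon> * S \<le> c1 / (4 * (S + 1)) * S" using S by (intro mult_right_mono) (auto simp: \<epsilon>_def)
  also have "\<dots> \<le> c1 / 4" using S c1 by (simp add: field_simps)
  finally have epsS: "\<epsilon> * S \<le> c1 / 4" .
  \<comment> \<open>Below this threshold the quadratic remainder \<open>h^2 * Rb\<close> is at most
    h c1 / 2.\<close>
  have small: "eventually (\<lambda>h::real. h < c1 / (2 * (Rb + 1))) (at_right 0)"
    unfolding eventually_at_right_0_iff using c1 Rb by (intro exI[of _ "c1 / (2 * (Rb + 1))"]) auto
  have pos_h: "eventually (\<lambda>h::real. 0 < h) (at_right 0)"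
    unfolding eventually_at_right_0_iff by (intro exI[of _ 1]) auto
  show ?thesis
    using incl[unfolded err_inclusion_def, rule_format, OF t eps(1)] small pos_h
  proof eventually_elim
    case (elim h)
    then obtain \<tau> where tau: "\<And>i l. i < N \<Longrightarrow> l < n \<Longrightarrow> \<bar>s i l * \<tau> i l\<bar> \<le> 1"
      and dx: "\<And>i l. i < N \<Longrightarrow> l < n \<Longrightarrow>
         \<bar>x (t + h) i l - x t i l - h * err_rate N n G s a \<kappa> \<gamma> \<tau> (x t) i l\<bar> \<le> \<epsilon> * h" by blast
    define r where "r = err_rate N n G s a \<kappa> \<gamma> \<tau> (x t)"
    define y where "y i l = x (t + h) i l - x t i l" for i l
    have rb: "\<bar>r i l\<bar> \<le> b i l" if "i < N" "l < n" for i l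
      unfolding r_def b_def using tau[OF that] pos by (intro abs_err_rate_le)
    have dr: "(\<Sum>l<n. \<Sum>i<N. d i l * r i l) \<le> - c1"
      unfolding d_def r_def c1_def
      using disagreement_rate[where a=a and x = "x t", OF sym poinc tau alpha pos m(2,3)] by simp
    have y1: "\<bar>y i l - h * r i l\<bar> \<le> \<epsilon> * h" if "i < N" "l < n" for i l
      using dx[OF that] by (simp add: y_def r_def)
    have "(\<Sum>l<n. \<Sum>i<N. d i l * y i l) \<le> (\<Sum>l<n. \<Sum>i<N. h * (d i l * r i l) + \<epsilon> * h * \<bar>d i l\<bar>)"
    proof (intro sum_mono)
      fix l i assume "l \<in> {..<n}" "i \<in> {..<N}"
      then have "\<bar>d i l\<bar> * \<bar>y i l - h * r i l\<bar> \<le> \<bar>d i l\<bar> * (\<epsilon> * h)"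
        using y1 by (intro mult_left_mono) auto
      then have "d i l * (y i l - h * r i l) \<le> \<bar>d i l\<bar> * (\<epsilon> * h)"
        unfolding abs_mult[symmetric] by linarith
      then show "d i l * y i l \<le> h * (d i l * r i l) + \<epsilon> * h * \<bar>d i l\<bar>" by (simp add: algebra_simps)
    qed
    also have "\<dots> = h * (\<Sum>l<n. \<Sum>i<N. d i l * r i l) + \<epsilon> * S * h"
      by (simp add: sum.distrib sum_distrib_left S_def ac_simps)
    also have "\<dots> \<le> h * (- c1) + c1 / 4 * h"
      using dr epsS elim(3) by (intro add_mono mult_left_mono mult_right_mono) auto
    finally have 1: "(\<Sum>l<n. \<Sum>i<N. d i l * y i l) \<le> - (3 * c1 / 4) * h" by (simp add: algebra_simps)
    have "(\<Sum>l<n. \<Sum>i<N. (y i l)^2) \<le> (\<Sum>l<n. \<Sum>i<N. h^2 * (b i l + 1)^2)"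
    proof (intro sum_mono)
      fix l i assume il: "l \<in> {..<n}" "i \<in> {..<N}"
      have "\<bar>y i l\<bar> \<le> \<bar>h * r i l\<bar> + \<epsilon> * h" using y1[of i l] il by auto
      also have "\<bar>h * r i l\<bar> = h * \<bar>r i l\<bar>" using elim(3) by (simp add: abs_mult)
      also have "h * \<bar>r i l\<bar> + \<epsilon> * h \<le> h * b i l + 1 * h"
        using rb[of i l] il elim(3) eps by (intro add_mono mult_left_mono mult_right_mono) auto
      finally have "\<bar>y i l\<bar> \<le> h * (b i l + 1)" by (simp add: algebra_simps)
      then have "\<bar>y i l\<bar>^2 \<le> (h * (b i l + 1))^2" by (intro power_mono) auto
      then show "(y i l)^2 \<le> h^2 * (b i l + 1)^2" by (simp add: power_mult_distrib)
    qed
    also have "\<dots> = h * (h * Rb)" by (simp add: Rb_def sum_distrib_left power2_eq_square mult.assoc)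
    also have "\<dots> \<le> h * (c1 / 2)"
    proof (intro mult_left_mono)
      have "h * Rb \<le> h * (Rb + 1)" using elim(3) by simp
      also have "\<dots> \<le> c1 / (2 * (Rb + 1)) * (Rb + 1)" using elim(2) Rb by (intro mult_right_mono) auto
      also have "\<dots> = c1 / 2" using Rb by (simp add: field_simps)
      finally show "h * Rb \<le> c1 / 2" .
    qed (use elim(3) in auto)
    finally have 2: "(\<Sum>l<n. \<Sum>i<N. (y i l)^2) \<le> h * (c1 / 2)" .
    have "disagreement N n (x (t + h)) \<le> disagreement N n (x t)
        + 2 * (\<Sum>l<n. \<Sum>i<N. d i l * y i l) + (\<Sum>l<n. \<Sum>i<N. (y i l)^2)"
      using disagreement_add_le[of N n "x t" y] by (simp add: y_def d_def)
    then show ?case using 1 2 unfolding c1_def[symmetric] by (simp add: algebra_simps)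
  qed
qed

section \<open>The honest majority and the mean\<close>

text \<open>Of the at least 2 q + 1 nodes with s = 1, at most q lie outside \<open>H\<close>, so the
  honest ones outnumber the others by at least one.\<close>

lemma honest_majority_sum:
  fixes s \<tau> :: "nat \<Rightarrow> real"
  assumes s01: "\<And>i. i < N \<Longrightarrow> s i \<in> {0, 1}"
    and maj: "2 * q + 1 \<le> card {i. i < N \<and> s i = 1}"
    and H: "H \<subseteq> {..<N}" "N \<le> card H + q"
    and le: "\<And>i. i < N \<Longrightarrow> s i = 1 \<Longrightarrow> \<tau> i \<le> 1"
    and hon: "\<And>i. i \<in> H \<Longrightarrow> s i = 1 \<Longrightarrow> \<tau> i = -1"
  shows "(\<Sum>i<N. s i * \<tau> i) \<le> -1"
proof -
  define P where "P = {i. i < N \<and> s i = 1}"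
  have fin: "finite P" "finite H" using H by (auto simp: P_def intro: finite_subset)
  have "card (P - H) \<le> card ({..<N} - H)" by (intro card_mono) (auto simp: P_def)
  also have "\<dots> = N - card H" using H fin by (subst card_Diff_subset) auto
  finally have c1: "card (P - H) \<le> q" using H by linarith
  have "card P = card (P \<inter> H) + card (P - H)"
    by (subst card_Un_disjoint[symmetric]) (use fin in \<open>auto intro!: arg_cong[of _ _ card]\<close>)
  then have c2: "card (P \<inter> H) \<ge> card (P - H) + 1" using maj c1 by (simp add: P_def)
  have "(\<Sum>i<N. s i * \<tau> i) = (\<Sum>i\<in>P. \<tau> i)"
    by (rule sum.mono_neutral_cong_right) (use s01 in \<open>auto simp: P_def\<close>)
  also have "\<dots> = (\<Sum>i\<in>P \<inter> H. \<tau> i) + (\<Sum>i\<in>P - H. \<tau> i)"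
    using fin(1) by (rule sum.Int_Diff)
  also have "(\<Sum>i\<in>P \<inter> H. \<tau> i) = (\<Sum>i\<in>P \<inter> H. -1)" by (intro sum.cong) (auto simp: hon P_def)
  also have "(\<Sum>i\<in>P - H. \<tau> i) \<le> (\<Sum>i\<in>P - H. 1)" by (intro sum_mono) (auto simp: le P_def)
  finally show ?thesis using c2 by simp
qed

text \<open>The factor \<open>sg\<close> treats both signs of the mean at once. Beyond E + D every
  honest node that sees coordinate \<open>l\<close> lies on the far side of its reference, so it
  votes -\<open>sg\<close>, and the total vote towards zero is at least 1. The gain N (\<alpha> R +
  2) pays N \<alpha> R for the plant and N for the tolerance 1 at each node, which leaves unit speed
  for the mean.\<close>

lemma node_mean_step:
  assumes sym: "\<forall>i<N. \<forall>j<N. G i j \<longleftrightarrow> G j i"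
    and s01: "\<And>i l. i < N \<Longrightarrow> l < n \<Longrightarrow> s i l \<in> {0, 1}"
    and maj: "\<And>l. l < n \<Longrightarrow> 2 * q + 1 \<le> card {i. i < N \<and> s i l = 1}"
    and H: "H \<subseteq> {..<N}" "N \<le> card H + q"
    and alpha: "(\<Sum>l<n. \<Sum>k<n. \<bar>a l k\<bar>) \<le> \<alpha>"
    and kappa: "real N * (\<alpha> * R + 2) \<le> \<kappa>" "R \<ge> 0" "\<kappa> > 0"
    and incl: "err_inclusion N n G s a \<kappa> \<gamma> H e x" and t: "0 \<le> t" and l: "l < n"
    and sg: "sg \<in> {1, -1::real}"
    and E: "\<And>i. i \<in> H \<Longrightarrow> s i l = 1 \<Longrightarrow> \<bar>e i l t\<bar> \<le> E"
    and D: "\<And>i. i < N \<Longrightarrow> \<bar>x t i l - node_mean N (x t) l\<bar> \<le> D"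
    and R: "\<And>k. k < n \<Longrightarrow> \<bar>node_mean N (x t) k\<bar> \<le> R"
    and big: "E + D < sg * node_mean N (x t) l"
  shows "eventually (\<lambda>h. sg * node_mean N (x (t + h)) l \<le> sg * node_mean N (x t) l - h) (at_right 0)"
proof -
  have "card {i. i < N \<and> s i l = 1} \<noteq> 0" using maj[OF l] by linarith
  then have N: "N > 0" by (cases "N = 0") auto
  have pos_h: "eventually (\<lambda>h::real. 0 < h) (at_right 0)"
    unfolding eventually_at_right_0_iff by (intro exI[of _ 1]) auto
  have one: "(0::real) < 1" by simp
  show ?thesis
    using incl[unfolded err_inclusion_def, rule_format, OF t one] pos_h
  proof eventually_elim
    case (elim h)
    then obtain \<tau> where tau: "\<And>i l. i < N \<Longrightarrow> l < n \<Longrightarrow> \<bar>s i l * \<tau> i l\<bar> \<le> 1"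
      and hon: "\<And>i l. i < N \<Longrightarrow> l < n \<Longrightarrow> i \<in> H \<Longrightarrow> s i l = 1 \<Longrightarrow> e i l t \<noteq> x t i l \<Longrightarrow>
          \<tau> i l = sgn (e i l t - x t i l)"
      and dx: "\<And>i l. i < N \<Longrightarrow> l < n \<Longrightarrow>
         \<bar>x (t + h) i l - x t i l - h * err_rate N n G s a \<kappa> \<gamma> \<tau> (x t) i l\<bar> \<le> h" by auto
    define r where "r = err_rate N n G s a \<kappa> \<gamma> \<tau> (x t)"
    have "(\<Sum>i<N. s i l * (sg * \<tau> i l)) \<le> -1"
    proof (rule honest_majority_sum[OF _ maj[OF l] H])
      show "s i l \<in> {0, 1}" if "i < N" for i using s01[OF that l] .
      show "sg * \<tau> i l \<le> 1" if "i < N" "s i l = 1" for i using tau[OF that(1) l] that sg by auto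
      show "sg * \<tau> i l = -1" if "i \<in> H" "s i l = 1" for i
      proof -
        have iN: "i < N" using that H by auto
        have "sg * (e i l t - x t i l) < 0"
          using E[OF that] D[OF iN] big sg by (auto simp: abs_le_iff)
        then show ?thesis using hon[OF iN l that] sg by (auto simp: sgn_if split: if_splits)
      qed
    qed
    then have maj1: "sg * (\<Sum>i<N. s i l * \<tau> i l) \<le> -1" by (simp add: sum_distrib_left ac_simps)
    have "\<bar>\<Sum>k<n. a l k * node_mean N (x t) k\<bar> \<le> (\<Sum>k<n. \<bar>a l k\<bar> * R)"
      by (rule order.trans[OF sum_abs]) (auto simp: abs_mult intro!: sum_mono mult_left_mono R)
    also have "\<dots> = (\<Sum>k<n. \<bar>a l k\<bar>) * R" unfolding sum_distrib_right ..
    also have "\<dots> \<le> \<alpha> * R"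
    proof (intro mult_right_mono kappa order.trans[OF _ alpha])
      show "(\<Sum>k<n. \<bar>a l k\<bar>) \<le> (\<Sum>l<n. \<Sum>k<n. \<bar>a l k\<bar>)"
        using l by (intro member_le_sum[of l "{..<n}" "\<lambda>l. \<Sum>k<n. \<bar>a l k\<bar>"] sum_nonneg) auto
    qed
    finally have aR: "sg * (\<Sum>k<n. a l k * node_mean N (x t) k) \<le> \<alpha> * R" using sg by auto
    have "sg * (\<Sum>i<N. r i l) = real N * (sg * (\<Sum>k<n. a l k * node_mean N (x t) k))
        + \<kappa> * (sg * (\<Sum>i<N. s i l * \<tau> i l))"
      unfolding r_def mean_rate[OF sym] by (simp add: algebra_simps)
    also have "\<dots> \<le> real N * (\<alpha> * R) + \<kappa> * (-1)"
      using aR maj1 kappa by (intro add_mono mult_left_mono) auto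
    also have "\<dots> \<le> - 2 * real N" using kappa(1) by (simp add: algebra_simps)
    finally have r1: "sg * (\<Sum>i<N. r i l) \<le> - 2 * real N" .
    have "\<bar>\<Sum>i<N. x (t + h) i l - x t i l - h * r i l\<bar> \<le> (\<Sum>i<N. h)"
      by (rule order.trans[OF sum_abs], rule sum_mono) (use dx l in \<open>auto simp: r_def\<close>)
    then have "\<bar>(\<Sum>i<N. x (t + h) i l) - (\<Sum>i<N. x t i l) - h * (\<Sum>i<N. r i l)\<bar> \<le> real N * h"
      by (simp add: sum_subtractf sum_distrib_left)
    then have "sg * (\<Sum>i<N. x (t + h) i l) - sg * (\<Sum>i<N. x t i l) \<le> h * (sg * (\<Sum>i<N. r i l)) + real N * h"
      using sg by (auto simp: abs_le_iff)
    also have "\<dots> \<le> h * (- 2 * real N) + real N * h" using r1 elim(2) by (intro add_mono mult_left_mono) auto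
    finally have "(sg * (\<Sum>i<N. x (t + h) i l) - sg * (\<Sum>i<N. x t i l)) / real N \<le> (- h * real N) / real N"
      by (intro divide_right_mono) (auto simp: algebra_simps)
    then show ?case using N by (simp add: node_mean_def diff_divide_distrib)
  qed
qed

text \<open>The means have to be kept in the box together, since the plant couples the coordinates
  and the step for one of them uses the bound on all.\<close>

lemma node_mean_invariant:
  assumes sym: "\<forall>i<N. \<forall>j<N. G i j \<longleftrightarrow> G j i"
    and s01: "\<And>i l. i < N \<Longrightarrow> l < n \<Longrightarrow> s i l \<in> {0, 1}"
    and maj: "\<And>l. l < n \<Longrightarrow> 2 * q + 1 \<le> card {i. i < N \<and> s i l = 1}"
    and H: "H \<subseteq> {..<N}" "N \<le> card H + q"
    and alpha: "(\<Sum>l<n. \<Sum>k<n. \<bar>a l k\<bar>) \<le> \<alpha>"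
    and kappa: "real N * (\<alpha> * R + 2) \<le> \<kappa>" "R \<ge> 0" "\<kappa> > 0"
    and incl: "err_inclusion N n G s a \<kappa> \<gamma> H e x"
    and cont: "\<And>i l. i < N \<Longrightarrow> l < n \<Longrightarrow> continuous_on {0..} (\<lambda>t. x t i l)"
    and E: "\<And>i l t. i \<in> H \<Longrightarrow> l < n \<Longrightarrow> 0 \<le> t \<Longrightarrow> s i l = 1 \<Longrightarrow> \<bar>e i l t\<bar> \<le> E"
    and D: "\<And>i l t. i < N \<Longrightarrow> l < n \<Longrightarrow> 0 \<le> t \<Longrightarrow> \<bar>x t i l - node_mean N (x t) l\<bar> \<le> D"
    and R0: "\<And>l. l < n \<Longrightarrow> \<bar>node_mean N (x 0) l\<bar> \<le> R" and R: "E + D < R"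
    and t: "0 \<le> t" and l: "l < n"
  shows "\<bar>node_mean N (x t) l\<bar> \<le> R"
proof -
  have cm: "continuous_on {0..} (\<lambda>t. node_mean N (x t) l)" if "l < n" for l
    unfolding node_mean_def divide_inverse by (intro continuous_intros cont) (use that in auto)
  define S where "S = {0..} \<inter> (\<Inter>l\<in>{..<n}. {t \<in> {0..}. \<bar>node_mean N (x t) l\<bar> \<le> R})"
  have "t \<in> S"
  proof (rule real_induct_closed[OF _ _ t])
    show "closed S" unfolding S_def
      by (intro closed_Int closed_INT ballI continuous_on_closed_Collect_le continuous_intros cm) auto
    show "0 \<in> S" using R0 by (auto simp: S_def)
    fix t assume "t \<in> S" and t0: "0 \<le> t"
    then have tS: "\<And>l. l < n \<Longrightarrow> \<bar>node_mean N (x t) l\<bar> \<le> R" by (auto simp: S_def)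
    have one: "eventually (\<lambda>h. sg * node_mean N (x (t + h)) l \<le> R) (at_right 0)"
      if l: "l < n" and sg: "sg \<in> {1, -1}" for l and sg :: real
    \<comment> \<open>Beyond E + D the mean is driven inwards; otherwise it is strictly inside
      because E + D < R, and continuity suffices.\<close>
    proof (cases "E + D < sg * node_mean N (x t) l")
      case True
      have "eventually (\<lambda>h. sg * node_mean N (x (t + h)) l \<le> sg * node_mean N (x t) l - h) (at_right 0)"
      proof (rule node_mean_step[OF sym s01 maj H alpha kappa incl t0 l sg])
        show "\<bar>e i l t\<bar> \<le> E" if "i \<in> H" "s i l = 1" for i using E l t0 that by blast
        show "\<bar>x t i l - node_mean N (x t) l\<bar> \<le> D" if "i < N" for i using D that l t0 by blast
        show "\<bar>node_mean N (x t) k\<bar> \<le> R" if "k < n" for k using tS that by blast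
        show "E + D < sg * node_mean N (x t) l" by (rule True)
      qed auto
      moreover have "eventually (\<lambda>h::real. 0 < h) (at_right 0)"
        unfolding eventually_at_right_0_iff by (intro exI[of _ 1]) auto
      ultimately show ?thesis
        by eventually_elim (use tS[OF l] sg in auto)
    next
      case False
      then have lt: "sg * node_mean N (x t) l < R" using R by linarith
      then obtain d where d: "d > 0"
        "\<And>u. u \<in> {0..} \<Longrightarrow> dist u t < d \<Longrightarrow> dist (node_mean N (x u) l) (node_mean N (x t) l) < R - sg * node_mean N (x t) l"
        using cm[OF l] t0 unfolding continuous_on_iff by (metis atLeast_iff diff_gt_0_iff_gt)
      have "sg * node_mean N (x (t + h)) l \<le> R" if "0 < h" "h < d" for h
        using d(2)[of "t + h"] that t0 sg by (auto simp: dist_real_def abs_less_iff)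
      then show ?thesis using d(1) unfolding eventually_at_right_0_iff by blast
    qed
    have "eventually (\<lambda>h. \<forall>l\<in>{..<n}. \<bar>node_mean N (x (t + h)) l\<bar> \<le> R) (at_right 0)"
      unfolding eventually_ball_finite_distrib[OF finite_lessThan]
    proof
      fix l assume "l \<in> {..<n}"
      then have "l < n" by simp
      show "eventually (\<lambda>h. \<bar>node_mean N (x (t + h)) l\<bar> \<le> R) (at_right 0)"
        using one[OF \<open>l < n\<close>, of 1, simplified] one[OF \<open>l < n\<close>, of "-1", simplified]
        by eventually_elim (auto simp: abs_le_iff)
    qed
    moreover have "eventually (\<lambda>h::real. 0 < h) (at_right 0)"
      unfolding eventually_at_right_0_iff by (intro exI[of _ 1]) auto
    ultimately show "eventually (\<lambda>h. t + h \<in> S) (at_right 0)"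
      by eventually_elim (use t0 in \<open>auto simp: S_def\<close>)
  qed
  then show ?thesis using l by (auto simp: S_def)
qed

lemma eventually_max_linear_le:
  fixes m b c t0 :: real
  assumes "c > 0" "m \<le> M"
  shows "eventually (\<lambda>t. max m (b - c * (t - t0)) \<le> M) at_top"
proof -
  have "eventually (\<lambda>t. t \<ge> t0 + (b - M) / c) at_top" by (rule eventually_ge_at_top)
  then show ?thesis
  proof eventually_elim
    case (elim t)
    then have "(b - M) / c \<le> t - t0" by simp
    then show ?case using assms by (simp add: pos_divide_le_eq mult.commute)
  qed
qed

section \<open>Ultimate bound for the error inclusion\<close>

text \<open>The constants are fixed without circularity: \<epsilon> and \<open>m\<close> by the
  tolerance, \<open>D0\<close> by \<open>m\<close> and the initial disagreement, \<open>R\<close> by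
  \<open>D0\<close> and \<open>M0\<close>, and only then the gains. The disagreement comes first:
  its bound for all times yields the box for the means, its ultimate bound the final
  estimate.\<close>

theorem robust_consensus:
  fixes N n q :: nat and \<eta> M0 :: real
  assumes sym: "\<forall>i<N. \<forall>j<N. G i j \<longleftrightarrow> G j i" and conn: "graph_connected N G"
    and s01: "\<And>i l. i < N \<Longrightarrow> l < n \<Longrightarrow> s i l \<in> {0, 1}"
    and maj: "\<And>l. l < n \<Longrightarrow> 2 * q + 1 \<le> card {i. i < N \<and> s i l = 1}"
    and H: "H \<subseteq> {..<N}" "N \<le> card H + q"
    and eta: "\<eta> > 0" and M0: "M0 \<ge> 0"
  shows "\<exists>\<kappa>s\<ge>0. \<exists>\<gamma>s\<ge>0. \<forall>\<kappa>>\<kappa>s. \<forall>\<gamma>>\<gamma>s. \<forall>e x.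
     err_inclusion N n G s a \<kappa> \<gamma> H e x \<longrightarrow>
     (\<forall>i<N. \<forall>l<n. continuous_on {0..} (\<lambda>t. x t i l) \<and> \<bar>x 0 i l\<bar> \<le> M0) \<longrightarrow>
     (\<forall>i\<in>H. \<forall>l<n. s i l = 1 \<longrightarrow> (\<forall>t\<ge>0. \<bar>e i l t\<bar> \<le> M0) \<and> (e i l \<longlongrightarrow> 0) at_top) \<longrightarrow>
     (\<forall>i<N. \<forall>l<n. eventually (\<lambda>t. \<bar>x t i l\<bar> \<le> \<eta>) at_top)"
proof -
  obtain c where c: "c > 0" and poinc: "\<And>f::nat \<Rightarrow> real. (\<Sum>i<N. f i) = 0 \<Longrightarrow>
           c * (\<Sum>i<N. (f i)^2) \<le> (\<Sum>i<N. \<Sum>j\<in>{j. j < N \<and> G i j}. (f j - f i)^2)"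
    using connected_graph_poincare[OF conn] by blast
  define \<alpha> where "\<alpha> = (\<Sum>l<n. \<Sum>k<n. \<bar>a l k\<bar>)"
  have alpha: "\<alpha> \<ge> 0" unfolding \<alpha>_def by (intro sum_nonneg) auto
  \<comment> \<open>One quarter is for the deviation of a node from the mean. The other three are
    for the mean: honest local errors, deviations, and a strict margin.\<close>
  define \<epsilon> where "\<epsilon> = \<eta> / 4"
  define m where "m = \<epsilon>^2"
  have eps: "\<epsilon> > 0" "m > 0" using eta by (auto simp: \<epsilon>_def m_def)
  \<comment> \<open>Covers the initial disagreement as well as the ultimate level \<open>m\<close>,
    hence all times.\<close>
  define D0 where "D0 = sqrt (max m (real n * (real N * M0^2)))"
  define R where "R = M0 + D0 + 1"
  have D0: "D0 \<ge> 0" using eps by (simp add: D0_def)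
  \<comment> \<open>The first summand serves \<open>node_mean_step\<close>; the second, together
    with \<gamma> \<ge> 1, gives 8 \<alpha> \<le> \<kappa> \<gamma> c. In \<open>\<gamma>s\<close>
    the square root is what brings the disagreement down to \<open>m\<close>.\<close>
  define \<kappa>s where "\<kappa>s = real N * (\<alpha> * R + 2) + 8 * \<alpha> / c + 1"
  define \<gamma>s where "\<gamma>s = 1 + sqrt (16 * real n * real N / m) / c"
  have ks: "\<kappa>s \<ge> 0" unfolding \<kappa>s_def using alpha c D0 M0 by (auto simp: R_def intro!: add_nonneg_nonneg mult_nonneg_nonneg)
  have gs: "\<gamma>s \<ge> 0" unfolding \<gamma>s_def using c eps by auto
  have main: "\<forall>i<N. \<forall>l<n. eventually (\<lambda>t. \<bar>x t i l\<bar> \<le> \<eta>) at_top"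
    if kappa: "\<kappa> > \<kappa>s" and gamma: "\<gamma> > \<gamma>s" and incl: "err_inclusion N n G s a \<kappa> \<gamma> H e x"
      and x: "\<forall>i<N. \<forall>l<n. continuous_on {0..} (\<lambda>t. x t i l) \<and> \<bar>x 0 i l\<bar> \<le> M0"
      and e: "\<forall>i\<in>H. \<forall>l<n. s i l = 1 \<longrightarrow> (\<forall>t\<ge>0. \<bar>e i l t\<bar> \<le> M0) \<and> (e i l \<longlongrightarrow> 0) at_top"
    for \<kappa> \<gamma> e x
  proof (cases "n = 0 \<or> N = 0")
    case False
    have cont: "continuous_on {0..} (\<lambda>t. x t i l)" if "i < N" "l < n" for i l using x that by blast
    have kpos: "\<kappa> > 0" using kappa ks by linarith
    have gpos: "\<gamma> > 0" using gamma gs by linarith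
    have pos4: "8 * \<alpha> \<le> \<kappa> * \<gamma> * c"
    proof -
      have "8 * \<alpha> / c \<le> \<kappa>s" unfolding \<kappa>s_def using alpha D0 M0 by (auto simp: R_def intro!: add_nonneg_nonneg mult_nonneg_nonneg)
      then have "8 * \<alpha> / c \<le> \<kappa> * 1" using kappa by linarith
      also have "\<dots> \<le> \<kappa> * \<gamma>" using gamma c eps kpos unfolding \<gamma>s_def
        by (intro mult_left_mono) (auto intro: order.trans[rotated, OF less_imp_le])
      finally show ?thesis using c by (simp add: pos_divide_le_eq)
    qed
    have m2: "16 * real n * real N \<le> m * (\<gamma> * c)^2"
    proof -
      have "sqrt (16 * real n * real N / m) / c \<le> \<gamma>" using gamma unfolding \<gamma>s_def by linarith
      then have "sqrt (16 * real n * real N / m) \<le> \<gamma> * c" using c by (simp add: pos_divide_le_eq)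
      then have "(sqrt (16 * real n * real N / m))^2 \<le> (\<gamma> * c)^2" by (intro power_mono) (use eps in auto)
      then have "16 * real n * real N / m \<le> (\<gamma> * c)^2" using eps by simp
      then show ?thesis using eps by (simp add: pos_divide_le_eq mult.commute)
    qed
    define V where "V t = disagreement N n (x t)" for t
    define c1 where "c1 = \<kappa> * \<gamma> * c / 8 * m"
    have c1: "c1 > 0" using kpos gpos c eps by (simp add: c1_def)
    have contV: "continuous_on {0..} V"
      unfolding V_def disagreement_def node_mean_def divide_inverse by (intro continuous_intros cont) auto
    have V0: "V 0 \<le> real n * (real N * M0^2)"
    proof -
      have "V 0 \<le> (\<Sum>l<n. \<Sum>i<N. (x 0 i l)^2)" unfolding V_def by (rule disagreement_le)
      also have "\<dots> \<le> (\<Sum>l<n. \<Sum>i<N. M0^2)"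
        using x by (intro sum_mono) (simp add: abs_le_square_iff[symmetric] M0)
      finally show ?thesis by simp
    qed
    have Vt: "V t \<le> max m (V 0 - c1 * (t - 0))" if "0 \<le> t" for t
      using contV _ that
    proof (rule decay_by_small_steps)
      fix t :: real assume "0 \<le> t" "m \<le> V t"
      then show "eventually (\<lambda>h. V (t + h) \<le> V t - c1 * h) (at_right 0)"
        unfolding V_def c1_def
        by (intro disagreement_step[OF sym poinc _ kpos gpos c pos4 eps(2) m2 _ incl]) (auto simp: \<alpha>_def)
    qed (use c1 in auto)
    have dev: "\<bar>x t i l - node_mean N (x t) l\<bar> \<le> sqrt (V t)" if "i < N" "l < n" for t i l
    proof -
      have "(x t i l - node_mean N (x t) l)^2 \<le> (\<Sum>i<N. (x t i l - node_mean N (x t) l)^2)"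
        using that by (intro member_le_sum) auto
      also have "\<dots> \<le> V t" unfolding V_def disagreement_def
        using that by (intro member_le_sum[of l "{..<n}" "\<lambda>l. \<Sum>i<N. (x t i l - node_mean N (x t) l)^2"] sum_nonneg) auto
      finally show ?thesis by (rule real_le_rsqrt[of "\<bar>_\<bar>", simplified])
    qed
    have D: "\<bar>x t i l - node_mean N (x t) l\<bar> \<le> D0" if "i < N" "l < n" "0 \<le> t" for t i l
    proof -
      have "V t \<le> max m (real n * (real N * M0^2))"
        using Vt[OF that(3)] V0 c1 that(3) by (smt (verit) mult_nonneg_nonneg)
      then show ?thesis using dev[OF that(1,2), of t] unfolding D0_def
        by (meson order.trans real_sqrt_le_mono)
    qed
    have kR: "real N * (\<alpha> * R + 2) \<le> \<kappa>"
      using kappa alpha c unfolding \<kappa>s_def by (smt (verit) divide_nonneg_pos)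
    have R: "\<bar>node_mean N (x t) l\<bar> \<le> R" if "0 \<le> t" "l < n" for t l
    proof (rule node_mean_invariant[OF sym s01 maj H _ kR _ kpos incl cont])
      show "(\<Sum>l<n. \<Sum>k<n. \<bar>a l k\<bar>) \<le> \<alpha>" by (simp add: \<alpha>_def)
      show "R \<ge> 0" using M0 D0 by (simp add: R_def)
      show "\<bar>e i l t\<bar> \<le> M0" if "i \<in> H" "l < n" "0 \<le> t" "s i l = 1" for i l t using e that by blast
      show "\<bar>x t i l - node_mean N (x t) l\<bar> \<le> D0" if "i < N" "l < n" "0 \<le> t" for i l t by (rule D[OF that])
      show "M0 + D0 < R" by (simp add: R_def)
      show "\<bar>node_mean N (x 0) l\<bar> \<le> R" if "l < n" for l
      proof -
        have "\<bar>\<Sum>i<N. x 0 i l\<bar> \<le> (\<Sum>i<N. M0)" using x that by (intro order.trans[OF sum_abs] sum_mono) auto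
        then have "\<bar>node_mean N (x 0) l\<bar> \<le> M0" using False by (simp add: node_mean_def abs_divide pos_divide_le_eq mult.commute)
        then show ?thesis using D0 by (simp add: R_def)
      qed
    qed (use that in auto)
    have Hfin: "finite H" using H finite_subset by blast
    have "eventually (\<lambda>t. V t \<le> m) at_top"
      using eventually_max_linear_le[OF c1 order.refl, of m "V 0" 0] eventually_ge_at_top[of 0]
      by eventually_elim (use Vt in force)
    moreover have "eventually (\<lambda>t. \<forall>i\<in>H. \<forall>l\<in>{..<n}. s i l = 1 \<longrightarrow> \<bar>e i l t\<bar> \<le> \<epsilon>) at_top"
      unfolding eventually_ball_finite_distrib[OF Hfin] eventually_ball_finite_distrib[OF finite_lessThan]
    proof (intro ballI)
      fix i l assume il: "i \<in> H" "l \<in> {..<n}"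
      show "eventually (\<lambda>t. s i l = 1 \<longrightarrow> \<bar>e i l t\<bar> \<le> \<epsilon>) at_top"
      proof (cases "s i l = 1")
        case True
        then have "(e i l \<longlongrightarrow> 0) at_top" using e il by blast
        then have "eventually (\<lambda>t. dist (e i l t) 0 < \<epsilon>) at_top" using eps(1) by (rule tendstoD)
        then show ?thesis by eventually_elim (simp add: dist_real_def)
      qed simp
    qed
    ultimately have "eventually (\<lambda>t. V t \<le> m \<and> (\<forall>i\<in>H. \<forall>l\<in>{..<n}. s i l = 1 \<longrightarrow> \<bar>e i l t\<bar> \<le> \<epsilon>)) at_top"
      by (rule eventually_conj)
    then obtain t1 where t1: "\<And>t. t \<ge> t1 \<Longrightarrow> V t \<le> m \<and> (\<forall>i\<in>H. \<forall>l\<in>{..<n}. s i l = 1 \<longrightarrow> \<bar>e i l t\<bar> \<le> \<epsilon>)"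
      unfolding eventually_at_top_linorder by blast
    define t2 where "t2 = max t1 0"
    have dev2: "\<bar>x t i l - node_mean N (x t) l\<bar> \<le> \<epsilon>" if "i < N" "l < n" "t2 \<le> t" for t i l
    proof -
      have "sqrt (V t) \<le> sqrt m" using t1[of t] that by (auto simp: t2_def)
      also have "\<dots> = \<epsilon>" using eps by (simp add: m_def)
      finally show ?thesis using dev[OF that(1,2), of t] by linarith
    qed
    \<comment> \<open>From \<open>t2\<close> on, honest errors and deviations are at most
      \<epsilon>, so the signed mean falls at unit speed as long as it is at least 3 \<epsilon>,
      strictly above their sum.\<close>
    have mean: "eventually (\<lambda>t. sg * node_mean N (x t) l \<le> 3 * \<epsilon>) at_top"
      if l: "l < n" and sg: "sg \<in> {1, -1}" for l and sg :: real
    proof -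
      have le: "sg * node_mean N (x t) l \<le> max (3 * \<epsilon>) (sg * node_mean N (x t2) l - 1 * (t - t2))" if "t2 \<le> t" for t
      proof (rule decay_by_small_steps[OF _ _ that])
        show "continuous_on {t2..} (\<lambda>t. sg * node_mean N (x t) l)"
          unfolding node_mean_def divide_inverse
          by (intro continuous_intros continuous_on_subset[OF cont]) (use l in \<open>auto simp: t2_def\<close>)
        fix t assume t: "t2 \<le> t" "3 * \<epsilon> \<le> sg * node_mean N (x t) l"
        have "eventually (\<lambda>h. sg * node_mean N (x (t + h)) l \<le> sg * node_mean N (x t) l - h) (at_right 0)"
        proof (rule node_mean_step[OF sym s01 maj H _ kR _ kpos incl _ l sg])
          show "(\<Sum>l<n. \<Sum>k<n. \<bar>a l k\<bar>) \<le> \<alpha>" by (simp add: \<alpha>_def)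
          show "R \<ge> 0" using M0 D0 by (simp add: R_def)
          show "0 \<le> t" using t by (simp add: t2_def)
          show "\<bar>e i l t\<bar> \<le> \<epsilon>" if "i \<in> H" "s i l = 1" for i using t1[of t] t l that by (auto simp: t2_def)
          show "\<bar>x t i l - node_mean N (x t) l\<bar> \<le> \<epsilon>" if "i < N" for i using dev2 that l t by blast
          show "\<bar>node_mean N (x t) k\<bar> \<le> R" if "k < n" for k using R[of t k] that t by (simp add: t2_def)
          show "\<epsilon> + \<epsilon> < sg * node_mean N (x t) l" using t eps by linarith
        qed auto
        then show "eventually (\<lambda>h. sg * node_mean N (x (t + h)) l \<le> sg * node_mean N (x t) l - 1 * h) (at_right 0)" by simp
      qed simp
      show ?thesis
        using eventually_max_linear_le[of 1 "3 * \<epsilon>" "3 * \<epsilon>" "sg * node_mean N (x t2) l" t2, simplified] eventually_ge_at_top[of t2]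
        by eventually_elim (use le in force)
    qed
    show ?thesis
    proof (intro allI impI)
      fix i l assume il: "i < N" "l < n"
      show "eventually (\<lambda>t. \<bar>x t i l\<bar> \<le> \<eta>) at_top"
        using mean[OF il(2), of 1, simplified] mean[OF il(2), of "-1", simplified] eventually_ge_at_top[of t2]
      proof eventually_elim
        case (elim t)
        then show ?case using dev2[OF il, of t] unfolding \<epsilon>_def abs_le_iff by linarith
      qed
    qed
  qed auto
  show ?thesis
    by (intro exI[of _ \<kappa>s] exI[of _ \<gamma>s] conjI ks gs,
        (rule allI, rule impI)+, (rule allI)+, (rule impI)+, rule main)
qed

section \<open>Exponential decay of Hurwitz systems\<close>

text \<open>With M = P B Q, the variables u = Q y turn y' = M y into u' = B u with \<open>B\<close>
  upper triangular, and y = P u. The Schur form is unpacked into entry functions, so that what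
  follows concerns finite sums. The diagonal of \<open>B\<close> consists of roots of the
  characteristic polynomial, hence of eigenvalues.\<close>

lemma hurwitz_triangularization:
  assumes M: "M \<in> carrier_mat d d" and hw: "hurwitz M"
  obtains B P Q :: "nat \<Rightarrow> nat \<Rightarrow> complex" where
    "\<And>k i. k < d \<Longrightarrow> i < d \<Longrightarrow> (\<Sum>j<d. Q k j * complex_of_real (M $$ (j, i))) = (\<Sum>j<d. B k j * Q j i)"
    "\<And>k i. k < d \<Longrightarrow> i < d \<Longrightarrow> (\<Sum>j<d. P k j * Q j i) = (if k = i then 1 else 0)"
    "\<And>k i. k < d \<Longrightarrow> i < k \<Longrightarrow> B k i = 0"
    "\<And>k. k < d \<Longrightarrow> Re (B k k) < 0"
proof -
  define Mc where "Mc = map_mat complex_of_real M"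
  have Mc: "Mc \<in> carrier_mat d d" using M by (simp add: Mc_def)
  obtain es where es: "char_poly Mc = (\<Prod>e\<leftarrow>es. [:- e, 1:])" "length es = d"
    using char_poly_factorized[OF Mc] by blast
  obtain B P Q where sd: "schur_decomposition Mc es = (B, P, Q)" by (cases "schur_decomposition Mc es") auto
  have sim: "similar_mat_wit Mc B P Q" and tri: "upper_triangular B" and diag: "diag_mat B = es"
    using schur_decomposition[OF Mc es(1) sd] by auto
  have carr: "B \<in> carrier_mat d d" "P \<in> carrier_mat d d" "Q \<in> carrier_mat d d"
    and eq: "Mc = P * B * Q" "P * Q = 1\<^sub>m d" "Q * P = 1\<^sub>m d"
    using similar_mat_witD2[OF Mc sim] by auto
  have "Q * Mc = (Q * P) * (B * Q)" using carr unfolding eq(1)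
    by (simp add: assoc_mult_mat[of _ d d _ d _ d])
  also have "\<dots> = B * Q" using carr unfolding eq(3) by simp
  finally have QM: "Q * Mc = B * Q" .
  have ent: "(X * Y) $$ (k, i) = (\<Sum>j<d. X $$ (k, j) * Y $$ (j, i))"
    if "X \<in> carrier_mat d d" "Y \<in> carrier_mat d d" "k < d" "i < d" for X Y :: "complex mat" and k i
    using that by (auto simp: scalar_prod_def atLeast0LessThan intro!: sum.cong)
  show ?thesis
  proof (rule that[of "\<lambda>k j. Q $$ (k, j)" "\<lambda>k j. B $$ (k, j)" "\<lambda>k j. P $$ (k, j)"])
    show "(\<Sum>j<d. Q $$ (k, j) * complex_of_real (M $$ (j, i))) = (\<Sum>j<d. B $$ (k, j) * Q $$ (j, i))"
      if "k < d" "i < d" for k i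
      using ent[OF carr(3) Mc that] ent[OF carr(1,3) that] QM that M by (simp add: Mc_def)
    show "(\<Sum>j<d. P $$ (k, j) * Q $$ (j, i)) = (if k = i then 1 else 0)" if "k < d" "i < d" for k i
      using ent[OF carr(2,3) that] eq(2) that by simp
    show "B $$ (k, i) = 0" if "k < d" "i < k" for k i
      using tri that carr by (auto simp: upper_triangular_def)
    show "Re (B $$ (k, k)) < 0" if "k < d" for k
    proof -
      have "B $$ (k, k) = es ! k" using diag carr that by (auto simp: diag_mat_def)
      then have "poly (char_poly Mc) (B $$ (k, k)) = 0"
        unfolding es(1) using that es(2) by (auto simp: poly_prod_list prod_list_zero_iff)
      then have "eigenvalue Mc (B $$ (k, k))" using eigenvalue_root_char_poly[OF Mc] by blast
      then show ?thesis using hw by (simp add: hurwitz_def Mc_def)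
    qed
  qed
qed

text \<open>Gronwall's inequality in differential form. The rate may have either sign: negative for
  Hurwitz decay, positive for the Cauchy estimate of approximate solutions.\<close>

lemma exp_decay_of_deriv:
  fixes W W' :: "real \<Rightarrow> real"
  assumes der: "\<And>t. t \<ge> 0 \<Longrightarrow> (W has_real_derivative W' t) (at t within {0..})"
    and le: "\<And>t. t \<ge> 0 \<Longrightarrow> W' t \<le> \<rho> * W t" and t: "t \<ge> 0"
  shows "W t \<le> exp (\<rho> * t) * W 0"
proof -
  define f where "f t = exp (- \<rho> * t) * W t" for t
  have d: "(f has_real_derivative (exp (- \<rho> * t) * (W' t - \<rho> * W t))) (at t within {0..})" if "t \<ge> 0" for t
    unfolding f_def by (rule derivative_eq_intros der that refl | simp)+ (simp add: algebra_simps)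
  have "f t \<le> f 0"
  proof (rule DERIV_nonpos_imp_decreasing_open[OF t])
    fix x assume x: "0 < x" "x < t"
    have "at x within {0..} = at x" using x by (intro at_within_interior) simp
    then have "(f has_real_derivative (exp (- \<rho> * x) * (W' x - \<rho> * W x))) (at x)" using d[of x] x by simp
    moreover have "exp (- \<rho> * x) * (W' x - \<rho> * W x) \<le> 0" using le[of x] x by (simp add: mult_nonneg_nonpos)
    ultimately show "\<exists>y. DERIV f x :> y \<and> y \<le> 0" by blast
  next
    show "continuous_on {0..t} f"
      using DERIV_continuous_on[of "{0..}" f, OF d] by (rule continuous_on_subset) auto
  qed
  then have "exp (\<rho> * t) * (exp (- \<rho> * t) * W t) \<le> exp (\<rho> * t) * W 0" by (simp add: f_def)
  then show ?thesis by (simp add: mult.assoc[symmetric] exp_add[symmetric])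
qed

text \<open>Weighting the k-th Schur coordinate by \<open>\<tau>^k\<close> shrinks the entries above
  the diagonal by at least the factor \<tau>, so for large \<tau> the damping on the diagonal
  absorbs them in the weighted square norm \<open>W\<close>. The constants are uniform over all
  solutions, which later allows them to be fixed before the gains.\<close>

theorem hurwitz_exp_decay:
  assumes M: "M \<in> carrier_mat d d" and hw: "hurwitz M"
  shows "\<exists>C\<ge>0. \<exists>\<beta>>0. \<forall>y :: nat \<Rightarrow> real \<Rightarrow> real.
    (\<forall>k<d. \<forall>t\<ge>0. (y k has_real_derivative (\<Sum>j<d. M $$ (k, j) * y j t)) (at t within {0..})) \<longrightarrow>
    (\<forall>k<d. \<forall>t\<ge>0. \<bar>y k t\<bar> \<le> C * exp (- \<beta> * t) * (\<Sum>j<d. \<bar>y j 0\<bar>))"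
proof -
  obtain B P Q :: "nat \<Rightarrow> nat \<Rightarrow> complex" where
    QM: "\<And>k i. k < d \<Longrightarrow> i < d \<Longrightarrow> (\<Sum>j<d. Q k j * complex_of_real (M $$ (j, i))) = (\<Sum>j<d. B k j * Q j i)"
    and PQ: "\<And>k i. k < d \<Longrightarrow> i < d \<Longrightarrow> (\<Sum>j<d. P k j * Q j i) = (if k = i then 1 else 0)"
    and tri: "\<And>k i. k < d \<Longrightarrow> i < k \<Longrightarrow> B k i = 0"
    and neg: "\<And>k. k < d \<Longrightarrow> Re (B k k) < 0"
    by (rule hurwitz_triangularization[OF M hw]) (rule that, assumption+)
  \<comment> \<open>The inserted 1 makes the minimum meaningful for d = 0.\<close>
  define \<rho> where "\<rho> = Min (insert 1 ((\<lambda>k. - Re (B k k)) ` {..<d}))"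
  have rho: "\<rho> > 0" unfolding \<rho>_def using neg by (subst Min_gr_iff) auto
  have rho_le: "Re (B k k) \<le> - \<rho>" if "k < d" for k
  proof -
    have "\<rho> \<le> - Re (B k k)" unfolding \<rho>_def using that by (intro Min_le) auto
    then show ?thesis by simp
  qed
  define b where "b = (\<Sum>k<d. \<Sum>j<d. cmod (B k j))"
  have b0: "b \<ge> 0" unfolding b_def by (intro sum_nonneg) auto
  have b: "cmod (B k j) \<le> b" if "k < d" "j < d" for k j
  proof -
    have "cmod (B k j) \<le> (\<Sum>j<d. cmod (B k j))" using that by (intro member_le_sum) auto
    also have "\<dots> \<le> b" unfolding b_def
      using that by (intro member_le_sum[of k "{..<d}" "\<lambda>k. \<Sum>j<d. cmod (B k j)"] sum_nonneg) auto
    finally show ?thesis .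
  qed
  \<comment> \<open>Chosen so that 2 d b / \<tau> \<le> \<rho>: half of the damping -2 \<rho>
    survives the terms above the diagonal.\<close>
  define \<tau> where "\<tau> = 1 + 2 * real d * b / \<rho>"
  have tau: "\<tau> \<ge> 1" using b0 rho by (simp add: \<tau>_def)
  have tau2: "2 * real d * (b / \<tau>) \<le> \<rho>"
  proof -
    have "2 * real d * b \<le> \<rho> * \<tau>" using rho by (simp add: \<tau>_def distrib_left)
    then show ?thesis using tau by (simp add: pos_divide_le_eq)
  qed
  define q where "q = (\<Sum>k<d. \<Sum>j<d. cmod (Q k j))"
  define p where "p = (\<Sum>k<d. \<Sum>j<d. cmod (P k j))"
  have q0: "q \<ge> 0" and p0: "p \<ge> 0" unfolding q_def p_def by (auto intro!: sum_nonneg)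
  have row_le: "(\<Sum>j<d. cmod (R k j)) \<le> (\<Sum>k<d. \<Sum>j<d. cmod (R k j))" if "k < d" for R :: "nat \<Rightarrow> nat \<Rightarrow> complex" and k
    using that by (intro member_le_sum[of k "{..<d}" "\<lambda>k. \<Sum>j<d. cmod (R k j)"] sum_nonneg) auto
  define S where "S = (\<Sum>k<d. \<tau>^k)"
  have S0: "S \<ge> 0" unfolding S_def using tau by (intro sum_nonneg) auto
  \<comment> \<open>Here \<open>q\<close> bounds the passage to Schur coordinates at time 0, and
    \<open>p\<close> the way back at time t.\<close>
  define C where "C = p * (sqrt (\<Sum>k<d. (\<tau>^k * q)^2))"
  have C0: "C \<ge> 0" unfolding C_def using p0 by (intro mult_nonneg_nonneg real_sqrt_ge_zero sum_nonneg) auto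
  have "\<bar>y k t\<bar> \<le> C * exp (- (\<rho> / 2) * t) * (\<Sum>j<d. \<bar>y j 0\<bar>)"
    if der: "\<forall>k<d. \<forall>t\<ge>0. (y k has_real_derivative (\<Sum>j<d. M $$ (k, j) * y j t)) (at t within {0..})"
      and k: "k < d" and t: "t \<ge> 0" for y :: "nat \<Rightarrow> real \<Rightarrow> real" and k t
  proof -
    define y' where "y' k t = (\<Sum>j<d. M $$ (k, j) * y j t)" for k t
    define u where "u k t = (\<Sum>j<d. Q k j * complex_of_real (y j t))" for k t
    define u' where "u' k t = (\<Sum>j<d. B k j * u j t)" for k t
    have u': "u' k t = (\<Sum>j<d. Q k j * complex_of_real (y' j t))" if "k < d" for k t
    proof -
      have "(\<Sum>j<d. Q k j * complex_of_real (y' j t)) = (\<Sum>j<d. \<Sum>i<d. Q k j * complex_of_real (M $$ (j, i)) * complex_of_real (y i t))"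
        by (simp add: y'_def sum_distrib_left mult.assoc)
      also have "\<dots> = (\<Sum>i<d. (\<Sum>j<d. Q k j * complex_of_real (M $$ (j, i))) * complex_of_real (y i t))"
        by (subst sum.swap) (simp add: sum_distrib_right)
      also have "\<dots> = (\<Sum>i<d. (\<Sum>j<d. B k j * Q j i) * complex_of_real (y i t))"
        by (intro sum.cong refl) (simp add: QM that)
      also have "\<dots> = (\<Sum>j<d. \<Sum>i<d. B k j * Q j i * complex_of_real (y i t))"
        unfolding sum_distrib_right by (rule sum.swap)
      also have "\<dots> = u' k t" by (simp add: u'_def u_def sum_distrib_left mult.assoc)
      finally show ?thesis ..
    qed
    have dRe: "((\<lambda>t. Re (u k t)) has_real_derivative Re (u' k t)) (at t within {0..})"
      and dIm: "((\<lambda>t. Im (u k t)) has_real_derivative Im (u' k t)) (at t within {0..})" if "k < d" "t \<ge> 0" for k t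
      unfolding u'[OF that(1)] u_def Re_sum Im_sum
      by (auto intro!: derivative_eq_intros der[rule_format] that simp: y'_def mult.commute)
    define v where "v k t = \<tau>^k * cmod (u k t)" for k t
    define W where "W t = (\<Sum>k<d. (\<tau>^k)^2 * ((Re (u k t))^2 + (Im (u k t))^2))" for t
    define W' where "W' t = (\<Sum>k<d. (\<tau>^k)^2 * (2 * Re (cnj (u k t) * u' k t)))" for t
    have Wv: "W t = (\<Sum>k<d. (v k t)^2)" for t
      by (simp add: W_def v_def power_mult_distrib cmod_power2)
    have dW: "(W has_real_derivative W' t) (at t within {0..})" if "t \<ge> 0" for t
      unfolding W_def[abs_def] W'_def
    proof (rule DERIV_sum)
      fix k assume "k \<in> {..<d}"
      then have "k < d" by simp
      show "((\<lambda>t. (\<tau>^k)^2 * ((Re (u k t))^2 + (Im (u k t))^2)) has_real_derivative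
          (\<tau>^k)^2 * (2 * Re (cnj (u k t) * u' k t))) (at t within {0..})"
        by (rule DERIV_cong[OF DERIV_cmult[OF DERIV_add[OF
              DERIV_power[OF dRe[OF \<open>k < d\<close> that]] DERIV_power[OF dIm[OF \<open>k < d\<close> that]]]]])
          (simp add: algebra_simps)
    qed
    have W'le: "W' t \<le> - \<rho> * W t" for t
    proof -
      have trm: "(\<tau>^k)^2 * (2 * Re (cnj (u k t) * (B k j * u j t)))
         \<le> (if j = k then - 2 * \<rho> * (v k t)^2 else 0) + b / \<tau> * ((v k t)^2 + (v j t)^2)"
        if kj: "k < d" "j < d" for k j
      proof -
        have nn: "0 \<le> b / \<tau> * ((v k t)^2 + (v j t)^2)" using b0 tau by simp
        \<comment> \<open>Entries below the diagonal vanish and the diagonal damps. For k < j, the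
          inequality \<open>\<tau>^Suc k \<le> \<tau>^j\<close> moves one factor \<tau> onto the
          other coordinate and leaves 1/\<tau> in front.\<close>
        consider "j < k" | "j = k" | "k < j" by linarith
        then show ?thesis
        proof cases
          case 1 then show ?thesis using tri kj nn by simp
        next
          case 2
          have "Re (cnj (u k t) * (B k k * u k t)) = Re (B k k) * (cmod (u k t))^2"
            unfolding cmod_power2 by (simp add: power2_eq_square algebra_simps)
          also have "\<dots> \<le> - \<rho> * (cmod (u k t))^2" using rho_le[OF kj(1)] by (intro mult_right_mono) auto
          finally have "(\<tau>^k)^2 * (2 * Re (cnj (u k t) * (B k k * u k t))) \<le> (\<tau>^k)^2 * (2 * (- \<rho> * (cmod (u k t))^2))"
            by (intro mult_left_mono) auto
          also have "\<dots> = - 2 * \<rho> * (v k t)^2" by (simp add: v_def power_mult_distrib)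
          finally show ?thesis using 2 nn by simp
        next
          case 3
          have "Re (cnj (u k t) * (B k j * u j t)) \<le> cmod (cnj (u k t) * (B k j * u j t))" by (rule complex_Re_le_cmod)
          also have "\<dots> = cmod (B k j) * (cmod (u k t) * cmod (u j t))" by (simp add: norm_mult)
          also have "\<dots> \<le> b * (cmod (u k t) * cmod (u j t))" using b[OF kj] by (intro mult_right_mono) auto
          finally have "(\<tau>^k)^2 * (2 * Re (cnj (u k t) * (B k j * u j t))) \<le> (\<tau>^k)^2 * (2 * (b * (cmod (u k t) * cmod (u j t))))"
            by (intro mult_left_mono) auto
          also have "\<dots> = b / \<tau> * (2 * (v k t * (\<tau>^Suc k * cmod (u j t))))"
            using tau by (simp add: v_def power2_eq_square)
          also have "\<dots> \<le> b / \<tau> * (2 * (v k t * v j t))"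
          proof -
            have "\<tau>^Suc k \<le> \<tau>^j" using 3 tau by (intro power_increasing) auto
            then show ?thesis unfolding v_def using tau b0
              by (intro mult_left_mono mult_right_mono) auto
          qed
          also have "\<dots> \<le> b / \<tau> * ((v k t)^2 + (v j t)^2)"
            using b0 tau zero_le_power2[of "v k t - v j t"]
            by (intro mult_left_mono) (auto simp: power2_eq_square algebra_simps)
          finally show ?thesis using 3 by simp
        qed
      qed
      have "W' t = (\<Sum>k<d. \<Sum>j<d. (\<tau>^k)^2 * (2 * Re (cnj (u k t) * (B k j * u j t))))"
        unfolding W'_def u'_def sum_distrib_left Re_sum ..
      also have "\<dots> \<le> (\<Sum>k<d. \<Sum>j<d. (if j = k then - 2 * \<rho> * (v k t)^2 else 0) + b / \<tau> * ((v k t)^2 + (v j t)^2))"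
        by (intro sum_mono trm) auto
      also have "\<dots> = (\<Sum>k<d. - 2 * \<rho> * (v k t)^2 + b / \<tau> * (real d * (v k t)^2 + W t))"
      proof (intro sum.cong refl)
        fix k assume "k \<in> {..<d}"
        then show "(\<Sum>j<d. (if j = k then - 2 * \<rho> * (v k t)^2 else 0) + b / \<tau> * ((v k t)^2 + (v j t)^2)) =
          - 2 * \<rho> * (v k t)^2 + b / \<tau> * (real d * (v k t)^2 + W t)"
          unfolding sum.distrib sum_distrib_left[symmetric] Wv by simp
      qed
      also have "\<dots> = (\<Sum>k<d. (- 2 * \<rho> + b / \<tau> * real d) * (v k t)^2 + b / \<tau> * W t)"
        by (intro sum.cong refl) (simp add: algebra_simps)
      also have "\<dots> = (- 2 * \<rho> + b / \<tau> * real d) * W t + real d * (b / \<tau> * W t)"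
        unfolding sum.distrib sum_distrib_left[symmetric] Wv[symmetric] by simp
      also have "\<dots> = - 2 * \<rho> * W t + 2 * real d * (b / \<tau>) * W t"
        by (simp add: algebra_simps)
      also have "\<dots> \<le> - 2 * \<rho> * W t + \<rho> * W t"
        using tau2 by (intro add_left_mono mult_right_mono) (auto simp: Wv intro!: sum_nonneg)
      finally show ?thesis by simp
    qed
    have Wt: "W t \<le> exp (- \<rho> * t) * W 0"
      using exp_decay_of_deriv[OF dW W'le t] .
    define Y where "Y = (\<Sum>j<d. \<bar>y j 0\<bar>)"
    have Y0: "Y \<ge> 0" unfolding Y_def by (intro sum_nonneg) auto
    have W0: "W 0 \<le> (\<Sum>k<d. (\<tau>^k * q)^2) * Y^2"
    proof -
      have "(v k 0)^2 \<le> (\<tau>^k * q)^2 * Y^2" if "k < d" for k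
      proof -
        have "cmod (u k 0) \<le> (\<Sum>j<d. cmod (Q k j) * \<bar>y j 0\<bar>)"
          unfolding u_def by (rule order.trans[OF norm_sum]) (simp add: norm_mult)
        also have "\<dots> \<le> (\<Sum>j<d. cmod (Q k j) * Y)"
          unfolding Y_def by (intro sum_mono mult_left_mono member_le_sum) auto
        also have "\<dots> = (\<Sum>j<d. cmod (Q k j)) * Y" unfolding sum_distrib_right ..
        also have "\<dots> \<le> q * Y" unfolding q_def using that Y0 by (intro mult_right_mono row_le) auto
        finally have "v k 0 \<le> \<tau>^k * (q * Y)" unfolding v_def using tau by (intro mult_left_mono) auto
        then have "(v k 0)^2 \<le> (\<tau>^k * (q * Y))^2" using tau by (intro power_mono) (auto simp: v_def)
        then show ?thesis by (simp add: power_mult_distrib)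
      qed
      then show ?thesis unfolding Wv sum_distrib_right by (intro sum_mono) auto
    qed
    have u_le: "cmod (u j t) \<le> sqrt (W t)" if "j < d" for j
    proof -
      have "1 * cmod (u j t) \<le> v j t" unfolding v_def using tau by (intro mult_right_mono) auto
      also have "v j t \<le> sqrt (W t)"
        unfolding Wv using that by (intro real_le_rsqrt member_le_sum) auto
      finally show ?thesis by simp
    qed
    have "complex_of_real (y k t) = (\<Sum>j<d. P k j * u j t)"
    proof -
      have "(\<Sum>j<d. P k j * u j t) = (\<Sum>j<d. \<Sum>i<d. P k j * Q j i * complex_of_real (y i t))"
        by (simp add: u_def sum_distrib_left mult.assoc)
      also have "\<dots> = (\<Sum>i<d. (\<Sum>j<d. P k j * Q j i) * complex_of_real (y i t))"
        by (subst sum.swap) (simp add: sum_distrib_right)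
      also have "\<dots> = (\<Sum>i<d. (if k = i then complex_of_real (y i t) else 0))"
        by (intro sum.cong refl) (simp add: PQ k)
      finally show ?thesis using k by simp
    qed
    then have "\<bar>y k t\<bar> = cmod (\<Sum>j<d. P k j * u j t)" by (metis norm_of_real)
    also have "\<dots> \<le> (\<Sum>j<d. cmod (P k j) * sqrt (W t))"
      by (rule order.trans[OF norm_sum]) (auto simp: norm_mult intro!: sum_mono mult_left_mono u_le)
    also have "\<dots> = (\<Sum>j<d. cmod (P k j)) * sqrt (W t)" unfolding sum_distrib_right ..
    also have "\<dots> \<le> p * sqrt (W t)"
      unfolding p_def using k by (intro mult_right_mono row_le real_sqrt_ge_zero) (auto simp: Wv intro!: sum_nonneg)
    also have "\<dots> \<le> p * sqrt (exp (- \<rho> * t) * ((\<Sum>k<d. (\<tau>^k * q)^2) * Y^2))"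
      using p0 order.trans[OF Wt mult_left_mono[OF W0]] by (intro mult_left_mono real_sqrt_le_mono) auto
    also have "\<dots> = C * exp (- (\<rho> / 2) * t) * Y"
    proof -
      have "exp (- \<rho> * t) = (exp (- (\<rho> / 2) * t))^2" by (simp add: exp_double[symmetric])
      then show ?thesis using Y0 by (simp add: C_def real_sqrt_mult)
    qed
    finally show ?thesis unfolding Y_def .
  qed
  \<comment> \<open>\<open>W\<close> is quadratic in the solution, so its rate is halved by the
    square root.\<close>
  then show ?thesis using C0 rho by (intro exI[of _ C] conjI exI[of _ "\<rho> / 2"]) auto
qed

section \<open>Existence for differential inclusions with signum terms\<close>

lemma at_within_atLeast_eq:
  fixes t b :: real
  assumes "0 \<le> t" "t < b"
  shows "at t within {0..b} = at t within {0..}"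
  by (rule at_within_nhd[of _ "{..<b}"]) (use assms in auto)

lemma integral_has_real_derivative_atLeast:
  fixes f :: "real \<Rightarrow> real"
  assumes "continuous_on {0..} f" "0 \<le> t"
  shows "((\<lambda>t. integral {0..t} f) has_real_derivative f t) (at t within {0..})"
proof -
  have "continuous_on {0..t+1} f" using assms by (auto intro: continuous_on_subset)
  then have "((\<lambda>t. integral {0..t} f) has_real_derivative f t) (at t within {0..t+1})"
    by (rule integral_has_real_derivative) (use assms in auto)
  then show ?thesis using assms at_within_atLeast_eq[of t "t+1"] by simp
qed

lemma continuous_on_integral_atLeast:
  fixes f :: "real \<Rightarrow> real"
  assumes "continuous_on {0..} f"
  shows "continuous_on {0..} (\<lambda>t. integral {0..t} f)"
  by (rule DERIV_continuous_on[OF integral_has_real_derivative_atLeast[OF assms]]) simp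

lemma continuous_on_atLeastI:
  fixes f :: "real \<Rightarrow> real"
  assumes "\<And>T. 0 \<le> T \<Longrightarrow> continuous_on {0..T} f"
  shows "continuous_on {0..} f"
  unfolding continuous_on_eq_continuous_within
proof
  fix t :: real assume t: "t \<in> {0..}"
  then have "continuous (at t within {0..t+1}) f"
    using assms[of "t+1"] by (simp add: continuous_on_eq_continuous_within)
  then show "continuous (at t within {0..}) f"
    using at_within_atLeast_eq[of t "t+1"] t by simp
qed

text \<open>Picard iterates are compared in the weight \<open>exp (2 L t)\<close>, for which the iteration contracts by the
  factor \<open>1/2\<close> on every interval \<open>[0, T]\<close>.\<close>

theorem picard_global:
  fixes F :: "'k \<Rightarrow> real \<Rightarrow> real" and \<Phi> :: "'k \<Rightarrow> real \<Rightarrow> ('k \<Rightarrow> real) \<Rightarrow> real"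
  assumes J: "finite J"
    and F: "\<And>k. k \<in> J \<Longrightarrow> continuous_on {0..} (F k)"
    and cont: "\<And>k y. k \<in> J \<Longrightarrow> (\<And>j. j \<in> J \<Longrightarrow> continuous_on {0..} (y j)) \<Longrightarrow>
        continuous_on {0..} (\<lambda>s. \<Phi> k s (\<lambda>j. y j s))"
    and lip: "\<And>k s y z. k \<in> J \<Longrightarrow> 0 \<le> s \<Longrightarrow> \<bar>\<Phi> k s y - \<Phi> k s z\<bar> \<le> L * (\<Sum>j\<in>J. \<bar>y j - z j\<bar>)"
    and L: "L \<ge> 0"
  obtains y where "\<And>k. k \<in> J \<Longrightarrow> continuous_on {0..} (y k)"
    "\<And>k t. k \<in> J \<Longrightarrow> 0 \<le> t \<Longrightarrow> y k t = F k t + integral {0..t} (\<lambda>s. \<Phi> k s (\<lambda>j. y j s))"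
proof -
  define Y where "Y = rec_nat F (\<lambda>_ y k t. F k t + integral {0..t} (\<lambda>s. \<Phi> k s (\<lambda>j. y j s)))"
  have Y0: "Y 0 = F" and YS: "Y (Suc m) k t = F k t + integral {0..t} (\<lambda>s. \<Phi> k s (\<lambda>j. Y m j s))" for m k t
    by (simp_all add: Y_def)
  have Yc: "\<And>k. k \<in> J \<Longrightarrow> continuous_on {0..} (Y m k)" for m
  proof (induction m)
    case 0 then show ?case using F Y0 by simp
  next
    case (Suc m)
    have "continuous_on {0..} (\<lambda>t. F k t + integral {0..t} (\<lambda>s. \<Phi> k s (\<lambda>j. Y m j s)))" if "k \<in> J" for k
      by (intro continuous_on_add F continuous_on_integral_atLeast cont that Suc.IH)
    then show ?case using Suc.prems YS[of m k] by (simp add: fun_eq_iff[symmetric] cong: continuous_on_cong)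
  qed
  \<comment> \<open>Dominates the Lipschitz constant for the sum over all coordinates; the added 1
    permits division.\<close>
  define L' where "L' = L * real (card J) + 1"
  have L': "L' > 0" using L by (simp add: L'_def add_nonneg_pos)
  have lip_int: "\<bar>integral {0..t} (\<lambda>s. \<Phi> k s (\<lambda>j. y j s)) - integral {0..t} (\<lambda>s. \<Phi> k s (\<lambda>j. z j s))\<bar>
      \<le> integral {0..t} (\<lambda>s. L * (\<Sum>j\<in>J. \<bar>y j s - z j s\<bar>))"
    if k: "k \<in> J" and y: "\<And>j. j \<in> J \<Longrightarrow> continuous_on {0..} (y j)" and z: "\<And>j. j \<in> J \<Longrightarrow> continuous_on {0..} (z j)"
    for k t y z
  proof -
    have cy: "continuous_on {0..t} (\<lambda>s. \<Phi> k s (\<lambda>j. y j s))" and cz: "continuous_on {0..t} (\<lambda>s. \<Phi> k s (\<lambda>j. z j s))"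
      using cont[where y = y, OF k y] cont[where y = z, OF k z] by (auto intro: continuous_on_subset)
    have cyz: "continuous_on {0..t} (\<lambda>s. L * (\<Sum>j\<in>J. \<bar>y j s - z j s\<bar>))"
      by (intro continuous_intros continuous_on_subset[OF y] continuous_on_subset[OF z]) auto
    have "integral {0..t} (\<lambda>s. \<Phi> k s (\<lambda>j. y j s)) - integral {0..t} (\<lambda>s. \<Phi> k s (\<lambda>j. z j s)) =
       integral {0..t} (\<lambda>s. \<Phi> k s (\<lambda>j. y j s) - \<Phi> k s (\<lambda>j. z j s))"
      by (rule Henstock_Kurzweil_Integration.integral_diff[symmetric]; rule integrable_continuous_real; fact)
    also have "norm \<dots> \<le> integral {0..t} (\<lambda>s. L * (\<Sum>j\<in>J. \<bar>y j s - z j s\<bar>))"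
      by (rule Henstock_Kurzweil_Integration.integral_norm_bound_integral)
         (auto intro!: integrable_continuous_real continuous_on_diff cy cz cyz lip k)
    finally show ?thesis by simp
  qed
  define D where "D m t = (\<Sum>k\<in>J. \<bar>Y (Suc m) k t - Y m k t\<bar>)" for m t
  have Dc: "continuous_on {0..} (D m)" for m
    unfolding D_def by (intro continuous_intros Yc) auto
  have Dbound: "\<exists>C\<ge>0. \<forall>m. \<forall>t\<in>{0..T}. D m t \<le> C * (1/2)^m" if T: "T \<ge> 0" for T
  proof -
    have "compact (D 0 ` {0..T})"
      by (intro compact_continuous_image continuous_on_subset[OF Dc]) auto
    then obtain C where C: "\<And>t. t \<in> {0..T} \<Longrightarrow> D 0 t \<le> C"
      using compact_imp_bounded bounded_imp_bdd_above unfolding bdd_above_def by (metis imageI)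
    have C0: "C \<ge> 0" using C[of 0] T unfolding D_def by (smt (verit) atLeastAtMost_iff sum_nonneg abs_ge_zero)
    \<comment> \<open>Integrating the weight costs 1 / (2 L'), and summation over \<open>J\<close>
      returns at most a factor L'; hence the 1/2 per iteration.\<close>
    have ind: "D m t \<le> C * (1/2)^m * exp (2 * L' * t)" if "t \<in> {0..T}" for m t
      using that
    proof (induction m arbitrary: t)
      case 0
      have "D 0 t \<le> C * 1" using C 0 by simp
      also have "\<dots> \<le> C * exp (2 * L' * t)" using C0 0 L' by (intro mult_left_mono) auto
      finally show ?case by simp
    next
      case (Suc m)
      have ex: "((\<lambda>s. L * (C * (1/2)^m * exp (2 * L' * s))) has_integral
          L * (C * (1/2)^m * (exp (2 * L' * t) / (2 * L'))) - L * (C * (1/2)^m * (exp (2 * L' * 0) / (2 * L')))) {0..t}"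
      proof (rule fundamental_theorem_of_calculus)
        fix s :: real
        have "((\<lambda>s. L * (C * (1/2)^m * (exp (2 * L' * s) / (2 * L')))) has_real_derivative
              L * (C * (1/2)^m * (exp (2 * L' * s) * (2 * L') / (2 * L')))) (at s within {0..t})"
          using L' by (auto intro!: derivative_eq_intros)
        then show "((\<lambda>s. L * (C * (1/2)^m * (exp (2 * L' * s) / (2 * L')))) has_vector_derivative
              L * (C * (1/2)^m * exp (2 * L' * s))) (at s within {0..t})"
          using L' by (simp add: has_real_derivative_iff_has_vector_derivative)
      qed (use Suc.prems in auto)
      have step: "\<bar>Y (Suc (Suc m)) k t - Y (Suc m) k t\<bar> \<le> L * (C * (1/2)^m * (exp (2 * L' * t) / (2 * L')))"
        if k: "k \<in> J" for k
      proof -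
        have "\<bar>Y (Suc (Suc m)) k t - Y (Suc m) k t\<bar> \<le> integral {0..t} (\<lambda>s. L * D m s)"
          unfolding D_def
          using lip_int[where y = "Y (Suc m)" and z = "Y m" and t = t, OF k Yc Yc] YS[of "Suc m" k t] YS[of m k t] by linarith
        also have "\<dots> \<le> integral {0..t} (\<lambda>s. L * (C * (1/2)^m * exp (2 * L' * s)))"
        proof (rule integral_le)
          show "(\<lambda>s. L * D m s) integrable_on {0..t}"
            by (intro integrable_continuous_real continuous_on_mult continuous_on_const continuous_on_subset[OF Dc]) auto
          show "(\<lambda>s. L * (C * (1/2)^m * exp (2 * L' * s))) integrable_on {0..t}" using ex by blast
          show "L * D m s \<le> L * (C * (1/2)^m * exp (2 * L' * s))" if "s \<in> {0..t}" for s
            using Suc.IH[of s] that Suc.prems L by (intro mult_left_mono) auto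
        qed
        also have "\<dots> = L * (C * (1/2)^m * (exp (2 * L' * t) / (2 * L'))) - L * (C * (1/2)^m * (exp (2 * L' * 0) / (2 * L')))"
          using ex by (rule integral_unique)
        also have "\<dots> \<le> L * (C * (1/2)^m * (exp (2 * L' * t) / (2 * L')))"
          using L C0 L' by simp
        finally show ?thesis .
      qed
      have "D (Suc m) t \<le> (\<Sum>k\<in>J. L * (C * (1/2)^m * (exp (2 * L' * t) / (2 * L'))))"
        unfolding D_def by (rule sum_mono) (rule step)
      also have "\<dots> = (L * real (card J)) * (C * (1/2)^m * (exp (2 * L' * t) / (2 * L')))" by simp
      also have "\<dots> \<le> L' * (C * (1/2)^m * (exp (2 * L' * t) / (2 * L')))"
        using C0 L' by (intro mult_right_mono mult_nonneg_nonneg divide_nonneg_pos) (auto simp: L'_def)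
      also have "\<dots> = C * (1/2)^Suc m * exp (2 * L' * t)" using L' by simp
      finally show ?case .
    qed
    have "D m t \<le> (C * exp (2 * L' * T)) * (1/2)^m" if "t \<in> {0..T}" for m t
    proof -
      have "D m t \<le> C * (1/2)^m * exp (2 * L' * t)" by (rule ind[OF that])
      also have "\<dots> \<le> C * (1/2)^m * exp (2 * L' * T)" using that C0 L' by (intro mult_left_mono) auto
      finally show ?thesis by (simp add: ac_simps)
    qed
    then show ?thesis using C0 by (intro exI[of _ "C * exp (2 * L' * T)"]) auto
  qed
  \<comment> \<open>The limit is written as a telescoping series, so that the Weierstrass test gives
    uniform convergence on compact intervals.\<close>
  define y where "y k t = F k t + (\<Sum>m. Y (Suc m) k t - Y m k t)" for k t
  have tel: "F k t + (\<Sum>i<m. Y (Suc i) k t - Y i k t) = Y m k t" for k t m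
    by (induction m) (simp_all add: Y0)
  have unif: "uniform_limit {0..T} (\<lambda>m t. Y m k t) (y k) sequentially" if kJ: "k \<in> J" and T: "T \<ge> 0" for k T
  proof -
    obtain C where C: "C \<ge> 0" "\<And>m t. t \<in> {0..T} \<Longrightarrow> D m t \<le> C * (1/2)^m" using Dbound[OF T] by blast
    have "uniform_limit {0..T} (\<lambda>m t. \<Sum>i<m. Y (Suc i) k t - Y i k t) (\<lambda>t. \<Sum>i. Y (Suc i) k t - Y i k t) sequentially"
    proof (rule Weierstrass_m_test)
      show "norm (Y (Suc m) k t - Y m k t) \<le> C * (1/2)^m" if "t \<in> {0..T}" for m t
      proof -
        have "\<bar>Y (Suc m) k t - Y m k t\<bar> \<le> D m t" unfolding D_def using J \<open>k \<in> J\<close> by (intro member_le_sum) auto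
        then show ?thesis using C(2)[OF that, of m] by simp
      qed
      show "summable (\<lambda>m. C * (1/2)^m)" by (intro summable_mult summable_geometric) auto
    qed
    then have "uniform_limit {0..T} (\<lambda>m t. F k t + (\<Sum>i<m. Y (Suc i) k t - Y i k t)) (\<lambda>t. F k t + (\<Sum>i. Y (Suc i) k t - Y i k t)) sequentially"
      by (intro uniform_limit_add uniform_limit_const)
    then show ?thesis unfolding tel y_def[abs_def] .
  qed
  have yc: "continuous_on {0..} (y k)" if "k \<in> J" for k
  proof (rule continuous_on_atLeastI)
    fix T :: real assume "0 \<le> T"
    show "continuous_on {0..T} (y k)"
      by (rule uniform_limit_theorem[OF _ unif[OF that \<open>0 \<le> T\<close>]])
         (auto intro!: always_eventually continuous_on_subset[OF Yc[OF that]])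
  qed
  show ?thesis
  proof (rule that[of y])
    fix k t assume k: "k \<in> J" and t: "0 \<le> (t::real)"
    have "uniform_limit {0..t} (\<lambda>m s. \<Phi> k s (\<lambda>j. Y m j s)) (\<lambda>s. \<Phi> k s (\<lambda>j. y j s)) sequentially"
      unfolding uniform_limit_iff
    proof (intro allI impI)
      fix e :: real assume e: "e > 0"
      have "\<forall>\<^sub>F m in sequentially. \<forall>j\<in>J. \<forall>s\<in>{0..t}. dist (Y m j s) (y j s) < e / L'"
        unfolding eventually_ball_finite_distrib[OF J]
        using unif[OF _ t] e L' unfolding uniform_limit_iff by simp
      then show "\<forall>\<^sub>F m in sequentially. \<forall>s\<in>{0..t}. dist (\<Phi> k s (\<lambda>j. Y m j s)) (\<Phi> k s (\<lambda>j. y j s)) < e"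
      proof eventually_elim
        case (elim m)
        show ?case
        proof
          fix s assume s: "s \<in> {0..t}"
          have "\<bar>\<Phi> k s (\<lambda>j. Y m j s) - \<Phi> k s (\<lambda>j. y j s)\<bar> \<le> L * (\<Sum>j\<in>J. \<bar>Y m j s - y j s\<bar>)"
            using lip[OF k] s by simp
          also have "\<dots> \<le> L * (\<Sum>j\<in>J. e / L')"
            using elim s L by (intro mult_left_mono sum_mono) (auto simp: dist_real_def less_imp_le)
          also have "\<dots> = (L * real (card J)) * (e / L')" by simp
          also have "\<dots> < L' * (e / L')" using e L' by (intro mult_strict_right_mono) (auto simp: L'_def)
          also have "\<dots> = e" using L' by simp
          finally show "dist (\<Phi> k s (\<lambda>j. Y m j s)) (\<Phi> k s (\<lambda>j. y j s)) < e" by (simp add: dist_real_def)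
        qed
      qed
    qed
    then obtain I K where I: "\<And>m. ((\<lambda>s. \<Phi> k s (\<lambda>j. Y m j s)) has_integral I m) {0..t}"
      and K: "((\<lambda>s. \<Phi> k s (\<lambda>j. y j s)) has_integral K) {0..t}" and IK: "I \<longlonglongrightarrow> K"
    proof (rule uniform_limit_integral)
      show "continuous_on {0..t} (\<lambda>s. \<Phi> k s (\<lambda>j. Y m j s))" for m
        using cont[OF k Yc] by (rule continuous_on_subset) auto
    qed auto
    have "(\<lambda>m. Y (Suc m) k t) \<longlonglongrightarrow> F k t + K"
      unfolding YS integral_unique[OF I] by (intro tendsto_intros IK)
    moreover have "(\<lambda>m. Y (Suc m) k t) \<longlonglongrightarrow> y k t"
      using tendsto_uniform_limitI[OF unif[OF k t], of t] t by (intro LIMSEQ_Suc) auto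
    ultimately show "y k t = F k t + integral {0..t} (\<lambda>s. \<Phi> k s (\<lambda>j. y j s))"
      using LIMSEQ_unique integral_unique[OF K] by blast
  qed (rule yc)
qed

section \<open>Bounded densities of Lipschitz functions\<close>

text \<open>Both \<open>F\<close> and c t - F are continuous and nondecreasing, and their interval
  measures add up to c times Lebesgue measure. Hence the measure of \<open>F\<close> is absolutely
  continuous, and Radon-Nikodym yields a density that is at most \<open>c\<close> almost
  everywhere.\<close>

lemma lipschitz_mono_density:
  fixes F :: "real \<Rightarrow> real"
  assumes mono: "\<And>s t. s \<le> t \<Longrightarrow> F s \<le> F t" and lip: "\<And>s t. s \<le> t \<Longrightarrow> F t - F s \<le> c * (t - s)"
    and c: "c > 0"
  obtains f where "f \<in> borel_measurable borel" "\<And>x. 0 \<le> f x" "\<And>x. f x \<le> c"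
    "\<And>a b. a \<le> b \<Longrightarrow> (f has_integral (F b - F a)) {a..b}"
proof -
  define G where "G t = c * t - F t" for t
  have monoG: "s \<le> t \<Longrightarrow> G s \<le> G t" for s t using lip[of s t] by (simp add: G_def algebra_simps)
  have "dist (F x) (F y) \<le> c * dist x y" for x y
    using mono[of x y] mono[of y x] lip[of x y] lip[of y x] by (cases "x \<le> y") (auto simp: dist_real_def)
  then have "c-lipschitz_on UNIV F" using c by (intro lipschitz_onI) auto
  then have cF: "continuous_on UNIV F" by (rule lipschitz_on_continuous_on)
  then have cG: "continuous_on UNIV G" unfolding G_def by (intro continuous_intros)
  define MF where "MF = interval_measure F"
  define MG where "MG = interval_measure G"
  have sF: "sets MF = sets lborel" and sG: "sets MG = sets lborel"
    by (simp_all add: MF_def MG_def)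
  have eF: "emeasure MF {a..b} = ennreal (F b - F a)" if "a \<le> b" for a b
    unfolding MF_def by (rule emeasure_interval_measure_Icc[OF that mono cF])
  have eG: "emeasure MG {a..b} = ennreal (G b - G a)" if "a \<le> b" for a b
    unfolding MG_def by (rule emeasure_interval_measure_Icc[OF that monoG cG])
  define M where "M = measure_of UNIV (sets borel) (\<lambda>A. emeasure MF A + emeasure MG A)"
  have sM: "sets M = sets borel" unfolding M_def
    by (metis sets.sigma_sets_eq sets.space_closed sets_measure_of space_borel)
  have eM: "emeasure M A = emeasure MF A + emeasure MG A" if "A \<in> sets borel" for A
    unfolding M_def
  proof (rule emeasure_measure_of_sigma)
    show "sigma_algebra UNIV (sets (borel :: real measure))" by (metis sets.sigma_algebra_axioms space_borel)
    show "countably_additive (sets borel) (\<lambda>A. emeasure MF A + emeasure MG A)"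
    proof (rule countably_additiveI)
      fix A :: "nat \<Rightarrow> real set" assume A: "range A \<subseteq> sets borel" "disjoint_family A"
      have "(\<Sum>i. emeasure MF (A i) + emeasure MG (A i)) = (\<Sum>i. emeasure MF (A i)) + (\<Sum>i. emeasure MG (A i))"
        by (rule suminf_add[symmetric]) auto
      also have "\<dots> = emeasure MF (\<Union>i. A i) + emeasure MG (\<Union>i. A i)"
        using A sF sG by (simp add: suminf_emeasure)
      finally show "(\<Sum>i. emeasure MF (A i) + emeasure MG (A i)) = emeasure MF (\<Union>i. A i) + emeasure MG (\<Union>i. A i)" .
    qed
  qed (use that in \<open>auto simp: positive_def\<close>)
  define E where "E = range (\<lambda>(a, b). {a..b::real})"
  \<comment> \<open>It suffices to compare the measures on closed intervals, which are stable under
    intersection and generate the Borel sets.\<close>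
  have Ml: "M = density lborel (\<lambda>_. ennreal c)"
  proof (rule measure_eqI_generator_eq[where E = E and \<Omega> = UNIV and A = "\<lambda>i::nat. {- real i..real i}"])
    show "Int_stable E"
    proof (rule Int_stableI)
      fix X Y assume "X \<in> E" "Y \<in> E"
      then obtain a b a' b' where "X = {a..b}" "Y = {a'..b'}" by (auto simp: E_def)
      then have "X \<inter> Y = {max a a'..min b b'}" by auto
      then show "X \<inter> Y \<in> E" unfolding E_def by blast
    qed
    have "sets borel = sigma_sets UNIV E"
      unfolding E_def borel_eq_atLeastAtMost by (rule sets_measure_of) auto
    then show "sets M = sigma_sets UNIV E" "sets (density lborel (\<lambda>_. ennreal c)) = sigma_sets UNIV E"
      using sM by simp_all
    fix X assume "X \<in> E"
    then obtain a b where X: "X = {a..b}" by (auto simp: E_def)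
    show "emeasure M X = emeasure (density lborel (\<lambda>_. ennreal c)) X"
    proof (cases "a \<le> b")
      case True
      have "emeasure M X = ennreal (F b - F a) + ennreal (G b - G a)"
        using eM[of X] eF[OF True] eG[OF True] X by simp
      also have "\<dots> = ennreal (c * (b - a))"
        using mono[OF True] monoG[OF True] by (simp add: ennreal_plus[symmetric] G_def algebra_simps del: ennreal_plus)
      also have "\<dots> = emeasure (density lborel (\<lambda>_. ennreal c)) X"
        using True c by (simp add: X emeasure_density_const ennreal_mult[symmetric])
      finally show ?thesis .
    qed (simp add: X)
  next
    show "(\<Union>i. {- real i..real i}) = UNIV"
    proof -
      have "x \<in> (\<Union>i::nat. {- real i..real i})" for x :: real
      proof -
        obtain i :: nat where "\<bar>x\<bar> \<le> real i" using real_arch_simple by blast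
        then show ?thesis by (auto simp: abs_le_iff intro!: exI[of _ i])
      qed
      then show ?thesis by blast
    qed
    show "emeasure M {- real i..real i} \<noteq> \<infinity>" for i
      using eM[of "{- real i..real i}"] eF[of "- real i" "real i"] eG[of "- real i" "real i"] by simp
  qed (auto simp: E_def)
  have sum_eq: "emeasure MF A + emeasure MG A = ennreal c * emeasure lborel A" if "A \<in> sets borel" for A
    using eM[OF that] that unfolding Ml by (simp add: emeasure_density_const)
  have acF: "absolutely_continuous lborel MF" and acG: "absolutely_continuous lborel MG"
    unfolding absolutely_continuous_def null_sets_def using sum_eq sF sG by fastforce+
  obtain f where f: "f \<in> borel_measurable lborel" "density lborel f = MF"
    using sigma_finite_measure.Radon_Nikodym[OF sigma_finite_lborel acF sF] by blast
  obtain g where g: "g \<in> borel_measurable lborel" "density lborel g = MG"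
    using sigma_finite_measure.Radon_Nikodym[OF sigma_finite_lborel acG sG] by blast
  have "density lborel (\<lambda>x. f x + g x) = density lborel (\<lambda>_. ennreal c)"
  proof (rule measure_eqI)
    fix A :: "real set" assume "A \<in> sets (density lborel (\<lambda>x. f x + g x))"
    then have A: "A \<in> sets lborel" by simp
    have "emeasure (density lborel (\<lambda>x. f x + g x)) A = (\<integral>\<^sup>+x. f x * indicator A x + g x * indicator A x \<partial>lborel)"
      using f g A by (simp add: emeasure_density distrib_right)
    also have "\<dots> = emeasure MF A + emeasure MG A"
      using f g A by (subst nn_integral_add) (auto simp: emeasure_density[symmetric])
    also have "\<dots> = emeasure (density lborel (\<lambda>_. ennreal c)) A"
      using sum_eq A by (simp add: emeasure_density_const)
    finally show "emeasure (density lborel (\<lambda>x. f x + g x)) A = emeasure (density lborel (\<lambda>_. ennreal c)) A" .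
  qed simp
  then have ae: "AE x in lborel. f x + g x = ennreal c"
    by (subst sigma_finite_measure.density_unique_iff[OF sigma_finite_lborel, symmetric]) (use f g in auto)
  \<comment> \<open>Truncation turns the almost-everywhere bound by \<open>c\<close> into one at
    every point.\<close>
  define h where "h x = enn2real (min (f x) (ennreal c))" for x
  have hm: "h \<in> borel_measurable borel" using f(1) unfolding h_def by simp
  have h0: "0 \<le> h x" for x by (simp add: h_def)
  have hc: "h x \<le> c" for x unfolding h_def using c by (metis enn2real_ennreal enn2real_mono ennreal_less_top less_imp_le min.cobounded2)
  have hf: "ennreal (h x) = min (f x) (ennreal c)" for x
    unfolding h_def by (rule ennreal_enn2real) (simp add: min_less_iff_disj)
  have aeh: "AE x in lborel. ennreal (h x) = f x"
    using ae by eventually_elim (metis hf add_increasing2 dual_order.refl min.absorb1 zero_le)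
  have "(h has_integral (F b - F a)) {a..b}" if ab: "a \<le> b" for a b
  proof -
    have "(\<integral>\<^sup>+x. ennreal (indicator {a..b} x * h x) \<partial>lborel) = (\<integral>\<^sup>+x. f x * indicator {a..b} x \<partial>lborel)"
      using aeh by (intro nn_integral_cong_AE) (auto elim!: eventually_mono simp: indicator_def)
    also have "\<dots> = emeasure MF {a..b}" using f by (simp add: emeasure_density[symmetric])
    also have "\<dots> = ennreal (F b - F a)" by (rule eF[OF ab])
    finally have nn: "(\<integral>\<^sup>+x. ennreal (indicator {a..b} x * h x) \<partial>lborel) = ennreal (F b - F a)" .
    have "((\<lambda>x. indicator {a..b} x * h x) has_integral (F b - F a)) UNIV"
      by (rule nn_integral_has_integral) (use hm h0 nn mono[OF ab] in auto)
    moreover have "(\<lambda>x. indicator {a..b} x * h x) = (\<lambda>x. if x \<in> {a..b} then h x else 0)" by auto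
    ultimately show ?thesis by (simp only: has_integral_restrict_UNIV)
  qed
  then show ?thesis using hm h0 hc that by blast
qed

text \<open>Adding K t makes the function nondecreasing with slopes at most 2 K; the shift is taken
  out of the density afterwards.\<close>

lemma lipschitz_density:
  fixes P :: "real \<Rightarrow> real"
  assumes lip: "\<And>s t. 0 \<le> s \<Longrightarrow> s \<le> t \<Longrightarrow> \<bar>P t - P s\<bar> \<le> K * (t - s)" and K: "K \<ge> 0"
  obtains \<rho> where "\<rho> \<in> borel_measurable borel" "\<And>x. \<bar>\<rho> x\<bar> \<le> K"
    "\<And>a b. 0 \<le> a \<Longrightarrow> a \<le> b \<Longrightarrow> (\<rho> has_integral (P b - P a)) {a..b}"
proof (cases "K = 0")
  case True
  show ?thesis
  proof (rule that[of "\<lambda>_. 0"])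
    show "((\<lambda>_. 0) has_integral (P b - P a)) {a..b}" if "0 \<le> a" "a \<le> b" for a b
    proof -
      have "P b - P a = 0" using lip[OF that] True by simp
      then show ?thesis by (metis has_integral_0)
    qed
  qed (use K in auto)
next
  case False
  \<comment> \<open>Frozen at its value at 0 for negative times: \<open>P\<close> is Lipschitz on
    the half-line only, while interval measures live on the whole line.\<close>
  define F where "F t = K * t + P (max t 0)" for t
  have lip': "\<bar>P (max t 0) - P (max s 0)\<bar> \<le> K * (t - s)" if "s \<le> t" for s t
  proof -
    have "\<bar>P (max t 0) - P (max s 0)\<bar> \<le> K * (max t 0 - max s 0)" using that by (intro lip) auto
    also have "\<dots> \<le> K * (t - s)" using that K by (intro mult_left_mono) auto
    finally show ?thesis .
  qed
  obtain f where f: "f \<in> borel_measurable borel" "\<And>x. 0 \<le> f x" "\<And>x. f x \<le> 2 * K"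
    "\<And>a b. a \<le> b \<Longrightarrow> (f has_integral (F b - F a)) {a..b}"
  proof (rule lipschitz_mono_density[of F "2 * K"])
    show "F s \<le> F t" if "s \<le> t" for s t using lip'[OF that] by (simp add: F_def algebra_simps)
    show "F t - F s \<le> 2 * K * (t - s)" if "s \<le> t" for s t using lip'[OF that] by (simp add: F_def algebra_simps)
  qed (use K False in auto)
  show ?thesis
  proof (rule that[of "\<lambda>x. f x - K"])
    show "(\<lambda>x. f x - K) \<in> borel_measurable borel" using f(1) by simp
    show "\<bar>f x - K\<bar> \<le> K" for x using f(2,3)[of x] by auto
    show "((\<lambda>x. f x - K) has_integral (P b - P a)) {a..b}" if "0 \<le> a" "a \<le> b" for a b
      using has_integral_diff[OF f(4)[OF that(2)] has_integral_const_real[of K a b]] that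
      by (simp add: F_def algebra_simps)
  qed
qed

text \<open>The difference c - \<rho> is nonnegative and has zero integral.\<close>

lemma AE_eq_of_integral_eq:
  fixes \<rho> :: "real \<Rightarrow> real"
  assumes m: "\<rho> \<in> borel_measurable borel" and b: "\<And>x. \<bar>\<rho> x\<bar> \<le> K" and le: "\<And>x. \<rho> x \<le> c"
    and int: "(\<rho> has_integral (c * (b - a))) {a..b}" and ab: "a \<le> b"
  shows "AE x in lborel. x \<in> {a..b} \<longrightarrow> \<rho> x = c"
proof -
  let ?f = "\<lambda>x. indicator {a..b} x *\<^sub>R (c - \<rho> x)"
  have si: "set_integrable lborel {a..b} (\<lambda>x. c - \<rho> x)"
    unfolding set_integrable_def
  proof (rule integrableI_bounded_set_indicator[where B = "\<bar>c\<bar> + K"])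
    show "AE x in lborel. x \<in> {a..b} \<longrightarrow> norm (c - \<rho> x) \<le> \<bar>c\<bar> + K"
      using b by (intro AE_I2) (smt (verit) real_norm_def)
  qed (use m ab in auto)
  have "(LINT x:{a..b}|lborel. c - \<rho> x) = integral {a..b} (\<lambda>x. c - \<rho> x)"
    by (rule set_borel_integral_eq_integral(2)[OF si])
  also have "\<dots> = 0"
    using has_integral_diff[OF has_integral_const_real[of c a b] int] ab by (simp add: integral_unique mult.commute)
  finally have "integral\<^sup>L lborel ?f = 0" by (simp add: set_lebesgue_integral_def)
  then have "AE x in lborel. ?f x = 0"
    using si le unfolding set_integrable_def by (subst (asm) integral_nonneg_eq_0_iff_AE) auto
  then show ?thesis by eventually_elim auto
qed

text \<open>The positive times at which \<phi> is positive are covered by countably many rational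
  intervals, and on each of them the extremal increment of \<open>P\<close> forces the extremal
  density.\<close>

lemma AE_density_const:
  fixes \<rho> P \<phi> :: "real \<Rightarrow> real"
  assumes m: "\<rho> \<in> borel_measurable borel" and b: "\<And>x. \<bar>\<rho> x\<bar> \<le> c"
    and int: "\<And>a b. 0 \<le> a \<Longrightarrow> a \<le> b \<Longrightarrow> (\<rho> has_integral (P b - P a)) {a..b}"
    and cont: "continuous_on {0..} \<phi>"
    and P: "\<And>a b. 0 \<le> a \<Longrightarrow> a \<le> b \<Longrightarrow> (\<And>x. x \<in> {a..b} \<Longrightarrow> \<phi> x > 0) \<Longrightarrow> P b - P a = c * (b - a)"
  shows "AE s in lborel. 0 < s \<longrightarrow> \<phi> s > 0 \<longrightarrow> \<rho> s = c"
proof -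
  define I where "I = {(a, b). a \<in> \<rat> \<and> b \<in> \<rat> \<and> 0 \<le> a \<and> a \<le> b \<and> (\<forall>x\<in>{a..b}. \<phi> x > 0)}"
  have "countable (\<rat> \<times> \<rat> :: (real \<times> real) set)" by (intro countable_SIGMA countable_rat)
  then have "countable I" by (rule countable_subset[rotated]) (auto simp: I_def)
  moreover have "AE s in lborel. s \<in> {fst p..snd p} \<longrightarrow> \<rho> s = c" if "p \<in> I" for p
  proof (rule AE_eq_of_integral_eq[OF m b])
    show "\<rho> x \<le> c" for x using b[of x] by auto
    have "0 \<le> fst p" "fst p \<le> snd p" "\<And>x. x \<in> {fst p..snd p} \<Longrightarrow> \<phi> x > 0" using that by (auto simp: I_def)
    then show "(\<rho> has_integral c * (snd p - fst p)) {fst p..snd p}" using int[of "fst p" "snd p"] P[of "fst p" "snd p"] by simp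
  qed (use that in \<open>auto simp: I_def\<close>)
  ultimately have "AE s in lborel. \<forall>p\<in>I. s \<in> {fst p..snd p} \<longrightarrow> \<rho> s = c"
    by (subst AE_ball_countable) auto
  then show ?thesis
  proof eventually_elim
    case (elim s)
    show ?case
    proof (intro impI)
      assume s: "0 < s" "\<phi> s > 0"
      then obtain d where d: "d > 0" "\<And>x. x \<in> {0..} \<Longrightarrow> dist x s < d \<Longrightarrow> dist (\<phi> x) (\<phi> s) < \<phi> s"
        using cont unfolding continuous_on_iff by (metis atLeast_iff less_imp_le)
      obtain a where a: "a \<in> \<rat>" "max 0 (s - d) < a" "a < s" using Rats_dense_in_real[of "max 0 (s - d)" s] s d by auto
      obtain b where b: "b \<in> \<rat>" "s < b" "b < s + d" using Rats_dense_in_real[of s "s + d"] d by auto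
      have "\<phi> x > 0" if "x \<in> {a..b}" for x using d(2)[of x] that a b by (auto simp: dist_real_def abs_less_iff)
      then have "(a, b) \<in> I" using a b by (auto simp: I_def)
      then show "\<rho> s = c" using elim a b by fastforce
    qed
  qed
qed

section \<open>Saturation as a monotone approximation of the signum\<close>

definition sat :: "real \<Rightarrow> real" where "sat z = max (-1) (min 1 z)"

lemma sat_bounds: "\<bar>sat z\<bar> \<le> 1" by (auto simp: sat_def)

lemma sat_lipschitz: "\<bar>sat a - sat b\<bar> \<le> \<bar>a - b\<bar>" by (auto simp: sat_def)

lemma continuous_on_sat: "continuous_on S f \<Longrightarrow> continuous_on S (\<lambda>x. sat (f x))"
  unfolding sat_def by (intro continuous_intros)

text \<open>Where |v| \<ge> 1/n the saturation is exactly the sign of \<open>v\<close>; elsewhere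
  the left side is negative and the right side nonnegative.\<close>

lemma mult_sat_ge: "n > 0 \<Longrightarrow> \<bar>v\<bar> - 1 / n \<le> v * sat (v * n)"
proof -
  assume n: "n > 0"
  consider "v * n \<ge> 1" | "v * n \<le> -1" | "\<bar>v * n\<bar> < 1" by linarith
  then show ?thesis
  proof cases
    case 1
    then have "v > 0" using n by (smt (verit) mult_nonpos_nonneg)
    then show ?thesis using 1 n by (simp add: sat_def)
  next
    case 2
    then have "v < 0" using n by (smt (verit) mult_nonneg_nonneg)
    then show ?thesis using 2 n by (simp add: sat_def min_def max_def)
  next
    case 3
    then have "\<bar>v\<bar> * n < 1" using n by (simp add: abs_mult)
    then have "\<bar>v\<bar> < 1 / n" using n by (simp add: pos_less_divide_eq)
    moreover have "v * sat (v * n) = v * (v * n)" using 3 by (auto simp: sat_def min_def max_def abs_less_iff)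
    moreover have "v * (v * n) \<ge> 0" using n by (simp add: mult.assoc[symmetric])
    ultimately show ?thesis by linarith
  qed
qed

text \<open>With equal slopes monotonicity would make the product nonpositive. For different slopes
  the defect is at most 1/n + 1/p, which tends to zero although the Lipschitz constants of the
  approximations blow up; this drives the Cauchy estimate.\<close>

lemma sat_monotone_defect:
  assumes "n > 0" "p > 0"
  shows "(a - b) * (sat ((r - a) * n) - sat ((r - b) * p)) \<le> 1 / n + 1 / p"
proof -
  define u v where "u = r - a" and "v = r - b"
  have bound: "x * sat z \<le> \<bar>x\<bar>" for x z
  proof -
    have "x * sat z \<le> \<bar>x\<bar> * \<bar>sat z\<bar>" unfolding abs_mult[symmetric] by simp
    also have "\<dots> \<le> \<bar>x\<bar> * 1" by (intro mult_left_mono sat_bounds) auto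
    finally show ?thesis by simp
  qed
  have "(a - b) * (sat (u * n) - sat (v * p)) =
     v * sat (u * n) - v * sat (v * p) - u * sat (u * n) + u * sat (v * p)"
    by (simp add: u_def v_def algebra_simps)
  then show ?thesis
    using bound[of v "u * n"] bound[of u "v * p"] mult_sat_ge[OF assms(1), of u] mult_sat_ge[OF assms(2), of v] by (simp add: u_def v_def)
qed

text \<open>Saturated approximations of the signum give Lipschitz equations; by monotonicity of the signum
  their solutions are uniformly Cauchy on compact intervals. The limit of the integrated feedback terms is
  Lipschitz, hence has a bounded density, which is the required selection of the set-valued signum.\<close>

theorem sign_inclusion_exists:
  fixes M :: "'k \<Rightarrow> 'k \<Rightarrow> real" and F r :: "'k \<Rightarrow> real \<Rightarrow> real" and K :: "'k \<Rightarrow> real"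
  assumes J: "finite J"
    and F: "\<And>k. k \<in> J \<Longrightarrow> continuous_on {0..} (F k)" and r: "\<And>k. k \<in> J \<Longrightarrow> continuous_on {0..} (r k)"
    and K: "\<And>k. k \<in> J \<Longrightarrow> K k \<ge> 0"
  obtains y \<rho> where
    "\<And>k. k \<in> J \<Longrightarrow> continuous_on {0..} (y k)"
    "\<And>k. k \<in> J \<Longrightarrow> \<rho> k \<in> borel_measurable borel"
    "\<And>k s. k \<in> J \<Longrightarrow> \<bar>\<rho> k s\<bar> \<le> K k"
    "\<And>k t. k \<in> J \<Longrightarrow> 0 \<le> t \<Longrightarrow>
       y k t = F k t + integral {0..t} (\<lambda>s. \<Sum>j\<in>J. M k j * y j s) + integral {0..t} (\<rho> k)"
    "\<And>k. k \<in> J \<Longrightarrow> AE s in lborel. 0 < s \<longrightarrow> y k s \<noteq> r k s \<longrightarrow> \<rho> k s = K k * sgn (r k s - y k s)"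
proof -
  define A where "A = (\<Sum>k\<in>J. \<Sum>j\<in>J. \<bar>M k j\<bar>) + 1"
  have A1: "A \<ge> 1" unfolding A_def by (simp add: sum_nonneg)
  define \<Phi> where "\<Phi> m k s y = (\<Sum>j\<in>J. M k j * y j) + K k * sat ((r k s - y k) * real (Suc m))" for m :: nat and k s and y :: "'k \<Rightarrow> real"
  have Mle: "\<bar>M k j\<bar> \<le> A" if "k \<in> J" "j \<in> J" for k j
  proof -
    have "\<bar>M k j\<bar> \<le> (\<Sum>j\<in>J. \<bar>M k j\<bar>)" using that J by (intro member_le_sum) auto
    also have "\<dots> \<le> (\<Sum>k\<in>J. \<Sum>j\<in>J. \<bar>M k j\<bar>)"
      using that J by (intro member_le_sum[of k J "\<lambda>k. \<Sum>j\<in>J. \<bar>M k j\<bar>"] sum_nonneg) auto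
    finally show ?thesis by (simp add: A_def)
  qed
  have cM: "continuous_on {0..} (\<lambda>s. \<Sum>j\<in>J. M k j * y j s)"
    if "\<And>j. j \<in> J \<Longrightarrow> continuous_on {0..} (y j)" for y :: "'k \<Rightarrow> real \<Rightarrow> real" and k
    by (intro continuous_intros that)
  have cS: "continuous_on {0..} (\<lambda>s. sat ((r k s - y k s) * real (Suc m)))"
    if "k \<in> J" "\<And>j. j \<in> J \<Longrightarrow> continuous_on {0..} (y j)" for y :: "'k \<Rightarrow> real \<Rightarrow> real" and k m
    by (intro continuous_on_sat continuous_intros that r)
  define Q where "Q m y \<longleftrightarrow> (\<forall>k\<in>J. continuous_on {0..} (y k)) \<and>
      (\<forall>k\<in>J. \<forall>t\<ge>0. y k t = F k t + integral {0..t} (\<lambda>s. \<Phi> m k s (\<lambda>j. y j s)))" for m y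
  have "\<exists>y. Q m y" for m
  proof -
    \<comment> \<open>This Lipschitz constant grows with \<open>m\<close>. It only serves to solve
      the m-th approximate equation; approximations are compared through monotonicity.\<close>
    define L where "L = A + (\<Sum>k\<in>J. K k * real (Suc m))"
    have L: "L \<ge> 0" unfolding L_def using A1 K by (intro add_nonneg_nonneg sum_nonneg mult_nonneg_nonneg) auto
    obtain y where "\<And>k. k \<in> J \<Longrightarrow> continuous_on {0..} (y k)"
      "\<And>k t. k \<in> J \<Longrightarrow> 0 \<le> t \<Longrightarrow> y k t = F k t + integral {0..t} (\<lambda>s. \<Phi> m k s (\<lambda>j. y j s))"
    proof (rule picard_global[where \<Phi> = "\<Phi> m" and F = F, OF J F _ _ L])
      fix k and y :: "'k \<Rightarrow> real \<Rightarrow> real"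
      assume k: "k \<in> J" and y: "\<And>j. j \<in> J \<Longrightarrow> continuous_on {0..} (y j)"
      show "continuous_on {0..} (\<lambda>s. \<Phi> m k s (\<lambda>j. y j s))"
        unfolding \<Phi>_def by (intro continuous_on_add continuous_on_mult continuous_on_const cM[OF y] cS[OF k y])
    next
      fix k s and y z :: "'k \<Rightarrow> real"
      assume k: "k \<in> J"
      have "\<bar>(\<Sum>j\<in>J. M k j * y j) - (\<Sum>j\<in>J. M k j * z j)\<bar> = \<bar>\<Sum>j\<in>J. M k j * (y j - z j)\<bar>"
        by (simp add: sum_subtractf right_diff_distrib)
      also have "\<dots> \<le> (\<Sum>j\<in>J. A * \<bar>y j - z j\<bar>)"
        by (rule order.trans[OF sum_abs]) (auto simp: abs_mult intro!: sum_mono mult_right_mono Mle k)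
      finally have 1: "\<bar>(\<Sum>j\<in>J. M k j * y j) - (\<Sum>j\<in>J. M k j * z j)\<bar> \<le> A * (\<Sum>j\<in>J. \<bar>y j - z j\<bar>)"
        by (simp add: sum_distrib_left)
      have "\<bar>K k * sat ((r k s - y k) * real (Suc m)) - K k * sat ((r k s - z k) * real (Suc m))\<bar> =
         K k * \<bar>sat ((r k s - y k) * real (Suc m)) - sat ((r k s - z k) * real (Suc m))\<bar>"
        using K[OF k] by (simp add: right_diff_distrib[symmetric] abs_mult)
      also have "\<dots> \<le> K k * \<bar>(r k s - y k) * real (Suc m) - (r k s - z k) * real (Suc m)\<bar>"
        by (intro mult_left_mono sat_lipschitz K k)
      also have "\<dots> = K k * real (Suc m) * \<bar>y k - z k\<bar>"
        by (simp only: left_diff_distrib[symmetric] abs_mult) (simp add: abs_minus_commute)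
      also have "\<dots> \<le> (\<Sum>k\<in>J. K k * real (Suc m)) * (\<Sum>j\<in>J. \<bar>y j - z j\<bar>)"
      proof (rule mult_mono)
        show "K k * real (Suc m) \<le> (\<Sum>k\<in>J. K k * real (Suc m))"
          using K by (intro member_le_sum k J) auto
        show "\<bar>y k - z k\<bar> \<le> (\<Sum>j\<in>J. \<bar>y j - z j\<bar>)" by (intro member_le_sum k J) auto
      qed (use K in \<open>auto intro!: sum_nonneg\<close>)
      finally have 2: "\<bar>K k * sat ((r k s - y k) * real (Suc m)) - K k * sat ((r k s - z k) * real (Suc m))\<bar>
         \<le> (\<Sum>k\<in>J. K k * real (Suc m)) * (\<Sum>j\<in>J. \<bar>y j - z j\<bar>)" .
      show "\<bar>\<Phi> m k s y - \<Phi> m k s z\<bar> \<le> L * (\<Sum>j\<in>J. \<bar>y j - z j\<bar>)"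
        using 1 2 unfolding \<Phi>_def L_def distrib_right by linarith
    qed (assumption, rule that, assumption+)
    then show ?thesis unfolding Q_def by blast
  qed
  then have "Q m (SOME y. Q m y)" for m by (rule someI_ex)
  then obtain Y where "\<And>m. Q m (Y m)" by (rule that)
  then have Yc: "\<And>m k. k \<in> J \<Longrightarrow> continuous_on {0..} (Y m k)"
    and Y: "\<And>m k t. k \<in> J \<Longrightarrow> 0 \<le> t \<Longrightarrow> Y m k t = F k t + integral {0..t} (\<lambda>s. \<Phi> m k s (\<lambda>j. Y m j s))"
    by (auto simp: Q_def)
  have \<Phi>c: "continuous_on {0..} (\<lambda>s. \<Phi> m k s (\<lambda>j. Y m j s))" if "k \<in> J" for m k
    unfolding \<Phi>_def by (intro continuous_on_add continuous_on_mult continuous_on_const cM cS Yc that)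
  define KS where "KS = (\<Sum>k\<in>J. K k)"
  have KS: "KS \<ge> 0" unfolding KS_def using K by (intro sum_nonneg)
  have Kle: "K k \<le> KS" if "k \<in> J" for k unfolding KS_def using that K J by (intro member_le_sum) auto
  have close: "(Y m k t - Y p k t)^2 \<le> exp (2 * A * t) * (KS * (1 / real (Suc m) + 1 / real (Suc p)))"
    if k: "k \<in> J" and t: "t \<ge> 0" for m p k t
  proof -
    define \<Delta> where "\<Delta> k t = Y m k t - Y p k t" for k t
    define g where "g k t = \<Phi> m k t (\<lambda>j. Y m j t) - \<Phi> p k t (\<lambda>j. Y p j t)" for k t
    \<comment> \<open>The monotonicity defect summed over all coordinates with their gains. Adding
      it to \<open>W\<close> turns an affine differential inequality into a homogeneous one.\<close>
    define b where "b = KS * (1 / real (Suc m) + 1 / real (Suc p))"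
    have b0: "b \<ge> 0" using KS by (simp add: b_def)
    define W where "W t = (\<Sum>k\<in>J. (\<Delta> k t)^2)" for t
    define W' where "W' t = (\<Sum>k\<in>J. 2 * (\<Delta> k t * g k t))" for t
    have W0: "W t \<ge> 0" for t unfolding W_def by (intro sum_nonneg) auto
    have dD: "(\<Delta> k has_real_derivative g k t) (at t within {0..})" if "k \<in> J" "t \<ge> 0" for k t
    proof (rule has_field_derivative_transform_within[where d = 1])
      show "((\<lambda>x. integral {0..x} (\<lambda>s. \<Phi> m k s (\<lambda>j. Y m j s)) - integral {0..x} (\<lambda>s. \<Phi> p k s (\<lambda>j. Y p j s)))
          has_real_derivative g k t) (at t within {0..})"
        unfolding g_def by (intro DERIV_diff integral_has_real_derivative_atLeast \<Phi>c that)
      show "integral {0..x} (\<lambda>s. \<Phi> m k s (\<lambda>j. Y m j s)) - integral {0..x} (\<lambda>s. \<Phi> p k s (\<lambda>j. Y p j s)) = \<Delta> k x"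
        if "x \<in> {0..}" for x
        using Y[OF \<open>k \<in> J\<close>, of x m] Y[OF \<open>k \<in> J\<close>, of x p] that by (simp add: \<Delta>_def)
    qed (use that in auto)
    have dW: "((\<lambda>t. W t + b) has_real_derivative W' t) (at t within {0..})" if "t \<ge> 0" for t
    proof -
      have "((\<lambda>t. (\<Delta> k t)^2) has_real_derivative 2 * (\<Delta> k t * g k t)) (at t within {0..})" if "k \<in> J" for k
        by (rule DERIV_cong[OF DERIV_power[OF dD[OF that \<open>t \<ge> 0\<close>]]]) simp
      then have "(W has_real_derivative W' t) (at t within {0..})"
        unfolding W_def[abs_def] W'_def by (rule DERIV_sum)
      from DERIV_add[OF this DERIV_const[of b]] show ?thesis by simp
    qed
    have W'le: "W' t \<le> 2 * A * (W t + b)" for t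
    proof -
      have "\<Delta> k t * g k t \<le> (\<Sum>j\<in>J. \<bar>M k j\<bar> * W t) + K k * (1 / real (Suc m) + 1 / real (Suc p))" if k: "k \<in> J" for k
      proof -
        have "\<Delta> k t * g k t = (\<Sum>j\<in>J. M k j * (\<Delta> k t * \<Delta> j t)) +
           K k * ((Y m k t - Y p k t) * (sat ((r k t - Y m k t) * real (Suc m)) - sat ((r k t - Y p k t) * real (Suc p))))"
        proof -
          have "g k t = (\<Sum>j\<in>J. M k j * \<Delta> j t) +
             K k * (sat ((r k t - Y m k t) * real (Suc m)) - sat ((r k t - Y p k t) * real (Suc p)))"
            by (simp add: g_def \<Phi>_def \<Delta>_def sum_subtractf right_diff_distrib)
          then show ?thesis by (simp add: distrib_left sum_distrib_left \<Delta>_def ac_simps)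
        qed
        also have "\<dots> \<le> (\<Sum>j\<in>J. \<bar>M k j\<bar> * W t) + K k * (1 / real (Suc m) + 1 / real (Suc p))"
        proof (intro add_mono sum_mono mult_left_mono sat_monotone_defect K k)
          fix j assume j: "j \<in> J"
          have sq: "(\<Delta> i t)^2 \<le> W t" if "i \<in> J" for i unfolding W_def using J that by (intro member_le_sum) auto
          have "2 * \<bar>\<Delta> k t * \<Delta> j t\<bar> \<le> (\<Delta> k t)^2 + (\<Delta> j t)^2"
            using zero_le_power2[of "\<Delta> k t - \<Delta> j t"] zero_le_power2[of "\<Delta> k t + \<Delta> j t"]
            by (simp add: power2_eq_square algebra_simps abs_if)
          then have "\<bar>\<Delta> k t * \<Delta> j t\<bar> \<le> W t" using sq[OF k] sq[OF j] by linarith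
          then have "\<bar>M k j\<bar> * \<bar>\<Delta> k t * \<Delta> j t\<bar> \<le> \<bar>M k j\<bar> * W t" by (intro mult_left_mono) auto
          then show "M k j * (\<Delta> k t * \<Delta> j t) \<le> \<bar>M k j\<bar> * W t" unfolding abs_mult[symmetric] by linarith
        qed auto
        finally show ?thesis .
      qed
      then have "(\<Sum>k\<in>J. \<Delta> k t * g k t) \<le> (\<Sum>k\<in>J. (\<Sum>j\<in>J. \<bar>M k j\<bar> * W t) + K k * (1 / real (Suc m) + 1 / real (Suc p)))"
        by (rule sum_mono)
      also have "\<dots> = (\<Sum>k\<in>J. \<Sum>j\<in>J. \<bar>M k j\<bar>) * W t + b"
        by (simp only: sum.distrib sum_distrib_right KS_def b_def)
      also have "\<dots> \<le> A * W t + A * b"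
        using W0[of t] b0 A1 by (intro add_mono mult_right_mono) (auto simp: A_def mult_le_cancel_right1)
      finally show ?thesis unfolding W'_def by (simp add: sum_distrib_left[symmetric] algebra_simps)
    qed
    have "W t + b \<le> exp (2 * A * t) * (W 0 + b)"
      by (rule exp_decay_of_deriv[OF dW W'le t])
    moreover have "W 0 = 0" using Y[where t = 0] by (simp add: W_def \<Delta>_def)
    moreover have "(\<Delta> k t)^2 \<le> W t" unfolding W_def using J k by (intro member_le_sum) auto
    ultimately have "(\<Delta> k t)^2 \<le> exp (2 * A * t) * b" using b0 by simp
    then show ?thesis by (simp add: \<Delta>_def b_def)
  qed
  have cauchy: "uniformly_Cauchy_on {0..T} (\<lambda>m. Y m k)" if k: "k \<in> J" and T: "T \<ge> 0" for k T
  proof (rule uniformly_Cauchy_onI)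
    fix e :: real assume e: "e > 0"
    define B where "B = exp (2 * A * T) * KS + 1"
    have B: "B > 0" unfolding B_def using KS by (intro add_nonneg_pos) auto
    \<comment> \<open>The two reciprocals in \<open>close\<close> together cost at most twice this
      amount, so the squared distance stays below e^2.\<close>
    obtain N where N: "1 / real (Suc N) < e^2 / (2 * B)" using nat_approx_posE[of "e^2 / (2 * B)"] e B by auto
    have "dist (Y m k t) (Y p k t) < e" if t: "t \<in> {0..T}" and mp: "m \<ge> N" "p \<ge> N" for t m p
    proof -
      have s: "1 / real (Suc m) \<le> 1 / real (Suc N)" "1 / real (Suc p) \<le> 1 / real (Suc N)"
        using mp by (auto intro!: divide_left_mono)
      have "(Y m k t - Y p k t)^2 \<le> exp (2 * A * t) * (KS * (1 / real (Suc m) + 1 / real (Suc p)))"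
        using close[OF k] t by simp
      also have "\<dots> \<le> exp (2 * A * T) * (KS * (2 * (1 / real (Suc N))))"
        using t A1 KS s by (intro mult_mono) auto
      also have "\<dots> = (exp (2 * A * T) * KS) * (2 * (1 / real (Suc N)))" by (simp only: mult.assoc)
      also have "\<dots> \<le> B * (2 * (1 / real (Suc N)))" by (intro mult_right_mono) (auto simp: B_def)
      also have "\<dots> < B * (2 * (e^2 / (2 * B)))" using N B by (intro mult_strict_left_mono) auto
      also have "\<dots> = e^2" using B by simp
      finally have "\<bar>Y m k t - Y p k t\<bar> < e" using e by (metis abs_le_square_iff abs_of_pos not_less)
      then show ?thesis by (simp add: dist_real_def)
    qed
    then show "\<exists>M. \<forall>x\<in>{0..T}. \<forall>m\<ge>M. \<forall>n\<ge>M. dist (Y m k x) (Y n k x) < e" by blast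
  qed
  define y where "y k t = lim (\<lambda>m. Y m k t)" for k t
  have unif: "uniform_limit {0..T} (\<lambda>m. Y m k) (y k) sequentially" if "k \<in> J" "T \<ge> 0" for k T
    using Cauchy_uniformly_convergent[OF cauchy[OF that]]
    unfolding uniformly_convergent_uniform_limit_iff y_def[abs_def] .
  have yc: "continuous_on {0..} (y k)" if "k \<in> J" for k
  proof (rule continuous_on_atLeastI)
    fix T :: real assume "0 \<le> T"
    show "continuous_on {0..T} (y k)"
      by (rule uniform_limit_theorem[OF _ unif[OF that \<open>0 \<le> T\<close>]])
         (auto intro!: always_eventually continuous_on_subset[OF Yc[OF that]])
  qed
  have ptw: "(\<lambda>m. Y m k t) \<longlonglongrightarrow> y k t" if "k \<in> J" "t \<ge> 0" for k t
    using tendsto_uniform_limitI[OF unif[OF that], of t] that by auto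
  \<comment> \<open>The saturated terms themselves need not converge. Their integrals
    \<open>S\<close> do, because the equation expresses them through \<open>Y\<close>, and
    \<open>P\<close> is what the limit of the equation gives.\<close>
  define S where "S m k t = integral {0..t} (\<lambda>s. K k * sat ((r k s - Y m k s) * real (Suc m)))" for m k t
  define P where "P k t = y k t - F k t - integral {0..t} (\<lambda>s. \<Sum>j\<in>J. M k j * y j s)" for k t
  have SY: "S m k t = Y m k t - F k t - integral {0..t} (\<lambda>s. \<Sum>j\<in>J. M k j * Y m j s)" if "k \<in> J" "t \<ge> 0" for m k t
  proof -
    have "integral {0..t} (\<lambda>s. \<Phi> m k s (\<lambda>j. Y m j s)) = integral {0..t} (\<lambda>s. \<Sum>j\<in>J. M k j * Y m j s) + S m k t"
      unfolding \<Phi>_def S_def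
      by (intro Henstock_Kurzweil_Integration.integral_add integrable_continuous_real continuous_on_mult
            continuous_on_const continuous_on_subset[OF cM[OF Yc]] continuous_on_subset[OF cS[OF _ Yc]] that) auto
    then show ?thesis using Y[OF that, of m] by simp
  qed
  have SP: "(\<lambda>m. S m k t) \<longlonglongrightarrow> P k t" if k: "k \<in> J" and t: "t \<ge> 0" for k t
  proof -
    have "uniform_limit {0..t} (\<lambda>m s. \<Sum>j\<in>J. M k j * Y m j s) (\<lambda>s. \<Sum>j\<in>J. M k j * y j s) sequentially"
      unfolding uniform_limit_iff
    proof (intro allI impI)
      fix e :: real assume e: "e > 0"
      define L where "L = A * real (card J) + 1"
      have L: "L > 0" using A1 by (simp add: L_def add_nonneg_pos)
      have "\<forall>\<^sub>F m in sequentially. \<forall>j\<in>J. \<forall>s\<in>{0..t}. dist (Y m j s) (y j s) < e / L"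
        unfolding eventually_ball_finite_distrib[OF J]
        using unif[OF _ t] e L unfolding uniform_limit_iff by simp
      then show "\<forall>\<^sub>F m in sequentially. \<forall>s\<in>{0..t}. dist (\<Sum>j\<in>J. M k j * Y m j s) (\<Sum>j\<in>J. M k j * y j s) < e"
      proof eventually_elim
        case (elim m)
        show ?case
        proof
          fix s assume s: "s \<in> {0..t}"
          have "\<bar>(\<Sum>j\<in>J. M k j * Y m j s) - (\<Sum>j\<in>J. M k j * y j s)\<bar> = \<bar>\<Sum>j\<in>J. M k j * (Y m j s - y j s)\<bar>"
            by (simp add: sum_subtractf right_diff_distrib)
          also have "\<dots> \<le> (\<Sum>j\<in>J. A * (e / L))"
          proof (intro order.trans[OF sum_abs] sum_mono)
            fix j assume j: "j \<in> J"
            have "\<bar>Y m j s - y j s\<bar> \<le> e / L" using elim[rule_format, OF j s] by (simp add: dist_real_def)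
            then show "\<bar>M k j * (Y m j s - y j s)\<bar> \<le> A * (e / L)"
              unfolding abs_mult using A1 by (intro mult_mono Mle k j) auto
          qed
          also have "\<dots> = (A * real (card J)) * (e / L)" by simp
          also have "\<dots> < L * (e / L)" using e L by (intro mult_strict_right_mono) (auto simp: L_def)
          also have "\<dots> = e" using L by simp
          finally show "dist (\<Sum>j\<in>J. M k j * Y m j s) (\<Sum>j\<in>J. M k j * y j s) < e" by (simp add: dist_real_def)
        qed
      qed
    qed
    then obtain I I' where I: "\<And>m. ((\<lambda>s. \<Sum>j\<in>J. M k j * Y m j s) has_integral I m) {0..t}"
      and I': "((\<lambda>s. \<Sum>j\<in>J. M k j * y j s) has_integral I') {0..t}" and II: "I \<longlonglongrightarrow> I'"
    proof (rule uniform_limit_integral)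
      show "continuous_on {0..t} (\<lambda>s. \<Sum>j\<in>J. M k j * Y m j s)" for m
        by (rule continuous_on_subset[OF cM[OF Yc]]) auto
    qed auto
    show ?thesis
      unfolding SY[OF that] P_def integral_unique[OF I] integral_unique[OF I']
      by (intro tendsto_intros II ptw that)
  qed
  have Sdiff: "S m k b - S m k a = integral {a..b} (\<lambda>s. K k * sat ((r k s - Y m k s) * real (Suc m)))"
    if "k \<in> J" "0 \<le> a" "a \<le> b" for m k a b
  proof -
    have "(\<lambda>s. K k * sat ((r k s - Y m k s) * real (Suc m))) integrable_on {0..b}"
      by (intro integrable_continuous_real continuous_on_mult continuous_on_const continuous_on_subset[OF cS[OF _ Yc]] that) auto
    from Henstock_Kurzweil_Integration.integral_combine[OF that(2,3) this] show ?thesis by (simp add: S_def)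
  qed
  have cSab: "continuous_on {a..b} (\<lambda>s. K k * sat ((r k s - Y m k s) * real (Suc m)))" if "k \<in> J" "0 \<le> a" for m k a b
    by (intro continuous_on_mult continuous_on_const continuous_on_subset[OF cS[OF _ Yc]] that) (use that in auto)
  have Plip: "\<bar>P k b - P k a\<bar> \<le> K k * (b - a)" if k: "k \<in> J" and ab: "0 \<le> a" "a \<le> b" for k a b
  proof (rule tendsto_le[OF trivial_limit_sequentially tendsto_const])
    show "(\<lambda>m. \<bar>S m k b - S m k a\<bar>) \<longlonglongrightarrow> \<bar>P k b - P k a\<bar>"
      using k ab by (intro tendsto_intros SP) auto
    have "\<bar>S m k b - S m k a\<bar> \<le> K k * (b - a)" for m
      unfolding Sdiff[OF that] real_norm_def[symmetric]
    proof (rule integral_bound[OF ab(2) cSab[OF k ab(1)]])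
      fix s
      have "K k * \<bar>sat ((r k s - Y m k s) * real (Suc m))\<bar> \<le> K k * 1"
        by (intro mult_left_mono sat_bounds K k)
      then show "norm (K k * sat ((r k s - Y m k s) * real (Suc m))) \<le> K k" using K[OF k] by (simp add: abs_mult)
    qed
    then show "\<forall>\<^sub>F m in sequentially. \<bar>S m k b - S m k a\<bar> \<le> K k * (b - a)" by simp
  qed
  define QR where "QR k \<rho> \<longleftrightarrow> \<rho> \<in> borel_measurable borel \<and> (\<forall>x. \<bar>\<rho> x\<bar> \<le> K k) \<and>
      (\<forall>a b. 0 \<le> a \<longrightarrow> a \<le> b \<longrightarrow> (\<rho> has_integral (P k b - P k a)) {a..b})" for k \<rho>
  have "\<exists>\<rho>. QR k \<rho>" if "k \<in> J" for k
    by (rule lipschitz_density[OF Plip[OF that] K[OF that]]) (auto simp: QR_def)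
  then have "QR k (SOME \<rho>. QR k \<rho>)" if "k \<in> J" for k using that someI_ex[of "QR k"] by blast
  then obtain \<rho> where "\<And>k. k \<in> J \<Longrightarrow> QR k (\<rho> k)" by (rule that)
  then have \<rho>: "\<And>k. k \<in> J \<Longrightarrow> \<rho> k \<in> borel_measurable borel" "\<And>k x. k \<in> J \<Longrightarrow> \<bar>\<rho> k x\<bar> \<le> K k"
    "\<And>k a b. k \<in> J \<Longrightarrow> 0 \<le> a \<Longrightarrow> a \<le> b \<Longrightarrow> (\<rho> k has_integral (P k b - P k a)) {a..b}"
    by (auto simp: QR_def)
  have Pconst: "P k b - P k a = sg * K k * (b - a)"
    if k: "k \<in> J" and ab: "0 \<le> a" "a \<le> b" and sg: "sg \<in> {1, -1}"
      and pos: "\<And>x. x \<in> {a..b} \<Longrightarrow> sg * (r k x - y k x) > 0" for k a b and sg :: real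
  proof -
    have "continuous_on {a..b} (\<lambda>x. sg * (r k x - y k x))"
      by (intro continuous_intros continuous_on_subset[OF r] continuous_on_subset[OF yc] k) (use ab in auto)
    then obtain x0 where x0: "x0 \<in> {a..b}" "\<And>x. x \<in> {a..b} \<Longrightarrow> sg * (r k x0 - y k x0) \<le> sg * (r k x - y k x)"
      using continuous_attains_inf[of "{a..b}" "\<lambda>x. sg * (r k x - y k x)"] ab by auto
    \<comment> \<open>A margin on a compact interval where r - y keeps its sign. Once the
      approximations are within d/2 and the slope exceeds 2/d, the saturation equals its extreme
      value exactly on the whole interval.\<close>
    define d where "d = sg * (r k x0 - y k x0)"
    have d: "d > 0" using pos[OF x0(1)] by (simp add: d_def)
    have "\<forall>\<^sub>F m in sequentially. \<forall>x\<in>{0..b}. dist (Y m k x) (y k x) < d / 2"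
      by (rule uniform_limitD[OF unif[OF k]]) (use ab d in auto)
    moreover have "\<forall>\<^sub>F m in sequentially. 2 / d \<le> real m"
      by (rule eventually_compose_filterlim[OF eventually_ge_at_top filterlim_real_sequentially])
    ultimately have "\<forall>\<^sub>F m in sequentially. S m k b - S m k a = sg * K k * (b - a)"
    proof eventually_elim
      case (elim m)
      have "sat ((r k s - Y m k s) * real (Suc m)) = sg" if s: "s \<in> {a..b}" for s
      proof -
        have "s \<in> {0..b}" using s ab by auto
        from elim(1)[rule_format, OF this] have near: "\<bar>Y m k s - y k s\<bar> < d / 2" by (simp add: dist_real_def)
        have dle: "d \<le> sg * (r k s - y k s)" using x0(2)[OF s] by (simp add: d_def)
        have "sg = 1 \<or> sg = -1" using sg by auto
        then have "sg * (r k s - Y m k s) \<ge> d / 2"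
        proof
          assume [simp]: "sg = 1"
          have "d \<le> r k s - y k s" using dle by simp
          then have "d / 2 \<le> r k s - Y m k s" using near by linarith
          then show ?thesis by simp
        next
          assume [simp]: "sg = -1"
          have "d \<le> y k s - r k s" using dle by simp
          then have "d / 2 \<le> Y m k s - r k s" using near by linarith
          then show ?thesis by simp
        qed
        then have "d / 2 * (2 / d) \<le> (sg * (r k s - Y m k s)) * real (Suc m)"
          using elim(2) d by (intro mult_mono) auto
        then have "1 \<le> sg * ((r k s - Y m k s) * real (Suc m))" using d by (simp add: mult.assoc)
        then show ?thesis using sg by (auto simp: sat_def)
      qed
      then have "integral {a..b} (\<lambda>s. K k * sat ((r k s - Y m k s) * real (Suc m))) = integral {a..b} (\<lambda>s. K k * sg)"
        by (intro integral_cong) simp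
      then show ?case unfolding Sdiff[OF k ab] using ab by (simp add: ac_simps)
    qed
    then have "(\<lambda>m. S m k b - S m k a) \<longlonglongrightarrow> sg * K k * (b - a)" by (rule tendsto_eventually)
    moreover have "(\<lambda>m. S m k b - S m k a) \<longlonglongrightarrow> P k b - P k a"
      using k ab by (intro tendsto_intros SP) auto
    ultimately show ?thesis by (rule LIMSEQ_unique[symmetric])
  qed
  show ?thesis
  proof (rule that[of y \<rho>])
    show "y k t = F k t + integral {0..t} (\<lambda>s. \<Sum>j\<in>J. M k j * y j s) + integral {0..t} (\<rho> k)"
      if "k \<in> J" "0 \<le> t" for k t
    proof -
      have "S m k 0 = 0" for m by (simp add: S_def)
      then have "P k 0 = 0" using SP[OF that(1), of 0] by (simp add: LIMSEQ_const_iff)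
      then have "integral {0..t} (\<rho> k) = P k t" using integral_unique[OF \<rho>(3)[OF that(1) _ that(2)]] by simp
      then show ?thesis by (simp add: P_def)
    qed
    show "AE s in lborel. 0 < s \<longrightarrow> y k s \<noteq> r k s \<longrightarrow> \<rho> k s = K k * sgn (r k s - y k s)" if k: "k \<in> J" for k
    proof -
      have "AE s in lborel. 0 < s \<longrightarrow> r k s - y k s > 0 \<longrightarrow> \<rho> k s = K k"
        by (rule AE_density_const[OF \<rho>(1)[OF k] \<rho>(2)[OF k] \<rho>(3)[OF k]])
           (use Pconst[OF k, of _ _ 1] in \<open>auto intro!: continuous_intros r yc k\<close>)
      moreover have "AE s in lborel. 0 < s \<longrightarrow> - (r k s - y k s) > 0 \<longrightarrow> - \<rho> k s = K k"
      proof (rule AE_density_const[where P = "\<lambda>t. - P k t"])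
        show "(\<lambda>x. - \<rho> k x) \<in> borel_measurable borel" using \<rho>(1)[OF k] by simp
        show "\<bar>- \<rho> k x\<bar> \<le> K k" for x using \<rho>(2)[OF k] by simp
        show "((\<lambda>x. - \<rho> k x) has_integral (- P k b - - P k a)) {a..b}" if "0 \<le> a" "a \<le> b" for a b
          using has_integral_neg[OF \<rho>(3)[OF k that]] by simp
        show "- P k b - - P k a = K k * (b - a)" if "0 \<le> a" "a \<le> b" "\<And>x. x \<in> {a..b} \<Longrightarrow> 0 < - (r k x - y k x)" for a b
          using Pconst[OF k that(1,2), of "-1"] that(3) by simp
      qed (intro continuous_intros r yc k)
      ultimately show ?thesis by eventually_elim (auto simp: sgn_if)
    qed
  qed (use yc \<rho> in auto)
qed

section \<open>Filippov sets of fields with signum terms\<close>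

text \<open>A half-space that contains \<open>X\<close> contains its closed convex hull; the
  coordinatewise tolerance is scaled by the sum of the |b k|.\<close>

lemma in_closed_hull_functional_le:
  assumes I: "finite I" and g: "in_closed_hull I X g"
    and le: "\<And>p. p \<in> X \<Longrightarrow> (\<Sum>k\<in>I. b k * p k) \<le> hi"
  shows "(\<Sum>k\<in>I. b k * g k) \<le> hi"
proof (rule field_le_epsilon)
  fix e :: real assume e: "e > 0"
  define B where "B = (\<Sum>k\<in>I. \<bar>b k\<bar>) + 1"
  have B: "B > 0" unfolding B_def by (intro add_nonneg_pos sum_nonneg) auto
  have "e / B > 0" using e B by simp
  from g[unfolded in_closed_hull_def, rule_format, OF this] obtain P c where P: "finite P" "P \<subseteq> X" "\<forall>p\<in>P. 0 \<le> c p" "sum c P = 1"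
    and near: "\<forall>k\<in>I. \<bar>g k - (\<Sum>p\<in>P. c p * p k)\<bar> < e / B"
    by blast
  have "(\<Sum>k\<in>I. b k * (\<Sum>p\<in>P. c p * p k)) = (\<Sum>k\<in>I. \<Sum>p\<in>P. c p * (b k * p k))"
    by (simp add: sum_distrib_left ac_simps)
  also have "\<dots> = (\<Sum>p\<in>P. c p * (\<Sum>k\<in>I. b k * p k))"
    by (subst sum.swap) (simp add: sum_distrib_left)
  also have "\<dots> \<le> (\<Sum>p\<in>P. c p * hi)" using P le by (intro sum_mono mult_left_mono) auto
  also have "\<dots> = hi" using P(4) by (simp add: sum_distrib_right[symmetric])
  finally have 1: "(\<Sum>k\<in>I. b k * (\<Sum>p\<in>P. c p * p k)) \<le> hi" .
  have "(\<Sum>k\<in>I. b k * (g k - (\<Sum>p\<in>P. c p * p k))) \<le> (\<Sum>k\<in>I. \<bar>b k\<bar> * (e / B))"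
  proof (rule sum_mono)
    fix k assume "k \<in> I"
    then have "\<bar>b k\<bar> * \<bar>g k - (\<Sum>p\<in>P. c p * p k)\<bar> \<le> \<bar>b k\<bar> * (e / B)"
      using near by (intro mult_left_mono) (auto simp: less_imp_le)
    then show "b k * (g k - (\<Sum>p\<in>P. c p * p k)) \<le> \<bar>b k\<bar> * (e / B)"
      unfolding abs_mult[symmetric] by linarith
  qed
  also have "\<dots> = (\<Sum>k\<in>I. \<bar>b k\<bar>) * (e / B)" unfolding sum_distrib_right ..
  also have "\<dots> \<le> B * (e / B)" using e B by (intro mult_right_mono) (auto simp: B_def)
  also have "\<dots> = e" using B by simp
  finally have "(\<Sum>k\<in>I. b k * g k) - (\<Sum>k\<in>I. b k * (\<Sum>p\<in>P. c p * p k)) \<le> e"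
    by (simp add: right_diff_distrib sum_subtractf)
  then show "(\<Sum>k\<in>I. b k * g k) \<le> hi + e" using 1 by linarith
qed

text \<open>\<open>in_closed_hull\<close> attaches weights to points and not to indices, so the
  weights of all indices with the same value have to be added up.\<close>

lemma indexed_convex_combination:
  assumes *: "finite \<Theta>" "p ` \<Theta> \<subseteq> X" "\<And>\<theta>. \<theta> \<in> \<Theta> \<Longrightarrow> 0 \<le> wt \<theta>" "sum wt \<Theta> = 1"
      "\<And>k. k \<in> I \<Longrightarrow> \<bar>g k - (\<Sum>\<theta>\<in>\<Theta>. wt \<theta> * p \<theta> k)\<bar> < (\<epsilon>::real)"
  shows "\<exists>P c. finite P \<and> P \<subseteq> X \<and> (\<forall>p\<in>P. 0 \<le> c p) \<and> sum c P = 1 \<and>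
      (\<forall>k\<in>I. \<bar>g k - (\<Sum>p\<in>P. c p * p k)\<bar> < \<epsilon>)"
proof -
  define c where "c q = (\<Sum>\<theta> | \<theta> \<in> \<Theta> \<and> p \<theta> = q. wt \<theta>)" for q
  have "sum c (p ` \<Theta>) = 1"
    unfolding c_def using sum.image_gen[OF *(1), of wt p] *(4) by simp
  moreover have "(\<Sum>q\<in>p ` \<Theta>. c q * q k) = (\<Sum>\<theta>\<in>\<Theta>. wt \<theta> * p \<theta> k)" for k
    unfolding sum.image_gen[OF *(1), of "\<lambda>\<theta>. wt \<theta> * p \<theta> k" p] c_def sum_distrib_right
    by (intro sum.cong refl) auto
  moreover have "\<forall>q\<in>p ` \<Theta>. 0 \<le> c q" unfolding c_def using *(3) by (auto intro!: sum_nonneg)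
  ultimately show ?thesis
    using *(1,2,5) by (intro exI[of _ "p ` \<Theta>"] exI[of _ c]) auto
qed

section \<open>Outer estimates of Filippov sets by linear functionals\<close>

text \<open>Neighbourhoods constrain the coordinates in \<open>I\<close> only, as do the boxes in
  \<open>filippov_set\<close>; as a filter they give access to the calculus of limits.\<close>

definition coord_nhds :: "idx set \<Rightarrow> (idx \<Rightarrow> real) \<Rightarrow> (idx \<Rightarrow> real) filter" where
  "coord_nhds I \<xi> = (INF \<delta>\<in>{0<..}. principal {\<zeta>. \<forall>k\<in>I. \<bar>\<zeta> k - \<xi> k\<bar> < \<delta>})"

lemma eventually_coord_nhds:
  "eventually P (coord_nhds I \<xi>) \<longleftrightarrow> (\<exists>\<delta>>0. \<forall>\<zeta>. (\<forall>k\<in>I. \<bar>\<zeta> k - \<xi> k\<bar> < \<delta>) \<longrightarrow> P \<zeta>)"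
  unfolding coord_nhds_def
proof (subst eventually_INF_base)
  fix a b :: real assume "a \<in> {0<..}" "b \<in> {0<..}"
  then show "\<exists>x\<in>{0<..}. principal {\<zeta>. \<forall>k\<in>I. \<bar>\<zeta> k - \<xi> k\<bar> < x} \<le>
      inf (principal {\<zeta>. \<forall>k\<in>I. \<bar>\<zeta> k - \<xi> k\<bar> < a}) (principal {\<zeta>. \<forall>k\<in>I. \<bar>\<zeta> k - \<xi> k\<bar> < b})"
    by (intro bexI[of _ "min a b"]) auto
qed (auto simp: eventually_principal)

lemma tendsto_coord_nhds: "k \<in> I \<Longrightarrow> ((\<lambda>\<zeta>. \<zeta> k) \<longlongrightarrow> \<xi> k) (coord_nhds I \<xi>)"
  unfolding tendsto_iff eventually_coord_nhds dist_real_def by blast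

text \<open>A box has positive product measure, so a point is left after the removal of a null
  set.\<close>

lemma emeasure_box_pos:
  assumes I: "finite (I :: idx set)" and d: "d > (0::real)" and S: "S \<in> null_sets (PiM I (\<lambda>_. lborel))"
  shows "\<not> {\<zeta> \<in> PiE I (\<lambda>_. UNIV). \<forall>k\<in>I. \<bar>\<zeta> k - \<xi> k\<bar> < d} \<subseteq> S"
proof
  let ?B = "{\<zeta> \<in> PiE I (\<lambda>_. UNIV). \<forall>k\<in>I. \<bar>\<zeta> k - \<xi> k\<bar> < d}"
  assume sub: "?B \<subseteq> S"
  interpret product_sigma_finite "\<lambda>_::idx. lborel :: real measure" ..
  have B: "?B = PiE I (\<lambda>k. {\<xi> k - d<..<\<xi> k + d})" by (fastforce simp: PiE_iff abs_less_iff extensional_def algebra_simps)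
  have "?B \<in> sets (PiM I (\<lambda>_. lborel))" unfolding B by (intro sets_PiM_I_finite I) auto
  then have "emeasure (PiM I (\<lambda>_. lborel)) ?B \<le> emeasure (PiM I (\<lambda>_. lborel)) S"
    using sub S by (intro emeasure_mono) auto
  also have "\<dots> = 0" using S by auto
  finally have "(\<Prod>k\<in>I. emeasure lborel {\<xi> k - d<..<\<xi> k + d}) = 0"
    unfolding B by (subst (asm) emeasure_PiM[OF I]) auto
  then show False using I d by simp
qed

text \<open>For outer bounds the empty null set and one small \<delta> suffice: an inequality for
  the field near \<xi> passes to the closed hull.\<close>

lemma filippov_set_functional_le:
  assumes I: "finite I" and g: "g \<in> filippov_set I f t \<xi>"
    and ev: "eventually (\<lambda>\<zeta>. (\<Sum>k\<in>I. b k * f t \<zeta> k) \<le> \<phi> \<zeta> + hi) (coord_nhds I \<xi>)"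
    and lim: "(\<phi> \<longlongrightarrow> \<phi> \<xi>) (coord_nhds I \<xi>)"
  shows "(\<Sum>k\<in>I. b k * g k) \<le> \<phi> \<xi> + hi"
proof (rule field_le_epsilon)
  fix e :: real assume e: "e > 0"
  have "eventually (\<lambda>\<zeta>. (\<Sum>k\<in>I. b k * f t \<zeta> k) \<le> \<phi> \<xi> + hi + e) (coord_nhds I \<xi>)"
    using ev tendstoD[OF lim e] by eventually_elim (auto simp: dist_real_def abs_less_iff)
  then obtain \<delta> where \<delta>: "\<delta> > 0"
    "\<And>\<zeta>. (\<forall>k\<in>I. \<bar>\<zeta> k - \<xi> k\<bar> < \<delta>) \<Longrightarrow> (\<Sum>k\<in>I. b k * f t \<zeta> k) \<le> \<phi> \<xi> + hi + e"
    unfolding eventually_coord_nhds by blast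
  have "in_closed_hull I (f t ` ({\<zeta> \<in> PiE I (\<lambda>_. UNIV). \<forall>k\<in>I. \<bar>\<zeta> k - \<xi> k\<bar> < \<delta>} - {})) g"
    using g \<delta>(1) unfolding filippov_set_def by blast
  then show "(\<Sum>k\<in>I. b k * g k) \<le> \<phi> \<xi> + hi + e"
    by (rule in_closed_hull_functional_le[OF I]) (use \<delta>(2) in auto)
qed

lemma eventually_sgn_eq:
  fixes h :: "'a \<Rightarrow> real"
  assumes "(h \<longlongrightarrow> l) F" "l \<noteq> 0"
  shows "eventually (\<lambda>\<zeta>. sgn (h \<zeta>) = sgn l) F"
proof (cases "l > 0")
  case True
  from order_tendstoD(1)[OF assms(1) this] show ?thesis by eventually_elim (use True in auto)
next
  case False
  then have "l < 0" using assms by auto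
  from order_tendstoD(2)[OF assms(1) this] show ?thesis by eventually_elim (use \<open>l < 0\<close> in auto)
qed

text \<open>A functional that meets a single signum reduces matters to the scalar picture: an
  interval of half-width |c| in general, a single value off the switching surface. The one-sided
  lemma is applied to \<open>b\<close> and to its negative.\<close>

lemma filippov_set_functional:
  assumes I: "finite I" and g: "g \<in> filippov_set I f t \<xi>"
    and eq: "\<And>\<zeta>. (\<Sum>k\<in>I. b k * f t \<zeta> k) = \<phi> \<zeta> + c * sgn (h \<zeta>)"
    and lim: "(\<phi> \<longlongrightarrow> \<phi> \<xi>) (coord_nhds I \<xi>)" "(h \<longlongrightarrow> h \<xi>) (coord_nhds I \<xi>)"
  shows "\<bar>(\<Sum>k\<in>I. b k * g k) - \<phi> \<xi>\<bar> \<le> \<bar>c\<bar>"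
    "h \<xi> \<noteq> 0 \<Longrightarrow> (\<Sum>k\<in>I. b k * g k) = \<phi> \<xi> + c * sgn (h \<xi>)"
proof -
  have neg: "(\<Sum>k\<in>I. - b k * f' k) = - (\<Sum>k\<in>I. b k * f' k)" for f' by (simp add: sum_negf)
  have bd: "\<bar>c * sgn x\<bar> \<le> \<bar>c\<bar>" for x by (simp add: abs_mult sgn_if)
  have "(\<Sum>k\<in>I. b k * g k) \<le> \<phi> \<xi> + \<bar>c\<bar>"
  proof (rule filippov_set_functional_le[OF I g _ lim(1)])
    show "\<forall>\<^sub>F \<zeta> in coord_nhds I \<xi>. (\<Sum>k\<in>I. b k * f t \<zeta> k) \<le> \<phi> \<zeta> + \<bar>c\<bar>"
      using bd by (auto simp: eq abs_le_iff intro!: always_eventually)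
  qed
  moreover have "(\<Sum>k\<in>I. - b k * g k) \<le> - \<phi> \<xi> + \<bar>c\<bar>"
  proof (rule filippov_set_functional_le[OF I g _ tendsto_minus[OF lim(1)]])
    show "\<forall>\<^sub>F \<zeta> in coord_nhds I \<xi>. (\<Sum>k\<in>I. - b k * f t \<zeta> k) \<le> - \<phi> \<zeta> + \<bar>c\<bar>"
      unfolding neg eq using bd by (auto simp: abs_le_iff intro!: always_eventually)
  qed
  ultimately show "\<bar>(\<Sum>k\<in>I. b k * g k) - \<phi> \<xi>\<bar> \<le> \<bar>c\<bar>" unfolding neg by linarith
  assume h: "h \<xi> \<noteq> 0"
  note ev = eventually_sgn_eq[OF lim(2) h]
  have "(\<Sum>k\<in>I. b k * g k) \<le> \<phi> \<xi> + c * sgn (h \<xi>)"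
  proof (rule filippov_set_functional_le[OF I g _ lim(1)])
    show "\<forall>\<^sub>F \<zeta> in coord_nhds I \<xi>. (\<Sum>k\<in>I. b k * f t \<zeta> k) \<le> \<phi> \<zeta> + c * sgn (h \<xi>)"
      using ev by eventually_elim (simp add: eq)
  qed
  moreover have "(\<Sum>k\<in>I. - b k * g k) \<le> - \<phi> \<xi> + - (c * sgn (h \<xi>))"
  proof (rule filippov_set_functional_le[OF I g _ tendsto_minus[OF lim(1)]])
    show "\<forall>\<^sub>F \<zeta> in coord_nhds I \<xi>. (\<Sum>k\<in>I. - b k * f t \<zeta> k) \<le> - \<phi> \<zeta> + - (c * sgn (h \<xi>))"
      unfolding neg eq using ev by eventually_elim simp
  qed
  ultimately show "(\<Sum>k\<in>I. b k * g k) = \<phi> \<xi> + c * sgn (h \<xi>)" unfolding neg by linarith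
qed

text \<open>Independent random signs with expectations \<open>\<sigma> z\<close> exhibit \<open>\<sigma>\<close> as a convex combination of sign patterns.\<close>

lemma sign_pattern_weights:
  fixes \<sigma> :: "'z \<Rightarrow> real"
  assumes Z: "finite Z" and \<sigma>: "\<And>z. z \<in> Z \<Longrightarrow> \<bar>\<sigma> z\<bar> \<le> 1"
  defines "\<Theta> \<equiv> PiE Z (\<lambda>_. {1, -1::real})" and "wt \<equiv> (\<lambda>\<theta>. \<Prod>z\<in>Z. (1 + \<theta> z * \<sigma> z) / 2)"
  shows "finite \<Theta>" "\<And>\<theta>. \<theta> \<in> \<Theta> \<Longrightarrow> 0 \<le> wt \<theta>" "sum wt \<Theta> = 1"
    "\<And>z. z \<in> Z \<Longrightarrow> (\<Sum>\<theta>\<in>\<Theta>. wt \<theta> * \<theta> z) = \<sigma> z"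
proof -
  show "finite \<Theta>" unfolding \<Theta>_def using Z by (intro finite_PiE) auto
  show "0 \<le> wt \<theta>" if "\<theta> \<in> \<Theta>" for \<theta>
    unfolding wt_def
  proof (rule prod_nonneg)
    fix z assume "z \<in> Z"
    moreover from this have "\<theta> z = 1 \<or> \<theta> z = -1" using that by (auto simp: \<Theta>_def PiE_iff)
    ultimately show "0 \<le> (1 + \<theta> z * \<sigma> z) / 2" using \<sigma>[of z] by (auto simp: abs_le_iff)
  qed
  show "sum wt \<Theta> = 1"
    unfolding wt_def \<Theta>_def
    by (subst prod_sum_PiE[symmetric, where f = "\<lambda>z a. (1 + a * \<sigma> z) / 2"]) (use Z in \<open>auto simp: field_simps\<close>)
  fix z assume z: "z \<in> Z"
  \<comment> \<open>The additional factor is placed at x = z only: the two-term sums at all other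
    places equal 1, the one at z equals \<sigma> z.\<close>
  have "(\<Sum>\<theta>\<in>\<Theta>. wt \<theta> * \<theta> z) = (\<Sum>\<theta>\<in>\<Theta>. \<Prod>x\<in>Z. (1 + \<theta> x * \<sigma> x) / 2 * (if x = z then \<theta> x else 1))"
    unfolding wt_def prod.distrib using Z z by (intro sum.cong refl) simp
  also have "\<dots> = (\<Prod>x\<in>Z. \<Sum>a\<in>{1, -1}. (1 + a * \<sigma> x) / 2 * (if x = z then a else 1))"
    unfolding \<Theta>_def by (subst prod_sum_PiE) (use Z in auto)
  also have "\<dots> = (\<Prod>x\<in>Z. if x = z then \<sigma> z else 1)"
    by (intro prod.cong refl) (auto simp: field_simps)
  also have "\<dots> = \<sigma> z" using Z z by simp
  finally show "(\<Sum>\<theta>\<in>\<Theta>. wt \<theta> * \<theta> z) = \<sigma> z" .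
qed

section \<open>Inner estimates of Filippov sets\<close>

text \<open>\<open>dir\<close> is a transversality condition: arbitrarily small displacements give
  the vanishing arguments any pattern of signs. Each pattern persists on a box of positive measure,
  hence at a point outside the null set, and the random-sign weights average the values at these
  points to \<open>g\<close> up to \<epsilon>.\<close>

lemma filippov_set_memI:
  fixes arg :: "'z \<Rightarrow> (idx \<Rightarrow> real) \<Rightarrow> real"
  assumes I: "finite I" and Z: "finite Z"
    and f: "\<And>k \<zeta>. k \<in> I \<Longrightarrow> f t \<zeta> k = lin k \<zeta> + (\<Sum>z\<in>Z. C k z * sgn (arg z \<zeta>))"
    and lin: "\<And>k. k \<in> I \<Longrightarrow> (lin k \<longlongrightarrow> lin k \<xi>) (coord_nhds I \<xi>)"
    and arg: "\<And>z \<zeta>. z \<in> Z \<Longrightarrow> (arg z \<longlongrightarrow> arg z \<zeta>) (coord_nhds I \<zeta>)"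
    and dir: "\<And>\<theta>. \<exists>D. \<forall>\<eta>. \<forall>z\<in>Z. arg z (\<lambda>k. \<xi> k + \<eta> * D k) = arg z \<xi> + \<eta> * \<theta> z"
    and g: "\<And>k. k \<in> I \<Longrightarrow> g k = lin k \<xi> + (\<Sum>z\<in>Z. C k z * \<sigma> z)"
    and \<sigma>: "\<And>z. z \<in> Z \<Longrightarrow> \<bar>\<sigma> z\<bar> \<le> 1" "\<And>z. z \<in> Z \<Longrightarrow> arg z \<xi> \<noteq> 0 \<Longrightarrow> \<sigma> z = sgn (arg z \<xi>)"
  shows "g \<in> filippov_set I f t \<xi>"
  unfolding filippov_set_def in_closed_hull_def
proof (intro CollectI allI impI ballI)
  fix \<delta> \<epsilon> :: real and S :: "(idx \<Rightarrow> real) set" assume d: "\<delta> > 0" and S: "S \<in> null_sets (PiM I (\<lambda>_. lborel))" and e: "\<epsilon> > 0"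
  \<comment> \<open>Only vanishing arguments leave freedom; the others keep their sign near \<xi>,
    where \<sigma> is prescribed.\<close>
  define Z0 where "Z0 = {z \<in> Z. arg z \<xi> = 0}"
  have Z0: "finite Z0" "\<And>z. z \<in> Z0 \<Longrightarrow> \<bar>\<sigma> z\<bar> \<le> 1" using Z \<sigma> by (auto simp: Z0_def)
  define \<Theta> where "\<Theta> = PiE Z0 (\<lambda>_. {1, -1::real})"
  define wt where "wt \<theta> = (\<Prod>z\<in>Z0. (1 + \<theta> z * \<sigma> z) / 2)" for \<theta>
  note w = sign_pattern_weights[where \<sigma> = \<sigma>, OF Z0, folded \<Theta>_def, folded wt_def]
  have "eventually (\<lambda>\<zeta>. (\<forall>k\<in>I. dist (lin k \<zeta>) (lin k \<xi>) < \<epsilon>) \<and> (\<forall>z\<in>Z - Z0. sgn (arg z \<zeta>) = sgn (arg z \<xi>))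
      \<and> (\<forall>k\<in>I. \<bar>\<zeta> k - \<xi> k\<bar> < \<delta>)) (coord_nhds I \<xi>)"
  proof (intro eventually_conj)
    show "\<forall>\<^sub>F \<zeta> in coord_nhds I \<xi>. \<forall>k\<in>I. dist (lin k \<zeta>) (lin k \<xi>) < \<epsilon>"
      unfolding eventually_ball_finite_distrib[OF I] using tendstoD[OF lin e] by blast
    show "\<forall>\<^sub>F \<zeta> in coord_nhds I \<xi>. \<forall>z\<in>Z - Z0. sgn (arg z \<zeta>) = sgn (arg z \<xi>)"
      unfolding eventually_ball_finite_distrib[OF finite_Diff[OF Z]]
      using eventually_sgn_eq[OF arg] by (auto simp: Z0_def)
    show "\<forall>\<^sub>F \<zeta> in coord_nhds I \<xi>. \<forall>k\<in>I. \<bar>\<zeta> k - \<xi> k\<bar> < \<delta>"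
      unfolding eventually_coord_nhds using d by blast
  qed
  then obtain d1 where d1: "d1 > 0" "\<And>\<zeta>. \<forall>k\<in>I. \<bar>\<zeta> k - \<xi> k\<bar> < d1 \<Longrightarrow>
      (\<forall>k\<in>I. dist (lin k \<zeta>) (lin k \<xi>) < \<epsilon>) \<and> (\<forall>z\<in>Z - Z0. sgn (arg z \<zeta>) = sgn (arg z \<xi>))
      \<and> (\<forall>k\<in>I. \<bar>\<zeta> k - \<xi> k\<bar> < \<delta>)"
    unfolding eventually_coord_nhds by blast
  let ?good = "\<lambda>(\<theta> :: 'z \<Rightarrow> real) (\<zeta> :: idx \<Rightarrow> real). \<zeta> \<in> PiE I (\<lambda>_. UNIV) \<and> \<zeta> \<notin> S \<and> (\<forall>k\<in>I. \<bar>\<zeta> k - \<xi> k\<bar> < d1) \<and> (\<forall>z\<in>Z0. sgn (arg z \<zeta>) = \<theta> z)"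
  have "\<exists>\<zeta>. ?good \<theta> \<zeta>" if \<theta>: "\<theta> \<in> \<Theta>" for \<theta>
  proof -
    obtain D where D: "\<And>\<eta> z. z \<in> Z \<Longrightarrow> arg z (\<lambda>k. \<xi> k + \<eta> * D k) = arg z \<xi> + \<eta> * \<theta> z"
      using dir[of \<theta>] by blast
    define B where "B = (\<Sum>k\<in>I. \<bar>D k\<bar>) + 1"
    have B: "B > 0" unfolding B_def by (intro add_nonneg_pos sum_nonneg) auto
    define \<eta> where "\<eta> = d1 / (2 * B)"
    have \<eta>: "\<eta> > 0" using d1 B by (simp add: \<eta>_def)
    define \<zeta>0 where "\<zeta>0 = (\<lambda>k. \<xi> k + \<eta> * D k)"
    have near0: "\<bar>\<zeta>0 k - \<xi> k\<bar> < d1" if "k \<in> I" for k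
    proof -
      have "\<bar>D k\<bar> \<le> (\<Sum>k\<in>I. \<bar>D k\<bar>)" using that I by (intro member_le_sum) auto
      then have "\<eta> * \<bar>D k\<bar> \<le> \<eta> * B" using \<eta> by (intro mult_left_mono) (auto simp: B_def)
      also have "\<dots> < d1" using d1 B by (simp add: \<eta>_def)
      finally show ?thesis using \<eta> by (simp add: \<zeta>0_def abs_mult)
    qed
    have a0: "arg z \<zeta>0 = \<eta> * \<theta> z" if "z \<in> Z0" for z using D[of z \<eta>] that by (auto simp: Z0_def \<zeta>0_def)
    have th: "\<theta> z = 1 \<or> \<theta> z = -1" if "z \<in> Z0" for z using \<theta> that by (auto simp: \<Theta>_def PiE_iff)
    have "eventually (\<lambda>\<zeta>. (\<forall>k\<in>I. \<bar>\<zeta> k - \<xi> k\<bar> < d1) \<and> (\<forall>z\<in>Z0. sgn (arg z \<zeta>) = sgn (arg z \<zeta>0))) (coord_nhds I \<zeta>0)"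
    proof (intro eventually_conj)
      show "\<forall>\<^sub>F \<zeta> in coord_nhds I \<zeta>0. \<forall>k\<in>I. \<bar>\<zeta> k - \<xi> k\<bar> < d1"
        unfolding eventually_ball_finite_distrib[OF I]
      proof
        fix k assume k: "k \<in> I"
        have "((\<lambda>\<zeta>. \<bar>\<zeta> k - \<xi> k\<bar>) \<longlongrightarrow> \<bar>\<zeta>0 k - \<xi> k\<bar>) (coord_nhds I \<zeta>0)"
          by (intro tendsto_intros tendsto_coord_nhds k)
        from order_tendstoD(2)[OF this near0[OF k]] show "\<forall>\<^sub>F \<zeta> in coord_nhds I \<zeta>0. \<bar>\<zeta> k - \<xi> k\<bar> < d1" .
      qed
      show "\<forall>\<^sub>F \<zeta> in coord_nhds I \<zeta>0. \<forall>z\<in>Z0. sgn (arg z \<zeta>) = sgn (arg z \<zeta>0)"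
        unfolding eventually_ball_finite_distrib[OF Z0(1)]
      proof
        fix z assume z: "z \<in> Z0"
        show "\<forall>\<^sub>F \<zeta> in coord_nhds I \<zeta>0. sgn (arg z \<zeta>) = sgn (arg z \<zeta>0)"
          by (rule eventually_sgn_eq[OF arg]) (use z a0[OF z] th[OF z] \<eta> in \<open>auto simp: Z0_def\<close>)
      qed
    qed
    then obtain d2 where d2: "d2 > 0" "\<And>\<zeta>. \<forall>k\<in>I. \<bar>\<zeta> k - \<zeta>0 k\<bar> < d2 \<Longrightarrow>
       (\<forall>k\<in>I. \<bar>\<zeta> k - \<xi> k\<bar> < d1) \<and> (\<forall>z\<in>Z0. sgn (arg z \<zeta>) = sgn (arg z \<zeta>0))"
      unfolding eventually_coord_nhds by blast
    \<comment> \<open>The displaced point may itself lie in the null set; some point of a small box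
      around it does not.\<close>
    obtain \<zeta> where z: "\<zeta> \<in> PiE I (\<lambda>_. UNIV)" "\<forall>k\<in>I. \<bar>\<zeta> k - \<zeta>0 k\<bar> < d2" "\<zeta> \<notin> S"
      using emeasure_box_pos[OF I d2(1) S, of \<zeta>0] by blast
    have "sgn (arg z \<zeta>0) = \<theta> z" if "z \<in> Z0" for z using a0[OF that] th[OF that] \<eta> by (auto simp: sgn_mult)
    then have "?good \<theta> \<zeta>" using d2(2)[OF z(2)] z by simp
    then show ?thesis by blast
  qed
  then have "?good \<theta> (SOME \<zeta>. ?good \<theta> \<zeta>)" if "\<theta> \<in> \<Theta>" for \<theta>
    using that by (intro someI_ex[of "?good \<theta>"]) auto
  then obtain pt where pt: "\<And>\<theta>. \<theta> \<in> \<Theta> \<Longrightarrow> ?good \<theta> (pt \<theta>)" by (rule that)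
  have val: "f t (pt \<theta>) k = lin k (pt \<theta>) + (\<Sum>z\<in>Z - Z0. C k z * \<sigma> z) + (\<Sum>z\<in>Z0. C k z * \<theta> z)"
    if "\<theta> \<in> \<Theta>" "k \<in> I" for \<theta> k
  proof -
    have "(\<Sum>z\<in>Z. C k z * sgn (arg z (pt \<theta>))) =
       (\<Sum>z\<in>Z - Z0. C k z * sgn (arg z (pt \<theta>))) + (\<Sum>z\<in>Z0. C k z * sgn (arg z (pt \<theta>)))"
      by (rule sum.subset_diff[OF _ Z]) (auto simp: Z0_def)
    moreover have "(\<Sum>z\<in>Z - Z0. C k z * sgn (arg z (pt \<theta>))) = (\<Sum>z\<in>Z - Z0. C k z * \<sigma> z)"
    proof (intro sum.cong refl)
      fix z assume z: "z \<in> Z - Z0"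
      then have "sgn (arg z (pt \<theta>)) = sgn (arg z \<xi>)" using pt[OF that(1)] d1(2)[of "pt \<theta>"] by blast
      then show "C k z * sgn (arg z (pt \<theta>)) = C k z * \<sigma> z" using \<sigma>(2)[of z] z by (auto simp: Z0_def)
    qed
    moreover have "(\<Sum>z\<in>Z0. C k z * sgn (arg z (pt \<theta>))) = (\<Sum>z\<in>Z0. C k z * \<theta> z)"
      using pt[OF that(1)] by (intro sum.cong refl) auto
    ultimately show ?thesis using f[OF that(2), of "pt \<theta>"] by simp
  qed
  show "\<exists>P c. finite P \<and> P \<subseteq> f t ` ({\<zeta> \<in> PiE I (\<lambda>_. UNIV). \<forall>k\<in>I. \<bar>\<zeta> k - \<xi> k\<bar> < \<delta>} - S) \<and>
      (\<forall>p\<in>P. 0 \<le> c p) \<and> sum c P = 1 \<and> (\<forall>k\<in>I. \<bar>g k - (\<Sum>p\<in>P. c p * p k)\<bar> < \<epsilon>)"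
  proof (rule indexed_convex_combination[where \<Theta> = \<Theta> and wt = wt and p = "\<lambda>\<theta>. f t (pt \<theta>)"])
    show "(\<lambda>\<theta>. f t (pt \<theta>)) ` \<Theta> \<subseteq> f t ` ({\<zeta> \<in> PiE I (\<lambda>_. UNIV). \<forall>k\<in>I. \<bar>\<zeta> k - \<xi> k\<bar> < \<delta>} - S)"
    proof
      fix y assume "y \<in> (\<lambda>\<theta>. f t (pt \<theta>)) ` \<Theta>"
      then obtain \<theta> where \<theta>: "\<theta> \<in> \<Theta>" "y = f t (pt \<theta>)" by blast
      then show "y \<in> f t ` ({\<zeta> \<in> PiE I (\<lambda>_. UNIV). \<forall>k\<in>I. \<bar>\<zeta> k - \<xi> k\<bar> < \<delta>} - S)"
        using pt[OF \<theta>(1)] d1(2)[of "pt \<theta>"] by blast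
    qed
    fix k assume k: "k \<in> I"
    have "(\<Sum>\<theta>\<in>\<Theta>. wt \<theta> * f t (pt \<theta>) k) =
       (\<Sum>\<theta>\<in>\<Theta>. wt \<theta> * (lin k (pt \<theta>) - lin k \<xi>) + wt \<theta> * (lin k \<xi> + (\<Sum>z\<in>Z - Z0. C k z * \<sigma> z))
          + (\<Sum>z\<in>Z0. C k z * (wt \<theta> * \<theta> z)))"
      by (intro sum.cong refl) (simp add: val k algebra_simps sum_distrib_left)
    also have "\<dots> = (\<Sum>\<theta>\<in>\<Theta>. wt \<theta> * (lin k (pt \<theta>) - lin k \<xi>)) + (lin k \<xi> + (\<Sum>z\<in>Z - Z0. C k z * \<sigma> z))
          + (\<Sum>\<theta>\<in>\<Theta>. \<Sum>z\<in>Z0. C k z * (wt \<theta> * \<theta> z))"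
      using w(3) by (simp add: sum.distrib sum_distrib_right[symmetric])
    also have "(\<Sum>\<theta>\<in>\<Theta>. \<Sum>z\<in>Z0. C k z * (wt \<theta> * \<theta> z)) = (\<Sum>z\<in>Z0. C k z * \<sigma> z)"
      by (subst sum.swap) (simp add: sum_distrib_left[symmetric] w(4))
    finally have "g k - (\<Sum>\<theta>\<in>\<Theta>. wt \<theta> * f t (pt \<theta>) k) = - (\<Sum>\<theta>\<in>\<Theta>. wt \<theta> * (lin k (pt \<theta>) - lin k \<xi>))"
      using g[OF k] sum.subset_diff[of Z0 Z "\<lambda>z. C k z * \<sigma> z", OF _ Z] by (simp add: Z0_def)
    also have "\<bar>\<dots>\<bar> < \<epsilon>"
    proof -
      \<comment> \<open>A maximum over finitely many patterns preserves the strict inequality, which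
        then passes to the weighted average.\<close>
      define M where "M = Max ((\<lambda>\<theta>. \<bar>lin k (pt \<theta>) - lin k \<xi>\<bar>) ` \<Theta>)"
      have ne: "\<Theta> \<noteq> {}" using w(3) by auto
      have M: "\<bar>lin k (pt \<theta>) - lin k \<xi>\<bar> \<le> M" if "\<theta> \<in> \<Theta>" for \<theta>
        unfolding M_def using that w(1) by (intro Max_ge) auto
      have "M < \<epsilon>" unfolding M_def
      proof (subst Max_less_iff)
        show "\<forall>a\<in>(\<lambda>\<theta>. \<bar>lin k (pt \<theta>) - lin k \<xi>\<bar>) ` \<Theta>. a < \<epsilon>"
        proof
          fix a assume "a \<in> (\<lambda>\<theta>. \<bar>lin k (pt \<theta>) - lin k \<xi>\<bar>) ` \<Theta>"
          then obtain \<theta> where "\<theta> \<in> \<Theta>" "a = \<bar>lin k (pt \<theta>) - lin k \<xi>\<bar>" by blast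
          then show "a < \<epsilon>" using pt[of \<theta>] d1(2)[of "pt \<theta>"] k by (simp add: dist_real_def)
        qed
      qed (use ne w(1) in auto)
      have "\<bar>\<Sum>\<theta>\<in>\<Theta>. wt \<theta> * (lin k (pt \<theta>) - lin k \<xi>)\<bar> \<le> (\<Sum>\<theta>\<in>\<Theta>. wt \<theta> * M)"
        using M w(2) by (intro order.trans[OF sum_abs] sum_mono) (simp add: abs_mult mult_left_mono)
      also have "\<dots> = M" using w(3) by (simp add: sum_distrib_right[symmetric])
      finally show ?thesis using \<open>M < \<epsilon>\<close> by simp
    qed
    finally show "\<bar>g k - (\<Sum>\<theta>\<in>\<Theta>. wt \<theta> * f t (pt \<theta>) k)\<bar> < \<epsilon>" .
  qed (use w in auto)
qed

section \<open>From almost-everywhere rates to one-sided rates\<close>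

lemma AE_lborel_negligible:
  assumes "AE s in lborel. P (s::real)"
  obtains N where "negligible N" "\<And>s. s \<notin> N \<Longrightarrow> P s"
proof -
  from assms obtain N where "N \<in> null_sets lborel" "{s. \<not> P s} \<subseteq> N" by (auto elim!: AE_E simp: null_sets_def)
  then show ?thesis using that[of N] null_sets_completionI[of N lborel] by (auto simp: negligible_iff_null_sets)
qed

lemma continuous_on_of_integral:
  fixes f g :: "real \<Rightarrow> real"
  assumes "\<And>T. T \<ge> 0 \<Longrightarrow> g integrable_on {0..T}" "\<And>T. T \<ge> 0 \<Longrightarrow> f T = f 0 + integral {0..T} g"
  shows "continuous_on {0..} f"
proof (rule continuous_on_atLeastI)
  fix T :: real assume "0 \<le> T"
  have "continuous_on {0..T} (\<lambda>t. f 0 + integral {0..t} g)"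
    by (intro continuous_intros indefinite_integral_continuous_1 assms(1) \<open>0 \<le> T\<close>)
  then show "continuous_on {0..T} f"
    by (rule continuous_on_eq) (rule assms(2)[symmetric], simp)
qed

text \<open>An almost-everywhere derivative with a continuous representative is a derivative at
  every time. This is applied to local errors, from which the merely integrable input has
  cancelled.\<close>

lemma deriv_of_AE_integral:
  fixes f g h :: "real \<Rightarrow> real"
  assumes int: "\<And>T. T \<ge> 0 \<Longrightarrow> f T = f 0 + integral {0..T} g"
    and ae: "AE s in lborel. 0 \<le> s \<longrightarrow> g s = h s" and h: "continuous_on {0..} h" and t: "t \<ge> 0"
  shows "(f has_real_derivative h t) (at t within {0..})"
proof (rule has_field_derivative_transform_within[where d = 1])
  obtain N where N: "negligible N" "\<And>s. s \<notin> N \<Longrightarrow> 0 \<le> s \<longrightarrow> g s = h s"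
    using AE_lborel_negligible[OF ae] by blast
  show "((\<lambda>t. f 0 + integral {0..t} h) has_real_derivative h t) (at t within {0..})"
    using DERIV_add[OF DERIV_const integral_has_real_derivative_atLeast[OF h t]] by simp
  show "f 0 + integral {0..x} h = f x" if "x \<in> {0..}" for x
    using int[of x] integral_spike[OF N(1), of "{0..x}" h g] N(2) that by auto
qed (use t in auto)

text \<open>The selection \<open>\<tau>\<close> is the average over \<open>[t, t + h]\<close> of the a.e. defined signum values.\<close>

lemma inclusion_of_AE_integral:
  fixes y g lin arg :: "real \<Rightarrow> real" and s \<kappa> :: real
  assumes int: "\<And>T. T \<ge> 0 \<Longrightarrow> g integrable_on {0..T}" "\<And>T. T \<ge> 0 \<Longrightarrow> y T = y 0 + integral {0..T} g"
    and ae: "AE r in lborel. 0 \<le> r \<longrightarrow> \<bar>g r - lin r\<bar> \<le> \<kappa> * s \<and>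
                (arg r \<noteq> 0 \<longrightarrow> g r = lin r + \<kappa> * s * sgn (arg r))"
    and lin: "continuous_on {0..} lin" and arg: "continuous_on {0..} arg"
    and s: "s \<in> {0, 1}" and \<kappa>: "\<kappa> > 0" and t: "t \<ge> 0" and e: "\<epsilon> > 0"
  shows "eventually (\<lambda>h. \<exists>\<tau>. \<bar>s * \<tau>\<bar> \<le> 1 \<and> (s = 1 \<and> arg t \<noteq> 0 \<longrightarrow> \<tau> = sgn (arg t)) \<and>
      \<bar>y (t + h) - y t - h * (lin t + \<kappa> * s * \<tau>)\<bar> \<le> \<epsilon> * h) (at_right 0)"
proof -
  obtain N where N: "negligible N" "\<And>r. r \<notin> N \<Longrightarrow> 0 \<le> r \<longrightarrow> \<bar>g r - lin r\<bar> \<le> \<kappa> * s \<and>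
      (arg r \<noteq> 0 \<longrightarrow> g r = lin r + \<kappa> * s * sgn (arg r))"
    using AE_lborel_negligible[OF ae] by blast
  \<comment> \<open>On the exceptional null set \<open>q\<close> receives an admissible value, so
    that its bounds hold at every time and pass to averages.\<close>
  define q where "q r = (if r \<in> N then \<kappa> * s * sgn (arg r) else g r - lin r)" for r
  have q1: "\<bar>q r\<bar> \<le> \<kappa> * s" if "0 \<le> r" for r
    using N(2)[of r] that s \<kappa> by (auto simp: q_def abs_mult sgn_if)
  have q2: "q r = \<kappa> * s * sgn (arg r)" if "0 \<le> r" "arg r \<noteq> 0" for r
    using N(2)[of r] that by (auto simp: q_def)
  have gint: "g integrable_on {a..b}" if "0 \<le> a" for a b
    by (rule integrable_on_subinterval[OF int(1)[of "max 0 b"]]) (use that in auto)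
  have lint: "lin integrable_on {a..b}" if "0 \<le> a" for a b
    by (intro integrable_continuous_real continuous_on_subset[OF lin]) (use that in auto)
  have qint: "q integrable_on {a..b}" if "0 \<le> a" for a b
    using Henstock_Kurzweil_Integration.integrable_diff[OF gint[OF that] lint[OF that]]
    by (rule integrable_spike[OF _ N(1)]) (auto simp: q_def)
  have geq: "integral {a..b} g = integral {a..b} lin + integral {a..b} q" if "0 \<le> a" for a b
  proof -
    have "integral {a..b} g = integral {a..b} (\<lambda>r. lin r + q r)"
      by (rule integral_spike[OF N(1)]) (auto simp: q_def)
    then show ?thesis using Henstock_Kurzweil_Integration.integral_add[OF lint[OF that] qint[OF that]] by simp
  qed
  obtain d1 where d1: "d1 > 0" "\<And>r. r \<in> {0..} \<Longrightarrow> dist r t < d1 \<Longrightarrow> dist (lin r) (lin t) < \<epsilon>"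
    using lin t e unfolding continuous_on_iff by (meson atLeast_iff)
  have "\<exists>d2>0. arg t \<noteq> 0 \<longrightarrow> (\<forall>r\<in>{0..}. dist r t < d2 \<longrightarrow> dist (arg r) (arg t) < \<bar>arg t\<bar>)"
  proof (cases "arg t = 0")
    case False
    then have "\<bar>arg t\<bar> > 0" by simp
    then obtain d2 where "d2 > 0" "\<forall>r\<in>{0..}. dist r t < d2 \<longrightarrow> dist (arg r) (arg t) < \<bar>arg t\<bar>"
      using arg[unfolded continuous_on_iff, rule_format, of t "\<bar>arg t\<bar>"] t by auto
    then show ?thesis by blast
  qed (auto intro: exI[of _ 1])
  then obtain d2 where d2: "d2 > 0"
    "arg t \<noteq> 0 \<Longrightarrow> \<forall>r\<in>{0..}. dist r t < d2 \<longrightarrow> dist (arg r) (arg t) < \<bar>arg t\<bar>" by blast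
  show ?thesis unfolding eventually_at_right_0_iff
  proof (rule exI[of _ "min d1 d2"], intro conjI allI impI)
    fix h assume "0 < h \<and> h < min d1 d2"
    then have h: "0 < h" "h < d1" "h < d2" by auto
    define \<tau> where "\<tau> = integral {t..t+h} q / (\<kappa> * h)"
    have qk: "integral {t..t+h} q = \<kappa> * h * \<tau>" using \<kappa> h by (simp add: \<tau>_def)
    have qle: "\<bar>integral {t..t+h} q\<bar> \<le> \<kappa> * s * h"
    proof -
      have "norm (integral {t..t+h} q) \<le> integral {t..t+h} (\<lambda>_. \<kappa> * s)"
        by (rule Henstock_Kurzweil_Integration.integral_norm_bound_integral[OF qint[OF t]]) (use q1 t in auto)
      then show ?thesis using h by (simp add: ac_simps)
    qed
    have s\<tau>: "s * \<tau> = \<tau>"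
    proof (cases "s = 1")
      case False
      then have "s = 0" using s by auto
      then have "\<tau> = 0" using qle by (simp add: \<tau>_def)
      then show ?thesis by simp
    qed simp
    have y: "y (t + h) - y t = integral {t..t+h} lin + integral {t..t+h} q"
      using int(2)[of "t + h"] int(2)[of t] t h geq[OF t, of "t + h"]
        Henstock_Kurzweil_Integration.integral_combine[of 0 t "t + h" g] gint[of 0 "t + h"] by auto
    have l: "\<bar>integral {t..t+h} lin - h * lin t\<bar> \<le> \<epsilon> * h"
    proof -
      have "integral {t..t+h} lin - h * lin t = integral {t..t+h} (\<lambda>r. lin r - lin t)"
        using h lint[OF t] by (subst Henstock_Kurzweil_Integration.integral_diff) auto
      also have "norm \<dots> \<le> integral {t..t+h} (\<lambda>_. \<epsilon>)"
        by (rule Henstock_Kurzweil_Integration.integral_norm_bound_integral)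
           (use d1(2) lint[OF t] t h in \<open>auto intro!: Henstock_Kurzweil_Integration.integrable_diff less_imp_le simp: dist_real_def\<close>)
      finally show ?thesis using h by (simp add: mult.commute)
    qed
    show "\<exists>\<tau>. \<bar>s * \<tau>\<bar> \<le> 1 \<and> (s = 1 \<and> arg t \<noteq> 0 \<longrightarrow> \<tau> = sgn (arg t)) \<and>
      \<bar>y (t + h) - y t - h * (lin t + \<kappa> * s * \<tau>)\<bar> \<le> \<epsilon> * h"
    proof (intro exI[of _ \<tau>] conjI impI)
      have "\<kappa> * h * \<bar>\<tau>\<bar> \<le> \<kappa> * h * s" using qle \<kappa> h unfolding qk by (simp add: abs_mult ac_simps)
      then have "\<bar>\<tau>\<bar> \<le> s" using \<kappa> h by simp
      then show "\<bar>s * \<tau>\<bar> \<le> 1" using s unfolding s\<tau> by auto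
      have "y (t + h) - y t - h * (lin t + \<kappa> * s * \<tau>) = integral {t..t+h} lin - h * lin t"
        unfolding y qk mult.assoc s\<tau> by (simp add: algebra_simps)
      then show "\<bar>y (t + h) - y t - h * (lin t + \<kappa> * s * \<tau>)\<bar> \<le> \<epsilon> * h" using l by simp
      assume a: "s = 1 \<and> arg t \<noteq> 0"
      have "q r = \<kappa> * sgn (arg t)" if "r \<in> {t..t+h}" for r
      proof -
        have r: "r \<in> {0..}" "dist r t < d2" using that t h by (auto simp: dist_real_def)
        from d2(2)[rule_format, OF _ r] a have "\<bar>arg r - arg t\<bar> < \<bar>arg t\<bar>" by (simp add: dist_real_def)
        then have "sgn (arg r) = sgn (arg t)" "arg r \<noteq> 0" by (auto simp: sgn_if abs_if split: if_splits)
        then show ?thesis using q2[of r] r a by simp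
      qed
      then have "integral {t..t+h} q = integral {t..t+h} (\<lambda>r. \<kappa> * sgn (arg t))"
        by (intro integral_cong) auto
      then show "\<tau> = sgn (arg t)" using h \<kappa> by (simp add: \<tau>_def)
    qed
  qed (use d1 d2 in auto)
qed

section \<open>Unobservable subspaces and dual bases\<close>

lemma mult_mat_vec_index:
  assumes "M \<in> carrier_mat r c" "x \<in> carrier_vec c" "k < r"
  shows "(M *\<^sub>v x) $ k = (\<Sum>j<c. M $$ (k, j) * x $ j)"
  using assms by (auto simp: scalar_prod_def atLeast0LessThan intro!: sum.cong)

lemma scalar_prod_eq_sum:
  assumes "x \<in> carrier_vec c"
  shows "w \<bullet> x = (\<Sum>j<c. w $ j * (x::real vec) $ j)"
  using assms by (auto simp: scalar_prod_def atLeast0LessThan)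

text \<open>The n + 1 vectors x, A x, ..., \<open>A^n x\<close> are dependent in R^n. A zero row
  pads the matrix with these columns to a square one, whose determinant vanishes.\<close>

lemma pow_mat_mult_vec_dependent:
  assumes A: "A \<in> carrier_mat n n" and x: "(x::real vec) \<in> carrier_vec n"
  shows "\<exists>d. (\<exists>j\<le>n. d j \<noteq> 0) \<and> (\<forall>r<n. (\<Sum>k\<le>n. d k * ((A ^\<^sub>m k) *\<^sub>v x) $ r) = 0)"
proof -
  define M where "M = mat (Suc n) (Suc n) (\<lambda>(r, k). if r < n then ((A ^\<^sub>m k) *\<^sub>v x) $ r else 0)"
  have M: "M \<in> carrier_mat (Suc n) (Suc n)" by (simp add: M_def)
  have "M\<^sup>T *\<^sub>v unit_vec (Suc n) n = 0\<^sub>v (Suc n)"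
  proof (rule eq_vecI)
    fix i assume "i < dim_vec (0\<^sub>v (Suc n) :: real vec)"
    then have i: "i < Suc n" by simp
    show "(M\<^sup>T *\<^sub>v unit_vec (Suc n) n) $ i = (0\<^sub>v (Suc n) :: real vec) $ i"
      using i by (subst mult_mat_vec_index[of _ "Suc n" "Suc n"]) (auto simp: M_def unit_vec_def if_distrib cong: if_cong)
  qed (simp add: M_def)
  moreover have "unit_vec (Suc n) n \<noteq> (0\<^sub>v (Suc n) :: real vec)"
    by (metis index_unit_vec(1) index_zero_vec(1) lessI zero_neq_one)
  ultimately have "det (M\<^sup>T) = 0"
    using det_0_iff_vec_prod_zero[of "M\<^sup>T" "Suc n"] M by (metis transpose_carrier_mat unit_vec_carrier)
  then have "det M = 0" using det_transpose[OF M] by simp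
  then obtain d where d: "d \<in> carrier_vec (Suc n)" "d \<noteq> 0\<^sub>v (Suc n)" "M *\<^sub>v d = 0\<^sub>v (Suc n)"
    using det_0_iff_vec_prod_zero[OF M] by blast
  have "\<exists>j<Suc n. d $ j \<noteq> 0"
  proof (rule ccontr)
    assume "\<not> ?thesis"
    then have "d = 0\<^sub>v (Suc n)" using d(1) by (intro eq_vecI) auto
    then show False using d(2) by simp
  qed
  moreover have "(\<Sum>k\<le>n. d $ k * ((A ^\<^sub>m k) *\<^sub>v x) $ r) = 0" if "r < n" for r
  proof -
    have "(M *\<^sub>v d) $ r = (\<Sum>k<Suc n. M $$ (r, k) * d $ k)" by (rule mult_mat_vec_index[OF M d(1)]) (use that in simp)
    also have "\<dots> = (\<Sum>k\<le>n. d $ k * ((A ^\<^sub>m k) *\<^sub>v x) $ r)"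
      unfolding lessThan_Suc_atMost using that by (intro sum.cong refl) (simp add: M_def)
    finally show ?thesis unfolding d(3) using that by simp
  qed
  ultimately show ?thesis by (intro exI[of _ "\<lambda>k. d $ k"]) (auto simp: less_Suc_eq_le)
qed

lemma pow_mat_plus:
  assumes A: "A \<in> carrier_mat n n"
  shows "(A ^\<^sub>m (i + j)) = (A ^\<^sub>m i) * ((A ^\<^sub>m j) :: real mat)"
proof (induction j)
  case (Suc j)
  have "A ^\<^sub>m (i + Suc j) = (A ^\<^sub>m i * A ^\<^sub>m j) * A" using Suc by simp
  also have "\<dots> = A ^\<^sub>m i * (A ^\<^sub>m j * A)" using A by (intro assoc_mult_mat) auto
  finally show ?case by simp
qed (use A in auto)

text \<open>Let j be the largest index with a nonzero coefficient in the dependence. Applying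
  \<open>C * A^(n-j)\<close> sends the terms with k < j to powers below n, which vanish on x, and
  leaves d j times the wanted vector.\<close>

lemma unobs_space_top_power:
  assumes A: "A \<in> carrier_mat n n" and C: "C \<in> carrier_mat m n" and x: "x \<in> unobs_space n C A"
  shows "(C * (A ^\<^sub>m n)) *\<^sub>v x = 0\<^sub>v m"
proof (rule eq_vecI)
  have xc: "x \<in> carrier_vec n" and z: "\<And>k. k < n \<Longrightarrow> (C * (A ^\<^sub>m k)) *\<^sub>v x = 0\<^sub>v m"
    using x C by (auto simp: unobs_space_def)
  obtain d where d: "\<exists>j\<le>n. d j \<noteq> 0" "\<And>r. r < n \<Longrightarrow> (\<Sum>k\<le>n. d k * ((A ^\<^sub>m k) *\<^sub>v x) $ r) = 0"
    using pow_mat_mult_vec_dependent[OF A xc] by blast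
  define j where "j = Max {j. j \<le> n \<and> d j \<noteq> 0}"
  have "{j. j \<le> n \<and> d j \<noteq> 0} \<noteq> {}" using d(1) by auto
  then have "j \<in> {j. j \<le> n \<and> d j \<noteq> 0}" unfolding j_def by (intro Max_in) auto
  then have j: "j \<le> n" "d j \<noteq> 0" by auto
  have above: "d k = 0" if "j < k" "k \<le> n" for k
  proof (rule ccontr)
    assume "d k \<noteq> 0"
    then have "k \<le> j" unfolding j_def using that by (intro Max_ge) auto
    then show False using that by simp
  qed
  define p where "p = n - j"
  have CA: "C * (A ^\<^sub>m p) \<in> carrier_mat m n" using A C by simp
  fix i assume "i < dim_vec (0\<^sub>v m :: real vec)"
  then have i: "i < m" by simp
  have trm: "((C * (A ^\<^sub>m (p + k))) *\<^sub>v x) $ i = (\<Sum>s<n. (C * (A ^\<^sub>m p)) $$ (i, s) * ((A ^\<^sub>m k) *\<^sub>v x) $ s)" for k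
  proof -
    have Ax: "(A ^\<^sub>m k) *\<^sub>v x \<in> carrier_vec n" by (rule mult_mat_vec_carrier[OF pow_carrier_mat[OF A] xc])
    have "C * (A ^\<^sub>m (p + k)) = (C * (A ^\<^sub>m p)) * (A ^\<^sub>m k)"
      unfolding pow_mat_plus[OF A] using A C by (intro assoc_mult_mat[symmetric]) auto
    then have "(C * (A ^\<^sub>m (p + k))) *\<^sub>v x = (C * (A ^\<^sub>m p)) *\<^sub>v ((A ^\<^sub>m k) *\<^sub>v x)"
      by (simp only: assoc_mult_mat_vec[OF CA pow_carrier_mat[OF A] xc])
    then show ?thesis using mult_mat_vec_index[OF CA Ax i] by simp
  qed
  have "(\<Sum>k\<le>n. d k * ((C * (A ^\<^sub>m (p + k))) *\<^sub>v x) $ i) =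
      (\<Sum>s<n. (C * (A ^\<^sub>m p)) $$ (i, s) * (\<Sum>k\<le>n. d k * ((A ^\<^sub>m k) *\<^sub>v x) $ s))"
    unfolding trm sum_distrib_left by (subst sum.swap) (simp add: ac_simps)
  also have "\<dots> = 0" using d(2) by simp
  also have "(\<Sum>k\<le>n. d k * ((C * (A ^\<^sub>m (p + k))) *\<^sub>v x) $ i) = (\<Sum>k\<in>{j}. d k * ((C * (A ^\<^sub>m (p + k))) *\<^sub>v x) $ i)"
  proof (rule sum.mono_neutral_right)
    show "\<forall>k\<in>{..n} - {j}. d k * ((C * (A ^\<^sub>m (p + k))) *\<^sub>v x) $ i = 0"
    proof
      fix k assume k: "k \<in> {..n} - {j}"
      show "d k * ((C * (A ^\<^sub>m (p + k))) *\<^sub>v x) $ i = 0"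
      proof (cases "k < j")
        case True
        then have "p + k < n" using j by (simp add: p_def)
        then show ?thesis using z i by simp
      next
        case False then show ?thesis using above[of k] k by simp
      qed
    qed
  qed (use j in auto)
  finally show "((C * (A ^\<^sub>m n)) *\<^sub>v x) $ i = (0\<^sub>v m :: real vec) $ i" using j i by (simp add: p_def)
qed (use C in simp)

text \<open>Only k = n - 1 leads outside the conditions that define the kernel, and there
  \<open>unobs_space_top_power\<close> applies.\<close>

lemma unobs_space_invariant:
  assumes A: "A \<in> carrier_mat n n" and C: "C \<in> carrier_mat m n" and x: "x \<in> unobs_space n C A"
  shows "A *\<^sub>v x \<in> unobs_space n C A"
proof -
  have xc: "x \<in> carrier_vec n" and z: "\<And>k. k < n \<Longrightarrow> (C * (A ^\<^sub>m k)) *\<^sub>v x = 0\<^sub>v m"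
    using x C by (auto simp: unobs_space_def)
  have "(C * (A ^\<^sub>m k)) *\<^sub>v (A *\<^sub>v x) = 0\<^sub>v m" if "k < n" for k
  proof -
    have CA: "C * (A ^\<^sub>m k) \<in> carrier_mat m n" using A C by simp
    have "(C * (A ^\<^sub>m k)) *\<^sub>v (A *\<^sub>v x) = (C * (A ^\<^sub>m Suc k)) *\<^sub>v x"
      using A C xc by (simp add: assoc_mult_mat_vec[OF CA, symmetric] assoc_mult_mat[OF C, of _ n])
    also have "\<dots> = 0\<^sub>v m"
      using z[of "Suc k"] unobs_space_top_power[OF A C x] that by (cases "Suc k < n") (auto simp: not_less Suc_le_eq le_antisym dest: le_antisym[of n])
    finally show ?thesis .
  qed
  then show ?thesis using A C xc by (auto simp: unobs_space_def)
qed

section \<open>Coordinates in the dual basis\<close>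

locale dual_basis =
  fixes n :: nat and v w :: "nat \<Rightarrow> real vec"
  assumes basis: "is_basis n v" and w_dim: "\<And>l. l < n \<Longrightarrow> w l \<in> carrier_vec n"
    and w_dual: "\<And>l l'. l < n \<Longrightarrow> l' < n \<Longrightarrow> w l \<bullet> v l' = (if l = l' then 1 else 0)"
begin

lemma v_dim: "l < n \<Longrightarrow> v l \<in> carrier_vec n"
  using basis by (simp add: is_basis_def)

lemma w_dual_sum: "l < n \<Longrightarrow> l' < n \<Longrightarrow> (\<Sum>r<n. w l $ r * v l' $ r) = (if l = l' then 1 else 0)"
  using w_dual[of l l'] scalar_prod_eq_sum[OF v_dim[of l'], of "w l"] by simp

text \<open>Pairing with a dual vector reads off a coefficient. A general index set \<open>T\<close>
  covers the full expansion as well as the spans in (A4).\<close>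

lemma w_combination:
  assumes l: "l < n" and T: "T \<subseteq> {..<n}"
  shows "(\<Sum>r<n. w l $ r * (\<Sum>k\<in>T. c k * v k $ r)) = (if l \<in> T then c l else 0)"
proof -
  have fin: "finite T" using T finite_subset by blast
  have "(\<Sum>r<n. w l $ r * (\<Sum>k\<in>T. c k * v k $ r)) = (\<Sum>k\<in>T. c k * (\<Sum>r<n. w l $ r * v k $ r))"
    unfolding sum_distrib_left by (subst sum.swap) (simp add: ac_simps)
  also have "\<dots> = (\<Sum>k\<in>T. if l = k then c k else 0)"
    using T by (intro sum.cong refl) (auto simp: w_dual_sum[OF l])
  finally show ?thesis using fin by simp
qed

lemma dual_expansion:
  assumes x: "x \<in> carrier_vec n" and r: "r < n"
  shows "x $ r = (\<Sum>l<n. (w l \<bullet> x) * v l $ r)"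
proof -
  have "x \<in> span_of n v {..<n}" using basis x by (simp add: is_basis_def)
  then obtain c where c: "\<And>r. r < n \<Longrightarrow> x $ r = (\<Sum>l<n. c l * v l $ r)" by (auto simp: span_of_def)
  have "w l \<bullet> x = c l" if "l < n" for l
    unfolding scalar_prod_eq_sum[OF x] using w_combination[OF that, of "{..<n}" c] that c by simp
  then show ?thesis using c[OF r] by simp
qed

text \<open>Change of basis: the numbers \<open>w l \<bullet> (A *\<^sub>v v k)\<close> are the
  entries of the plant matrix in the basis \<open>v\<close>.\<close>

lemma mult_dual_expansion:
  assumes A: "A \<in> carrier_mat n n" and x: "x \<in> carrier_vec n" and l: "l < n"
  shows "w l \<bullet> (A *\<^sub>v x) = (\<Sum>k<n. (w l \<bullet> (A *\<^sub>v v k)) * (w k \<bullet> x))"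
proof -
  have Ax: "A *\<^sub>v x \<in> carrier_vec n" using A x by simp
  have Av: "A *\<^sub>v v k \<in> carrier_vec n" if "k < n" for k using A v_dim[OF that] by simp
  have e: "(A *\<^sub>v x) $ r = (\<Sum>k<n. (w k \<bullet> x) * (A *\<^sub>v v k) $ r)" if r: "r < n" for r
  proof -
    have "(A *\<^sub>v x) $ r = (\<Sum>j<n. A $$ (r, j) * (\<Sum>k<n. (w k \<bullet> x) * v k $ j))"
      unfolding mult_mat_vec_index[OF A x r] by (intro sum.cong refl) (simp add: dual_expansion[OF x, symmetric])
    also have "\<dots> = (\<Sum>k<n. (w k \<bullet> x) * (\<Sum>j<n. A $$ (r, j) * v k $ j))"
      unfolding sum_distrib_left by (subst sum.swap) (simp add: ac_simps)
    also have "\<dots> = (\<Sum>k<n. (w k \<bullet> x) * (A *\<^sub>v v k) $ r)"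
      by (intro sum.cong refl) (simp add: mult_mat_vec_index[OF A v_dim r])
    finally show ?thesis .
  qed
  have "w l \<bullet> (A *\<^sub>v x) = (\<Sum>r<n. w l $ r * (\<Sum>k<n. (w k \<bullet> x) * (A *\<^sub>v v k) $ r))"
    unfolding scalar_prod_eq_sum[OF Ax] by (simp add: e)
  also have "\<dots> = (\<Sum>k<n. (w k \<bullet> x) * (\<Sum>r<n. w l $ r * (A *\<^sub>v v k) $ r))"
    unfolding sum_distrib_left by (subst sum.swap) (simp add: ac_simps)
  also have "\<dots> = (\<Sum>k<n. (w l \<bullet> (A *\<^sub>v v k)) * (w k \<bullet> x))"
    by (intro sum.cong refl) (simp add: scalar_prod_eq_sum[OF Av])
  finally show ?thesis .
qed

end

lemma nth_sel: "k < length (sel n U v) \<Longrightarrow> sel n U v ! k < n \<and> v (sel n U v ! k) \<notin> U"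
  using nth_mem[of k "sel n U v"] by (auto simp: sel_def)

lemma sum_sel:
  "(\<Sum>c<length (sel n U v). f (sel n U v ! c)) = (\<Sum>l\<in>{l. l < n \<and> v l \<notin> U}. f l)"
proof -
  have d: "distinct (sel n U v)" by (simp add: sel_def)
  have s: "set (sel n U v) = {l. l < n \<and> v l \<notin> U}" by (auto simp: sel_def)
  have "bij_betw (\<lambda>c. sel n U v ! c) {..<length (sel n U v)} (set (sel n U v))"
    by (rule bij_betw_nth[OF d]) auto
  from sum.reindex_bij_betw[OF this, of f] show ?thesis by (simp add: s)
qed

lemma Vmat_carrier [simp]: "Vmat n U v \<in> carrier_mat n (length (sel n U v))"
  by (simp add: Vmat_def)

lemma Wmat_carrier [simp]: "Wmat n U v w \<in> carrier_mat (length (sel n U v)) n"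
  by (simp add: Wmat_def)

context dual_basis
begin

lemma Wmat_mult_index:
  assumes "y \<in> carrier_vec n" "k < length (sel n U v)"
  shows "(Wmat n U v w *\<^sub>v y) $ k = w (sel n U v ! k) \<bullet> y"
  using assms by (simp add: mult_mat_vec_index[OF Wmat_carrier] scalar_prod_eq_sum[of y n] Wmat_def)

text \<open>\<open>W * V\<close> is the identity by duality, so the entries of z are dual
  coordinates of the local estimate V z.\<close>

lemma w_Vmat_mult:
  assumes z: "z \<in> carrier_vec (length (sel n U v))" and k: "k < length (sel n U v)"
  shows "w (sel n U v ! k) \<bullet> (Vmat n U v *\<^sub>v z) = z $ k"
proof -
  let ?s = "sel n U v"
  have Vz: "Vmat n U v *\<^sub>v z \<in> carrier_vec n" by (rule mult_mat_vec_carrier[OF Vmat_carrier z])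
  have d: "distinct ?s" by (simp add: sel_def)
  have "w (?s ! k) \<bullet> (Vmat n U v *\<^sub>v z) = (\<Sum>r<n. w (?s ! k) $ r * (\<Sum>c<length ?s. v (?s ! c) $ r * z $ c))"
    unfolding scalar_prod_eq_sum[OF Vz]
  proof (intro sum.cong refl)
    fix r assume "r \<in> {..<n}"
    then have r: "r < n" by simp
    have "(Vmat n U v *\<^sub>v z) $ r = (\<Sum>c<length ?s. v (?s ! c) $ r * z $ c)"
      unfolding mult_mat_vec_index[OF Vmat_carrier z r] by (intro sum.cong refl) (simp add: Vmat_def r)
    then show "w (?s ! k) $ r * (Vmat n U v *\<^sub>v z) $ r = w (?s ! k) $ r * (\<Sum>c<length ?s. v (?s ! c) $ r * z $ c)"
      by simp
  qed
  also have "\<dots> = (\<Sum>c<length ?s. z $ c * (\<Sum>r<n. w (?s ! k) $ r * v (?s ! c) $ r))"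
    unfolding sum_distrib_left by (subst sum.swap) (simp add: ac_simps)
  also have "\<dots> = (\<Sum>c<length ?s. if k = c then z $ c else 0)"
    using d nth_sel[of _ n U v] k by (intro sum.cong refl) (auto simp: w_dual_sum nth_eq_iff_index_eq)
  finally show ?thesis using k by simp
qed

end

section \<open>Error dynamics of one local observer\<close>

locale observed_node = dual_basis +
  fixes A C :: "real mat" and m :: nat and U :: "real vec set" and S :: "nat set"
  assumes A: "A \<in> carrier_mat n n" and C: "C \<in> carrier_mat m n"
    and U: "U = unobs_space n C A" and S: "S \<subseteq> {..<n}" and US: "U = span_of n v S"
begin

text \<open>This is where (A4) enters: \<open>U\<close> is spanned by the basis vectors it contains,
  so the dual vectors of the others annihilate it.\<close>

lemma w_unobs_zero:
  assumes "x \<in> U" "l < n" "v l \<notin> U"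
  shows "w l \<bullet> x = 0"
proof -
  obtain c where x: "x \<in> carrier_vec n" and c: "\<And>r. r < n \<Longrightarrow> x $ r = (\<Sum>l\<in>S. c l * v l $ r)"
    using assms(1) by (auto simp: US span_of_def)
  have "l \<notin> S"
  proof
    assume "l \<in> S"
    have fin: "finite S" using S finite_subset by blast
    have "v l $ r = (\<Sum>k\<in>S. (if k = l then 1 else 0) * v k $ r)" for r
      using \<open>l \<in> S\<close> fin by (simp add: if_distrib[of "\<lambda>x. x * _"] cong: if_cong)
    then have "v l \<in> U" unfolding US span_of_def using v_dim[OF assms(2)] by auto
    then show False using assms(3) by simp
  qed
  then show ?thesis unfolding scalar_prod_eq_sum[OF x] using w_combination[OF assms(2) S, of c] c by simp
qed

lemma mem_S_iff: "l < n \<Longrightarrow> v l \<in> U \<longleftrightarrow> l \<in> S"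
proof
  assume l: "l < n" and "v l \<in> U"
  then obtain c where c: "\<And>r. r < n \<Longrightarrow> v l $ r = (\<Sum>l\<in>S. c l * v l $ r)"
    by (auto simp: US span_of_def)
  have "(1::real) = (if l \<in> S then c l else 0)"
    using w_combination[OF l S, of c] w_dual_sum[OF l l] c by simp
  then show "l \<in> S" by (auto split: if_splits)
next
  assume l: "l < n" and "l \<in> S"
  show "v l \<in> U"
  proof -
    have fin: "finite S" using S finite_subset by blast
    have "v l $ r = (\<Sum>k\<in>S. (if k = l then 1 else 0) * v k $ r)" for r
      using \<open>l \<in> S\<close> fin by (simp add: if_distrib[of "\<lambda>x. x * _"] cong: if_cong)
    then show ?thesis unfolding US span_of_def using v_dim[OF l] by auto
  qed
qed

definition unobs_part :: "real vec \<Rightarrow> real vec" where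
  "unobs_part x = vec n (\<lambda>r. \<Sum>l\<in>S. (w l \<bullet> x) * v l $ r)"

lemma unobs_part_mem: "unobs_part x \<in> U"
  unfolding US span_of_def unobs_part_def by (auto intro!: exI[of _ "\<lambda>l. w l \<bullet> x"])

text \<open>V W and \<open>unobs_part\<close> are the complementary projections along the basis, for
  the indices outside and inside \<open>S\<close>.\<close>

lemma unobs_part_decomp:
  assumes x: "x \<in> carrier_vec n"
  shows "x = Vmat n U v *\<^sub>v (Wmat n U v w *\<^sub>v x) + unobs_part x"
proof (rule eq_vecI)
  show "dim_vec x = dim_vec (Vmat n U v *\<^sub>v (Wmat n U v w *\<^sub>v x) + unobs_part x)"
    using x by (simp add: unobs_part_def)
  fix r assume "r < dim_vec (Vmat n U v *\<^sub>v (Wmat n U v w *\<^sub>v x) + unobs_part x)"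
  then have r: "r < n" by (simp add: unobs_part_def)
  let ?s = "sel n U v"
  have Wx: "Wmat n U v w *\<^sub>v x \<in> carrier_vec (length ?s)" using x by (metis Wmat_carrier mult_mat_vec_carrier)
  have "(Vmat n U v *\<^sub>v (Wmat n U v w *\<^sub>v x)) $ r = (\<Sum>c<length ?s. v (?s ! c) $ r * (w (?s ! c) \<bullet> x))"
    unfolding mult_mat_vec_index[OF Vmat_carrier Wx r]
    by (intro sum.cong refl) (simp only: Wmat_mult_index[OF x] lessThan_iff, simp add: Vmat_def r)
  also have "\<dots> = (\<Sum>l\<in>{l. l < n \<and> v l \<notin> U}. v l $ r * (w l \<bullet> x))"
    by (rule sum_sel)
  also have "{l. l < n \<and> v l \<notin> U} = {..<n} - S" using mem_S_iff by auto
  finally have "(Vmat n U v *\<^sub>v (Wmat n U v w *\<^sub>v x)) $ r = (\<Sum>l\<in>{..<n} - S. (w l \<bullet> x) * v l $ r)"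
    by (simp add: mult.commute)
  moreover have "x $ r = (\<Sum>l\<in>{..<n} - S. (w l \<bullet> x) * v l $ r) + (\<Sum>l\<in>S. (w l \<bullet> x) * v l $ r)"
    unfolding dual_expansion[OF x r] using S by (intro sum.subset_diff) auto
  ultimately show "x $ r = (Vmat n U v *\<^sub>v (Wmat n U v w *\<^sub>v x) + unobs_part x) $ r"
    using r by (simp add: unobs_part_def)
qed

lemma C_unobs: "x \<in> U \<Longrightarrow> C *\<^sub>v x = 0\<^sub>v m"
proof -
  assume x: "x \<in> U"
  have xc: "x \<in> carrier_vec n" using x by (simp add: U unobs_space_def)
  show ?thesis
  proof (cases "n = 0")
    case True
    show ?thesis using C xc True by (intro eq_vecI) (auto simp: scalar_prod_def)
  next
    case False
    then have "(C * (A ^\<^sub>m 0)) *\<^sub>v x = 0\<^sub>v (dim_row C)" using x unfolding U unobs_space_def by blast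
    then show ?thesis using A C xc by simp
  qed
qed

text \<open>\<open>A\<close> leaves the unobservable subspace invariant, and the rows of W
  annihilate it.\<close>

lemma W_A_unobs: "x \<in> U \<Longrightarrow> Wmat n U v w *\<^sub>v (A *\<^sub>v x) = 0\<^sub>v (length (sel n U v))"
proof -
  assume x: "x \<in> U"
  have xc: "x \<in> carrier_vec n" using x by (simp add: U unobs_space_def)
  have Ax: "A *\<^sub>v x \<in> U" using unobs_space_invariant[OF A C] x by (simp add: U)
  show ?thesis
  proof (rule eq_vecI)
    fix k assume "k < dim_vec (0\<^sub>v (length (sel n U v)) :: real vec)"
    then have k: "k < length (sel n U v)" by simp
    show "(Wmat n U v w *\<^sub>v (A *\<^sub>v x)) $ k = (0\<^sub>v (length (sel n U v)) :: real vec) $ k"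
      using Wmat_mult_index[of "A *\<^sub>v x" k U] A xc k w_unobs_zero[OF Ax] nth_sel[OF k] by simp
  qed (simp add: Wmat_def)
qed

text \<open>Without attack, x enters only through its observable part V W x, as both C and W A kill
  the remainder, and the input \<open>b\<close> cancels. What is left is an autonomous linear system
  for z - W x.\<close>

lemma local_error_rate:
  assumes L: "L \<in> carrier_mat (length (sel n U v)) m"
    and x: "x \<in> carrier_vec n" and z: "z \<in> carrier_vec (length (sel n U v))" and b: "b \<in> carrier_vec n"
    and k: "k < length (sel n U v)"
  shows "(Wmat n U v w *\<^sub>v (A *\<^sub>v (Vmat n U v *\<^sub>v z) + b)
      + L *\<^sub>v (C *\<^sub>v x + 0\<^sub>v m - C *\<^sub>v (Vmat n U v *\<^sub>v z))) $ k - w (sel n U v ! k) \<bullet> (A *\<^sub>v x + b)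
    = (\<Sum>j<length (sel n U v). (Wmat n U v w * A * Vmat n U v - L * C * Vmat n U v) $$ (k, j) *
         (z $ j - w (sel n U v ! j) \<bullet> x))"
proof -
  let ?o = "length (sel n U v)" and ?W = "Wmat n U v w" and ?V = "Vmat n U v"
  define d where "d = z - ?W *\<^sub>v x"
  define xo where "xo = ?V *\<^sub>v (?W *\<^sub>v x)"
  have W: "?W \<in> carrier_mat ?o n" and V: "?V \<in> carrier_mat n ?o" by simp_all
  have Wx: "?W *\<^sub>v x \<in> carrier_vec ?o" using W x by (rule mult_mat_vec_carrier)
  have xo: "xo \<in> carrier_vec n" unfolding xo_def using V Wx by (rule mult_mat_vec_carrier)
  have d: "d \<in> carrier_vec ?o" unfolding d_def using z Wx by simp
  have Vz: "?V *\<^sub>v z \<in> carrier_vec n" using V z by (rule mult_mat_vec_carrier)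
  have up: "unobs_part x \<in> carrier_vec n" by (simp add: unobs_part_def)
  have xdec: "x = xo + unobs_part x" unfolding xo_def by (rule unobs_part_decomp[OF x])
  have Cx: "C *\<^sub>v x = C *\<^sub>v xo"
    using C_unobs[OF unobs_part_mem[of x]] C xo mult_add_distrib_mat_vec[OF C xo up]
    by (subst xdec) simp
  have WAx: "?W *\<^sub>v (A *\<^sub>v x) = ?W *\<^sub>v (A *\<^sub>v xo)"
  proof -
    have "A *\<^sub>v x = A *\<^sub>v xo + A *\<^sub>v unobs_part x" by (subst xdec) (rule mult_add_distrib_mat_vec[OF A xo up])
    then have "?W *\<^sub>v (A *\<^sub>v x) = ?W *\<^sub>v (A *\<^sub>v xo) + ?W *\<^sub>v (A *\<^sub>v unobs_part x)"
      using mult_add_distrib_mat_vec[OF W, of "A *\<^sub>v xo" "A *\<^sub>v unobs_part x"] A xo up by simp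
    then show ?thesis using W_A_unobs[OF unobs_part_mem[of x]] mult_mat_vec_carrier[OF W, of "A *\<^sub>v xo"] A xo by simp
  qed
  have Vd: "?V *\<^sub>v d = ?V *\<^sub>v z - xo" unfolding d_def xo_def by (rule mult_minus_distrib_mat_vec[OF V z Wx])
  have WA: "?W * A \<in> carrier_mat ?o n" and LC: "L * C \<in> carrier_mat ?o n"
    by (rule mult_carrier_mat[OF W A], rule mult_carrier_mat[OF L C])
  have WAV: "?W * A * ?V \<in> carrier_mat ?o ?o" and LCV: "L * C * ?V \<in> carrier_mat ?o ?o"
    by (rule mult_carrier_mat[OF WA V], rule mult_carrier_mat[OF LC V])
  have M: "?W * A * ?V - L * C * ?V \<in> carrier_mat ?o ?o" by (rule minus_carrier_mat[OF LCV])
  define y where "y = ?V *\<^sub>v z"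
  have y: "y \<in> carrier_vec n" using Vz by (simp add: y_def)
  have AyV: "A *\<^sub>v y \<in> carrier_vec n" "A *\<^sub>v xo \<in> carrier_vec n" "A *\<^sub>v x \<in> carrier_vec n"
    using A y xo x by auto
  have CyV: "C *\<^sub>v y \<in> carrier_vec m" "C *\<^sub>v xo \<in> carrier_vec m" using C y xo by auto
  have "(?W * A * ?V - L * C * ?V) *\<^sub>v d = (?W * A * ?V) *\<^sub>v d - (L * C * ?V) *\<^sub>v d"
    by (rule minus_mult_distrib_mat_vec[OF WAV LCV d])
  also have "(?W * A * ?V) *\<^sub>v d = ?W *\<^sub>v (A *\<^sub>v (y - xo))"
    using assoc_mult_mat_vec[OF WA V d] assoc_mult_mat_vec[OF W A, of "y - xo"] y xo by (simp add: Vd y_def)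
  also have "(L * C * ?V) *\<^sub>v d = L *\<^sub>v (C *\<^sub>v (y - xo))"
    using assoc_mult_mat_vec[OF LC V d] assoc_mult_mat_vec[OF L C, of "y - xo"] y xo by (simp add: Vd y_def)
  also have "A *\<^sub>v (y - xo) = A *\<^sub>v y - A *\<^sub>v xo" by (rule mult_minus_distrib_mat_vec[OF A y xo])
  also have "C *\<^sub>v (y - xo) = C *\<^sub>v y - C *\<^sub>v xo" by (rule mult_minus_distrib_mat_vec[OF C y xo])
  also have "?W *\<^sub>v (A *\<^sub>v y - A *\<^sub>v xo) = ?W *\<^sub>v (A *\<^sub>v y) - ?W *\<^sub>v (A *\<^sub>v xo)"
    by (rule mult_minus_distrib_mat_vec[OF W AyV(1,2)])
  also have "L *\<^sub>v (C *\<^sub>v y - C *\<^sub>v xo) = L *\<^sub>v (C *\<^sub>v y) - L *\<^sub>v (C *\<^sub>v xo)"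
    by (rule mult_minus_distrib_mat_vec[OF L CyV])
  finally have Md: "(?W * A * ?V - L * C * ?V) *\<^sub>v d =
     ?W *\<^sub>v (A *\<^sub>v y) - ?W *\<^sub>v (A *\<^sub>v xo) - (L *\<^sub>v (C *\<^sub>v y) - L *\<^sub>v (C *\<^sub>v xo))" .
  have neg: "L *\<^sub>v (C *\<^sub>v x + 0\<^sub>v m - C *\<^sub>v y) = L *\<^sub>v (C *\<^sub>v xo) - L *\<^sub>v (C *\<^sub>v y)"
    using mult_minus_distrib_mat_vec[OF L CyV(2,1)] CyV by (simp add: Cx)
  have lin: "?W *\<^sub>v (A *\<^sub>v y + b) = ?W *\<^sub>v (A *\<^sub>v y) + ?W *\<^sub>v b"
    by (rule mult_add_distrib_mat_vec[OF W AyV(1) b])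
  have lin2: "?W *\<^sub>v (A *\<^sub>v x + b) = ?W *\<^sub>v (A *\<^sub>v xo) + ?W *\<^sub>v b"
    unfolding WAx[symmetric] by (rule mult_add_distrib_mat_vec[OF W AyV(3) b])
  have wk: "w (sel n U v ! k) \<bullet> (A *\<^sub>v x + b) = (?W *\<^sub>v (A *\<^sub>v xo) + ?W *\<^sub>v b) $ k"
    unfolding lin2[symmetric] by (rule Wmat_mult_index[symmetric]) (use AyV b k in auto)
  have dims: "dim_vec (?W *\<^sub>v (A *\<^sub>v y)) = ?o" "dim_vec (?W *\<^sub>v (A *\<^sub>v xo)) = ?o" "dim_vec (?W *\<^sub>v b) = ?o"
     "dim_vec (L *\<^sub>v (C *\<^sub>v y)) = ?o" "dim_vec (L *\<^sub>v (C *\<^sub>v xo)) = ?o"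
    using carrier_matD(1)[OF W] carrier_matD(1)[OF L] by simp_all
  have "((?W * A * ?V - L * C * ?V) *\<^sub>v d) $ k = (\<Sum>j<?o. (?W * A * ?V - L * C * ?V) $$ (k, j) * d $ j)"
    by (rule mult_mat_vec_index[OF M d k])
  also have "\<dots> = (\<Sum>j<?o. (?W * A * ?V - L * C * ?V) $$ (k, j) * (z $ j - w (sel n U v ! j) \<bullet> x))"
    using carrier_matD(1)[OF W] Wmat_mult_index[OF x, of _ U] by (intro sum.cong refl) (simp add: d_def)
  finally have s: "((?W * A * ?V - L * C * ?V) *\<^sub>v d) $ k = \<dots>" .
  show ?thesis unfolding s[symmetric] Md wk y_def[symmetric] neg lin
    using dims k by (simp add: index_minus_vec index_add_vec)
qed

end

section \<open>The distributed observer\<close>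

lemma idxset_eq: "idxset n N od = IX ` {..<n} \<union> (\<lambda>(i, k). IZ i k) ` (SIGMA i:{..<N}. {..<od i})
    \<union> (\<lambda>(i, r). IXH i r) ` ({..<N} \<times> {..<n})"
  unfolding idxset_def by (auto simp: image_iff)

lemma finite_idxset [simp]: "finite (idxset n N od)"
  unfolding idxset_eq by auto

lemma idxset_simps [simp]:
  "IX r \<in> idxset n N od \<longleftrightarrow> r < n"
  "IZ i k \<in> idxset n N od \<longleftrightarrow> i < N \<and> k < od i"
  "IXH i r \<in> idxset n N od \<longleftrightarrow> i < N \<and> r < n"
  by (auto simp: idxset_def)

lemma sum_idxset:
  "(\<Sum>k\<in>idxset n N od. f k) = (\<Sum>r<n. f (IX r)) + (\<Sum>i<N. \<Sum>k<od i. f (IZ i k)) + (\<Sum>i<N. \<Sum>r<n. f (IXH i r))"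
proof -
  have 1: "(\<Sum>k\<in>IX ` {..<n}. f k) = (\<Sum>r<n. f (IX r))"
    by (subst sum.reindex) (auto simp: inj_on_def)
  have 2: "(\<Sum>k\<in>(\<lambda>(i, k). IZ i k) ` (SIGMA i:{..<N}. {..<od i}). f k) = (\<Sum>i<N. \<Sum>k<od i. f (IZ i k))"
    by (subst sum.reindex) (auto simp: inj_on_def sum.Sigma split_def)
  have 3: "(\<Sum>k\<in>(\<lambda>(i, r). IXH i r) ` ({..<N} \<times> {..<n}). f k) = (\<Sum>i<N. \<Sum>r<n. f (IXH i r))"
    by (subst sum.reindex) (auto simp: inj_on_def sum.cartesian_product split_def)
  show ?thesis unfolding idxset_eq
    by (subst sum.union_disjoint, force, force, force, subst sum.union_disjoint) (auto simp: 1 2 3)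
qed

lemma tendsto_mult_mat_vec:
  fixes p :: "'a \<Rightarrow> real vec"
  assumes M: "M \<in> carrier_mat r c" and p: "\<And>\<zeta>. p \<zeta> \<in> carrier_vec c" and k: "k < r"
    and lim: "\<And>j. j < c \<Longrightarrow> ((\<lambda>\<zeta>. p \<zeta> $ j) \<longlongrightarrow> p \<xi> $ j) F"
  shows "((\<lambda>\<zeta>. (M *\<^sub>v p \<zeta>) $ k) \<longlongrightarrow> (M *\<^sub>v p \<xi>) $ k) F"
  unfolding mult_mat_vec_index[OF M p k] by (intro tendsto_intros lim) auto

lemma xof_carrier [simp]: "xof n \<zeta> \<in> carrier_vec n"
  and zof_carrier [simp]: "zof oi i \<zeta> \<in> carrier_vec oi"
  and xhof_carrier [simp]: "xhof n i \<zeta> \<in> carrier_vec n"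
  by (auto simp: xof_def zof_def xhof_def)

section \<open>The closed-loop vector field in dual coordinates\<close>

locale observer = dual_basis n v w for n v w +
  fixes N p :: nat and m :: "nat \<Rightarrow> nat" and A B :: "real mat" and C :: "nat \<Rightarrow> real mat"
    and G :: "nat \<Rightarrow> nat \<Rightarrow> bool" and L :: "nat \<Rightarrow> real mat"
    and u :: "real \<Rightarrow> real vec" and a :: "nat \<Rightarrow> real \<Rightarrow> real vec"
    and U :: "nat \<Rightarrow> real vec set" and od :: "nat \<Rightarrow> nat"
  assumes U_def: "U = (\<lambda>i. unobs_space n (C i) A)"
    and od_def: "od = (\<lambda>i. length (sel n (U i) v))"
    and A_dim: "A \<in> carrier_mat n n" and B_dim: "B \<in> carrier_mat n p"
    and C_dim: "\<And>i. i < N \<Longrightarrow> C i \<in> carrier_mat (m i) n"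
    and u_dim: "\<And>t. u t \<in> carrier_vec p"
    and a_dim: "\<And>i t. i < N \<Longrightarrow> a i t \<in> carrier_vec (m i)"
    and A4: "\<And>i. i < N \<Longrightarrow> \<exists>S\<subseteq>{..<n}. U i = span_of n v S"
    and L_dim: "\<And>i. i < N \<Longrightarrow> L i \<in> carrier_mat (od i) (m i)"
begin

abbreviation "I \<equiv> idxset n N od"
abbreviation "V i \<equiv> Vmat n (U i) v"
abbreviation "W i \<equiv> Wmat n (U i) v w"
abbreviation "sflg i l \<equiv> sflag (U i) v l"
abbreviation "A_dual l k \<equiv> w l \<bullet> (A *\<^sub>v v k)"
abbreviation "rhs' \<kappa> \<gamma> \<equiv> rhs n N A B C U v w L G \<kappa> \<gamma> u a"

lemma V_dim: "V i \<in> carrier_mat n (od i)" and W_dim: "W i \<in> carrier_mat (od i) n"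
  by (simp_all add: od_def)

lemma Bu_dim: "B *\<^sub>v u t \<in> carrier_vec n"
  by (rule mult_mat_vec_carrier[OF B_dim u_dim])

lemma Vz_dim: "V i *\<^sub>v zof (od i) i \<zeta> \<in> carrier_vec n"
  by (rule mult_mat_vec_carrier[OF V_dim zof_carrier])

definition xc :: "nat \<Rightarrow> (idx \<Rightarrow> real) \<Rightarrow> real" where
  "xc l \<zeta> = w l \<bullet> xof n \<zeta>"
definition zc :: "nat \<Rightarrow> nat \<Rightarrow> (idx \<Rightarrow> real) \<Rightarrow> real" where
  "zc i l \<zeta> = w l \<bullet> (V i *\<^sub>v zof (od i) i \<zeta>)"
definition xhc :: "nat \<Rightarrow> nat \<Rightarrow> (idx \<Rightarrow> real) \<Rightarrow> real" where
  "xhc i l \<zeta> = w l \<bullet> xhof n i \<zeta>"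
definition sgn_arg :: "nat \<times> nat \<Rightarrow> (idx \<Rightarrow> real) \<Rightarrow> real" where
  "sgn_arg z \<zeta> = zc (fst z) (snd z) \<zeta> - xhc (fst z) (snd z) \<zeta>"

lemma xc_sum: "xc l \<zeta> = (\<Sum>r<n. w l $ r * \<zeta> (IX r))"
  unfolding xc_def scalar_prod_eq_sum[OF xof_carrier] by (simp add: xof_def)

lemma xhc_sum: "xhc i l \<zeta> = (\<Sum>r<n. w l $ r * \<zeta> (IXH i r))"
  unfolding xhc_def scalar_prod_eq_sum[OF xhof_carrier] by (simp add: xhof_def)

lemma zc_sum: "zc i l \<zeta> = (\<Sum>r<n. w l $ r * (\<Sum>k<od i. V i $$ (r, k) * \<zeta> (IZ i k)))"
  unfolding zc_def scalar_prod_eq_sum[OF Vz_dim]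
proof (intro sum.cong refl)
  fix r assume "r \<in> {..<n}"
  then have "(V i *\<^sub>v zof (od i) i \<zeta>) $ r = (\<Sum>k<od i. V i $$ (r, k) * zof (od i) i \<zeta> $ k)"
    by (intro mult_mat_vec_index[OF V_dim zof_carrier]) simp
  then show "w l $ r * (V i *\<^sub>v zof (od i) i \<zeta>) $ r = w l $ r * (\<Sum>k<od i. V i $$ (r, k) * \<zeta> (IZ i k))"
    by (simp add: zof_def)
qed

lemma zc_sel: "k < od i \<Longrightarrow> zc i (sel n (U i) v ! k) \<zeta> = \<zeta> (IZ i k)"
  unfolding zc_def using w_Vmat_mult[of "zof (od i) i \<zeta>" "U i" k] by (simp add: od_def zof_def)

lemma tendsto_xhc: "i < N \<Longrightarrow> (xhc i l \<longlongrightarrow> xhc i l \<xi>) (coord_nhds I \<xi>)"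
  unfolding xhc_sum[abs_def] by (intro tendsto_intros tendsto_coord_nhds) auto

lemma tendsto_zc: "i < N \<Longrightarrow> (zc i l \<longlongrightarrow> zc i l \<xi>) (coord_nhds I \<xi>)"
  unfolding zc_sum[abs_def] by (intro tendsto_intros tendsto_coord_nhds) auto

lemma tendsto_sgn_arg: "z \<in> {..<N} \<times> {..<n} \<Longrightarrow> (sgn_arg z \<longlongrightarrow> sgn_arg z \<xi>) (coord_nhds I \<xi>)"
  unfolding sgn_arg_def[abs_def] by (intro tendsto_intros tendsto_xhc tendsto_zc) auto

text \<open>Together with \<open>lin_part\<close> this splits the vector field into a part
  continuous in the state and a finite sum of signums, the shape that the outer and inner estimates
  of Filippov sets require.\<close>

definition sgn_coeff :: "real \<Rightarrow> idx \<Rightarrow> nat \<times> nat \<Rightarrow> real" where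
  "sgn_coeff \<kappa> k z = (case k of IXH i r \<Rightarrow> if i = fst z then \<kappa> * sflg i (snd z) * v (snd z) $ r else 0 | _ \<Rightarrow> 0)"

definition lin_part :: "real \<Rightarrow> real \<Rightarrow> real \<Rightarrow> idx \<Rightarrow> (idx \<Rightarrow> real) \<Rightarrow> real" where
  "lin_part \<kappa> \<gamma> t k \<zeta> = (case k of
      IX r \<Rightarrow> (A *\<^sub>v xof n \<zeta> + B *\<^sub>v u t) $ r
    | IZ i k \<Rightarrow> (W i *\<^sub>v (A *\<^sub>v (V i *\<^sub>v zof (od i) i \<zeta>) + B *\<^sub>v u t)
            + L i *\<^sub>v (C i *\<^sub>v xof n \<zeta> + a i t - C i *\<^sub>v (V i *\<^sub>v zof (od i) i \<zeta>))) $ k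
    | IXH i r \<Rightarrow> (A *\<^sub>v xhof n i \<zeta> + B *\<^sub>v u t) $ r
           + \<kappa> * \<gamma> * (\<Sum>j\<in>{j. j < N \<and> G i j}. xhof n j \<zeta> $ r - xhof n i \<zeta> $ r))"

lemma sgn_sum_IXH:
  assumes "i < N"
  shows "(\<Sum>z\<in>{..<N} \<times> {..<n}. sgn_coeff \<kappa> (IXH i r) z * \<sigma> z) = (\<Sum>l<n. \<kappa> * sflg i l * \<sigma> (i, l) * v l $ r)"
proof -
  have "(\<Sum>z\<in>{..<N} \<times> {..<n}. sgn_coeff \<kappa> (IXH i r) z * \<sigma> z) =
     (\<Sum>i'<N. \<Sum>l<n. sgn_coeff \<kappa> (IXH i r) (i', l) * \<sigma> (i', l))"
    by (simp add: sum.cartesian_product split_def)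
  also have "\<dots> = (\<Sum>i'<N. if i = i' then (\<Sum>l<n. \<kappa> * sflg i l * \<sigma> (i, l) * v l $ r) else 0)"
    by (intro sum.cong refl) (auto simp: sgn_coeff_def ac_simps intro!: sum.cong)
  finally show ?thesis using assms by simp
qed

lemma rhs_decomp:
  assumes "k \<in> I"
  shows "rhs' \<kappa> \<gamma> t \<zeta> k = lin_part \<kappa> \<gamma> t k \<zeta> + (\<Sum>z\<in>{..<N} \<times> {..<n}. sgn_coeff \<kappa> k z * sgn (sgn_arg z \<zeta>))"
proof (cases k)
  case (IX r)
  then show ?thesis using assms by (simp add: rhs_def lin_part_def sgn_coeff_def)
next
  case (IZ i j)
  then show ?thesis using assms unfolding lin_part_def sgn_coeff_def by (simp add: rhs_def od_def Let_def)
next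
  case (IXH i r)
  have i: "i < N" using assms IXH by simp
  have s: "(\<Sum>z\<in>{..<N} \<times> {..<n}. sgn_coeff \<kappa> k z * sgn (sgn_arg z \<zeta>)) =
     \<kappa> * (\<Sum>l<n. sflg i l * sgn (sgn_arg (i, l) \<zeta>) * v l $ r)"
    unfolding IXH sgn_sum_IXH[OF i] by (simp add: sum_distrib_left ac_simps)
  show ?thesis unfolding s using assms unfolding lin_part_def sgn_arg_def zc_def xhc_def
    by (simp add: IXH rhs_def od_def Let_def)
qed

lemma tendsto_lin_part:
  assumes k: "k \<in> I"
  shows "(lin_part \<kappa> \<gamma> t k \<longlongrightarrow> lin_part \<kappa> \<gamma> t k \<xi>) (coord_nhds I \<xi>)"
proof -
  have x: "((\<lambda>\<zeta>. xof n \<zeta> $ j) \<longlongrightarrow> xof n \<xi> $ j) (coord_nhds I \<xi>)" if "j < n" for j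
    using tendsto_coord_nhds[of "IX j" I \<xi>] that by (simp add: xof_def)
  have z: "((\<lambda>\<zeta>. zof (od i) i \<zeta> $ j) \<longlongrightarrow> zof (od i) i \<xi> $ j) (coord_nhds I \<xi>)" if "i < N" "j < od i" for i j
    using tendsto_coord_nhds[of "IZ i j" I \<xi>] that by (simp add: zof_def)
  have xh: "((\<lambda>\<zeta>. xhof n i \<zeta> $ j) \<longlongrightarrow> xhof n i \<xi> $ j) (coord_nhds I \<xi>)" if "i < N" "j < n" for i j
    using tendsto_coord_nhds[of "IXH i j" I \<xi>] that by (simp add: xhof_def)
  have Bd: "dim_vec (B *\<^sub>v u t) = n" using Bu_dim by (rule carrier_vecD)
  have addB: "((\<lambda>\<zeta>. (f \<zeta> + B *\<^sub>v u t) $ j) \<longlongrightarrow> (f \<xi> + B *\<^sub>v u t) $ j) F"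
    if "((\<lambda>\<zeta>. f \<zeta> $ j) \<longlongrightarrow> f \<xi> $ j) F" "j < n" for f :: "(idx \<Rightarrow> real) \<Rightarrow> real vec" and j F
    using tendsto_add[OF that(1) tendsto_const[of "(B *\<^sub>v u t) $ j"]] that(2) Bd by simp
  show ?thesis
  proof (cases k)
    case (IX r)
    then have r: "r < n" using k by simp
    show ?thesis unfolding lin_part_def IX idx.case
      by (intro addB tendsto_mult_mat_vec[OF A_dim] r x xof_carrier)
  next
    case (IXH i r)
    then have ir: "i < N" "r < n" using k by auto
    show ?thesis unfolding lin_part_def IXH idx.case
      by (intro tendsto_intros addB tendsto_mult_mat_vec[OF A_dim] ir xh xhof_carrier) auto
  next
    case (IZ i j)
    then have ij: "i < N" "j < od i" using k by auto
    have AVd: "A *\<^sub>v (V i *\<^sub>v zof (od i) i \<zeta>) \<in> carrier_vec n" for \<zeta>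
      by (rule mult_mat_vec_carrier[OF A_dim Vz_dim])
    have CVd: "C i *\<^sub>v (V i *\<^sub>v zof (od i) i \<zeta>) \<in> carrier_vec (m i)" for \<zeta>
      by (rule mult_mat_vec_carrier[OF C_dim[OF ij(1)] Vz_dim])
    have Cxd: "C i *\<^sub>v xof n \<zeta> \<in> carrier_vec (m i)" for \<zeta>
      by (rule mult_mat_vec_carrier[OF C_dim[OF ij(1)] xof_carrier])
    let ?y = "\<lambda>\<zeta>. C i *\<^sub>v xof n \<zeta> + a i t - C i *\<^sub>v (V i *\<^sub>v zof (od i) i \<zeta>)"
    have yd: "?y \<zeta> \<in> carrier_vec (m i)" for \<zeta> using Cxd CVd a_dim[OF ij(1)] by simp
    have 1: "((\<lambda>\<zeta>. (W i *\<^sub>v (A *\<^sub>v (V i *\<^sub>v zof (od i) i \<zeta>) + B *\<^sub>v u t)) $ j) \<longlongrightarrow>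
        (W i *\<^sub>v (A *\<^sub>v (V i *\<^sub>v zof (od i) i \<xi>) + B *\<^sub>v u t)) $ j) (coord_nhds I \<xi>)"
      by (intro tendsto_mult_mat_vec[OF W_dim] add_carrier_vec AVd Bu_dim ij addB tendsto_mult_mat_vec[OF A_dim]
            Vz_dim tendsto_mult_mat_vec[OF V_dim] zof_carrier z)
    have 2: "((\<lambda>\<zeta>. ?y \<zeta> $ s) \<longlongrightarrow> ?y \<xi> $ s) (coord_nhds I \<xi>)" if s: "s < m i" for s
    proof -
      have e: "?y \<zeta> $ s = (C i *\<^sub>v xof n \<zeta>) $ s + a i t $ s - (C i *\<^sub>v (V i *\<^sub>v zof (od i) i \<zeta>)) $ s" for \<zeta>
        using carrier_vecD[OF CVd] carrier_vecD[OF Cxd] carrier_vecD[OF a_dim[OF ij(1)]] s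
        by (simp del: index_mult_mat_vec dim_mult_mat_vec)
      show ?thesis unfolding e
        by (intro tendsto_intros tendsto_mult_mat_vec[OF C_dim[OF ij(1)]] xof_carrier s x
            tendsto_mult_mat_vec[OF V_dim] Vz_dim zof_carrier z ij)
    qed
    have 3: "((\<lambda>\<zeta>. (L i *\<^sub>v ?y \<zeta>) $ j) \<longlongrightarrow> (L i *\<^sub>v ?y \<xi>) $ j) (coord_nhds I \<xi>)"
      by (intro tendsto_mult_mat_vec[OF L_dim[OF ij(1)]] yd ij 2)
    have Ld: "dim_vec (L i *\<^sub>v y) = od i" for y using L_dim[OF ij(1)] by simp
    have e: "lin_part \<kappa> \<gamma> t k = (\<lambda>\<zeta>. (W i *\<^sub>v (A *\<^sub>v (V i *\<^sub>v zof (od i) i \<zeta>) + B *\<^sub>v u t)) $ j + (L i *\<^sub>v ?y \<zeta>) $ j)"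
      using ij(2) Ld by (intro ext) (simp add: lin_part_def IZ del: index_mult_mat_vec dim_mult_mat_vec)
    show ?thesis unfolding e by (intro tendsto_add 1 3)
  qed
qed


text \<open>Duality singles out one signum per direction; this decoupling is the reason for working
  in dual coordinates.\<close>

lemma w_sgn_sum_IXH:
  assumes "i < N" "l < n"
  shows "(\<Sum>r<n. w l $ r * (\<Sum>z\<in>{..<N} \<times> {..<n}. sgn_coeff \<kappa> (IXH i r) z * \<sigma> z)) = \<kappa> * sflg i l * \<sigma> (i, l)"
  unfolding sgn_sum_IXH[OF assms(1)] using w_combination[OF assms(2) order.refl] assms(2) by simp

lemma w_add_Bu: 
  assumes "y \<in> carrier_vec n" "l < n"
  shows "(\<Sum>r<n. w l $ r * (A *\<^sub>v y + B *\<^sub>v u t) $ r) = (\<Sum>k<n. A_dual l k * (w k \<bullet> y)) + w l \<bullet> (B *\<^sub>v u t)"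
proof -
  have Ay: "A *\<^sub>v y \<in> carrier_vec n" by (rule mult_mat_vec_carrier[OF A_dim assms(1)])
  have "(\<Sum>r<n. w l $ r * (A *\<^sub>v y + B *\<^sub>v u t) $ r) = (\<Sum>r<n. w l $ r * (A *\<^sub>v y) $ r + w l $ r * (B *\<^sub>v u t) $ r)"
    using carrier_vecD[OF Bu_dim[of t]]
    by (intro sum.cong refl) (simp add: distrib_left del: index_mult_mat_vec dim_mult_mat_vec)
  also have "\<dots> = w l \<bullet> (A *\<^sub>v y) + w l \<bullet> (B *\<^sub>v u t)"
    unfolding scalar_prod_eq_sum[OF Ay] scalar_prod_eq_sum[OF Bu_dim] by (rule sum.distrib)
  finally show ?thesis by (simp only: mult_dual_expansion[OF A_dim assms])
qed

lemma w_lin_part_IXH: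
  assumes "i < N" "l < n"
  shows "(\<Sum>r<n. w l $ r * lin_part \<kappa> \<gamma> t (IXH i r) \<zeta>) = (\<Sum>k<n. A_dual l k * xhc i k \<zeta>) + w l \<bullet> (B *\<^sub>v u t)
     + \<kappa> * \<gamma> * (\<Sum>j\<in>{j. j < N \<and> G i j}. xhc j l \<zeta> - xhc i l \<zeta>)"
proof -
  have "(\<Sum>r<n. w l $ r * lin_part \<kappa> \<gamma> t (IXH i r) \<zeta>) = (\<Sum>r<n. w l $ r * (A *\<^sub>v xhof n i \<zeta> + B *\<^sub>v u t) $ r)
     + (\<Sum>r<n. w l $ r * (\<kappa> * \<gamma> * (\<Sum>j\<in>{j. j < N \<and> G i j}. \<zeta> (IXH j r) - \<zeta> (IXH i r))))"
    unfolding sum.distrib[symmetric] lin_part_def idx.case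
    by (intro sum.cong refl) (simp add: distrib_left xhof_def del: index_add_vec)
  also have "(\<Sum>r<n. w l $ r * (\<kappa> * \<gamma> * (\<Sum>j\<in>{j. j < N \<and> G i j}. \<zeta> (IXH j r) - \<zeta> (IXH i r)))) =
      \<kappa> * \<gamma> * (\<Sum>j\<in>{j. j < N \<and> G i j}. \<Sum>r<n. w l $ r * (\<zeta> (IXH j r) - \<zeta> (IXH i r)))"
    unfolding sum_distrib_left by (subst sum.swap) (simp add: ac_simps)
  finally show ?thesis
    unfolding w_add_Bu[OF xhof_carrier assms(2)]
    by (simp add: xhc_def[symmetric] xhc_sum sum_subtractf right_diff_distrib)
qed

section \<open>Properties of arbitrary Filippov solutions\<close>

text \<open>Coordinate k is taken as the functional, with a signum of weight 0, so the interval of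
  possible values shrinks to a point. Plant and local observers are of this kind.\<close>

lemma filippov_exact:
  assumes g: "g \<in> filippov_set I (rhs' \<kappa> \<gamma>) t \<xi>" and k: "k \<in> I" "\<And>z. sgn_coeff \<kappa> k z = 0"
  shows "g k = lin_part \<kappa> \<gamma> t k \<xi>"
proof -
  have s: "(\<Sum>j\<in>I. (if j = k then 1 else 0) * f j) = f k" for f :: "idx \<Rightarrow> real"
    using k(1) by (simp add: if_distrib[of "\<lambda>x. x * _"] cong: if_cong)
  have "\<bar>(\<Sum>j\<in>I. (if j = k then 1 else 0) * g j) - lin_part \<kappa> \<gamma> t k \<xi>\<bar> \<le> \<bar>0::real\<bar>"
    by (rule filippov_set_functional(1)[OF _ g, where h = "\<lambda>_. 0"])
       (auto simp: s rhs_decomp[OF k(1)] k tendsto_lin_part)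
  then show ?thesis by (simp add: s)
qed

lemma sgn_coeff_zero [simp]: "sgn_coeff \<kappa> (IX r) z = 0" "sgn_coeff \<kappa> (IZ i k) z = 0"
  by (simp_all add: sgn_coeff_def)

definition err :: "(idx \<Rightarrow> real) \<Rightarrow> nat \<Rightarrow> nat \<Rightarrow> real" where
  "err \<zeta> i l = xhc i l \<zeta> - xc l \<zeta>"

definition err_lin :: "real \<Rightarrow> real \<Rightarrow> (idx \<Rightarrow> real) \<Rightarrow> nat \<Rightarrow> nat \<Rightarrow> real" where
  "err_lin \<kappa> \<gamma> \<zeta> i l = (\<Sum>k<n. A_dual l k * err \<zeta> i k) + \<kappa> * \<gamma> * (\<Sum>j\<in>{j. j < N \<and> G i j}. err \<zeta> j l - err \<zeta> i l)"

text \<open>The functional acts by \<open>w l\<close> on the block of node i alone and so meets the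
  single signum (i, l). The plant block is exact and is subtracted afterwards, which removes the
  input.\<close>

lemma filippov_error_rate:
  assumes g: "g \<in> filippov_set I (rhs' \<kappa> \<gamma>) t \<xi>" and il: "i < N" "l < n" and \<kappa>: "\<kappa> > 0"
  defines "D \<equiv> (\<Sum>r<n. w l $ r * (g (IXH i r) - g (IX r)))"
  shows "\<bar>D - err_lin \<kappa> \<gamma> \<xi> i l\<bar> \<le> \<kappa> * sflg i l"
    "sgn_arg (i, l) \<xi> \<noteq> 0 \<Longrightarrow> D = err_lin \<kappa> \<gamma> \<xi> i l + \<kappa> * sflg i l * sgn (sgn_arg (i, l) \<xi>)"
proof -
  define b where "b j = (case j of IXH i' r \<Rightarrow> if i' = i then w l $ r else 0 | _ \<Rightarrow> 0)" for j
  have s: "(\<Sum>j\<in>I. b j * f j) = (\<Sum>r<n. w l $ r * f (IXH i r))" for f :: "idx \<Rightarrow> real"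
  proof -
    have "(\<Sum>i'<N. \<Sum>r<n. b (IXH i' r) * f (IXH i' r)) =
        (\<Sum>i'<N. if i' = i then (\<Sum>r<n. w l $ r * f (IXH i r)) else 0)"
      by (rule sum.cong[OF refl]) (simp add: b_def)
    then show ?thesis unfolding sum_idxset using il by (simp add: b_def)
  qed
  define \<phi> where "\<phi> \<zeta> = (\<Sum>r<n. w l $ r * lin_part \<kappa> \<gamma> t (IXH i r) \<zeta>)" for \<zeta>
  have eq: "(\<Sum>j\<in>I. b j * rhs' \<kappa> \<gamma> t \<zeta> j) = \<phi> \<zeta> + (\<kappa> * sflg i l) * sgn (sgn_arg (i, l) \<zeta>)" for \<zeta>
  proof -
    have "(\<Sum>j\<in>I. b j * rhs' \<kappa> \<gamma> t \<zeta> j) = (\<Sum>r<n. w l $ r * lin_part \<kappa> \<gamma> t (IXH i r) \<zeta> +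
        w l $ r * (\<Sum>z\<in>{..<N} \<times> {..<n}. sgn_coeff \<kappa> (IXH i r) z * sgn (sgn_arg z \<zeta>)))"
      unfolding s using il by (intro sum.cong refl) (simp add: rhs_decomp distrib_left)
    then show ?thesis unfolding sum.distrib w_sgn_sum_IXH[OF il] by (simp add: \<phi>_def)
  qed
  have lim: "(\<phi> \<longlongrightarrow> \<phi> \<xi>) (coord_nhds I \<xi>)"
    unfolding \<phi>_def by (intro tendsto_intros tendsto_lin_part) (use il in auto)
  have arg: "(sgn_arg (i, l) \<longlongrightarrow> sgn_arg (i, l) \<xi>) (coord_nhds I \<xi>)" using il by (intro tendsto_sgn_arg) auto
  have gx: "(\<Sum>r<n. w l $ r * g (IX r)) = (\<Sum>k<n. A_dual l k * xc k \<xi>) + w l \<bullet> (B *\<^sub>v u t)"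
  proof -
    have "(\<Sum>r<n. w l $ r * g (IX r)) = (\<Sum>r<n. w l $ r * (A *\<^sub>v xof n \<xi> + B *\<^sub>v u t) $ r)"
      using filippov_exact[OF g] by (intro sum.cong refl) (simp add: lin_part_def)
    then show ?thesis unfolding w_add_Bu[OF xof_carrier il(2)] by (simp add: xc_def)
  qed
  have D: "D - err_lin \<kappa> \<gamma> \<xi> i l = (\<Sum>j\<in>I. b j * g j) - \<phi> \<xi>"
    unfolding D_def s right_diff_distrib sum_subtractf gx \<phi>_def w_lin_part_IXH[OF il] err_lin_def err_def
    by (simp add: sum_subtractf right_diff_distrib)
  have nn: "\<bar>\<kappa> * sflg i l\<bar> = \<kappa> * sflg i l" using \<kappa> by (simp add: sflag_def)
  show "\<bar>D - err_lin \<kappa> \<gamma> \<xi> i l\<bar> \<le> \<kappa> * sflg i l"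
    unfolding D using filippov_set_functional(1)[OF finite_idxset g eq lim arg] nn by simp
  show "D = err_lin \<kappa> \<gamma> \<xi> i l + \<kappa> * sflg i l * sgn (sgn_arg (i, l) \<xi>)" if "sgn_arg (i, l) \<xi> \<noteq> 0"
    using filippov_set_functional(2)[OF finite_idxset g eq lim arg that] D by simp
qed

lemma filippov_solution_continuous:
  assumes "filippov_solution I f \<xi>" "k \<in> I"
  shows "continuous_on {0..} (\<lambda>t. \<xi> t k)"
proof -
  obtain g where "\<forall>T\<ge>0. \<forall>k\<in>I. (\<lambda>s. g s k) absolutely_integrable_on {0..T} \<and>
                    \<xi> T k = \<xi> 0 k + integral {0..T} (\<lambda>s. g s k)"
    using assms(1) unfolding filippov_solution_def by blast
  then have g: "(\<lambda>s. g s k) absolutely_integrable_on {0..T}" "\<xi> T k = \<xi> 0 k + integral {0..T} (\<lambda>s. g s k)"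
    if "T \<ge> 0" for T using that assms(2) by blast+
  show ?thesis
    by (rule continuous_on_of_integral[where g = "\<lambda>s. g s k"])
       (use set_lebesgue_integral_eq_integral(1)[OF g(1)] g(2) in blast)+
qed

lemma continuous_on_coords:
  assumes "\<And>k. k \<in> I \<Longrightarrow> continuous_on {0..} (\<lambda>t. \<xi> t k)"
  shows "continuous_on {0..} (\<lambda>t. xc l (\<xi> t))"
    "i < N \<Longrightarrow> continuous_on {0..} (\<lambda>t. xhc i l (\<xi> t))"
    "i < N \<Longrightarrow> continuous_on {0..} (\<lambda>t. zc i l (\<xi> t))"
  unfolding xc_sum xhc_sum zc_sum by (auto intro!: continuous_intros assms)

text \<open>Reference and error are both measured relative to the plant, so their difference is the
  original signum argument. Every node follows its own reference, hence \<open>H\<close> can be any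
  set; honesty matters only for the size of \<open>e\<close>.\<close>

lemma solution_err_inclusion:
  assumes sol: "filippov_solution I (rhs' \<kappa> \<gamma>) \<xi>" and \<kappa>: "\<kappa> > 0"
  shows "err_inclusion N n G sflg A_dual \<kappa> \<gamma> H (\<lambda>i l t. zc i l (\<xi> t) - xc l (\<xi> t)) (\<lambda>t. err (\<xi> t))"
  unfolding err_inclusion_def
proof (intro allI impI)
  fix t \<epsilon> :: real assume t: "0 \<le> t" and e: "0 < \<epsilon>"
  obtain g where g: "\<And>T k. T \<ge> 0 \<Longrightarrow> k \<in> I \<Longrightarrow> (\<lambda>s. g s k) absolutely_integrable_on {0..T}"
      "\<And>T k. T \<ge> 0 \<Longrightarrow> k \<in> I \<Longrightarrow> \<xi> T k = \<xi> 0 k + integral {0..T} (\<lambda>s. g s k)"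
    and ae: "AE s in lborel. 0 \<le> s \<longrightarrow> g s \<in> filippov_set I (rhs' \<kappa> \<gamma>) s (\<xi> s)"
    using sol unfolding filippov_solution_def by blast
  note cont = continuous_on_coords[OF filippov_solution_continuous[OF sol]]
  have gi: "(\<lambda>s. g s k) integrable_on {0..T}" if "T \<ge> 0" "k \<in> I" for T k
    using set_lebesgue_integral_eq_integral(1)[OF g(1)[OF that]] .
  let ?P = "\<lambda>i l h \<tau>. \<bar>sflg i l * \<tau>\<bar> \<le> 1 \<and> (sflg i l = 1 \<and> sgn_arg (i, l) (\<xi> t) \<noteq> 0 \<longrightarrow> \<tau> = sgn (sgn_arg (i, l) (\<xi> t))) \<and>
      \<bar>err (\<xi> (t + h)) i l - err (\<xi> t) i l - h * (err_lin \<kappa> \<gamma> (\<xi> t) i l + \<kappa> * sflg i l * \<tau>)\<bar> \<le> \<epsilon> * h"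
  have one: "eventually (\<lambda>h. \<exists>\<tau>. ?P i l h \<tau>) (at_right 0)" if il: "i < N" "l < n" for i l
  proof (rule inclusion_of_AE_integral[OF _ _ _ _ _ _ \<kappa> t e])
    let ?g = "\<lambda>s. \<Sum>r<n. w l $ r * (g s (IXH i r) - g s (IX r))"
    show "?g integrable_on {0..T}" if "T \<ge> 0" for T
      by (intro integrable_sum integrable_on_mult_right Henstock_Kurzweil_Integration.integrable_diff gi) (use that il in auto)
    show "err (\<xi> T) i l = err (\<xi> 0) i l + integral {0..T} ?g" if T: "T \<ge> 0" for T
    proof -
      have d: "integral {0..T} (\<lambda>s. g s (IXH i r) - g s (IX r)) = (\<xi> T (IXH i r) - \<xi> T (IX r)) - (\<xi> 0 (IXH i r) - \<xi> 0 (IX r))"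
        if "r < n" for r
        using g(2)[OF T, of "IXH i r"] g(2)[OF T, of "IX r"] that il
        by (subst Henstock_Kurzweil_Integration.integral_diff) (auto intro!: gi T)
      have "integral {0..T} ?g = (\<Sum>r<n. integral {0..T} (\<lambda>s. w l $ r * (g s (IXH i r) - g s (IX r))))"
        by (intro integral_sum integrable_on_mult_right Henstock_Kurzweil_Integration.integrable_diff gi T) (use il in auto)
      also have "\<dots> = (\<Sum>r<n. w l $ r * ((\<xi> T (IXH i r) - \<xi> T (IX r)) - (\<xi> 0 (IXH i r) - \<xi> 0 (IX r))))"
        by (intro sum.cong refl) (simp add: d)
      finally show ?thesis
        by (simp add: err_def xhc_sum xc_sum sum_subtractf right_diff_distrib)
    qed
    show "AE s in lborel. 0 \<le> s \<longrightarrow> \<bar>?g s - err_lin \<kappa> \<gamma> (\<xi> s) i l\<bar> \<le> \<kappa> * sflg i l \<and>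
        (sgn_arg (i, l) (\<xi> s) \<noteq> 0 \<longrightarrow> ?g s = err_lin \<kappa> \<gamma> (\<xi> s) i l + \<kappa> * sflg i l * sgn (sgn_arg (i, l) (\<xi> s)))"
      using ae by eventually_elim (use filippov_error_rate[OF _ il \<kappa>] in blast)
    show "continuous_on {0..} (\<lambda>s. err_lin \<kappa> \<gamma> (\<xi> s) i l)"
      unfolding err_lin_def err_def by (intro continuous_intros cont) (use il in auto)
    show "continuous_on {0..} (\<lambda>s. sgn_arg (i, l) (\<xi> s))"
      unfolding sgn_arg_def by (intro continuous_intros cont) (use il in auto)
    show "sflg i l \<in> {0, 1}" by (simp add: sflag_def)
  qed
  have "eventually (\<lambda>h. \<forall>i\<in>{..<N}. \<forall>l\<in>{..<n}. \<exists>\<tau>. ?P i l h \<tau>) (at_right 0)"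
    unfolding eventually_ball_finite_distrib[OF finite_lessThan] using one by blast
  then show "\<forall>\<^sub>F h in at_right 0. \<exists>\<tau>. \<forall>i<N. \<forall>l<n. \<bar>sflg i l * \<tau> i l\<bar> \<le> 1 \<and>
      (i \<in> H \<and> sflg i l = 1 \<and> zc i l (\<xi> t) - xc l (\<xi> t) \<noteq> err (\<xi> t) i l \<longrightarrow>
        \<tau> i l = sgn (zc i l (\<xi> t) - xc l (\<xi> t) - err (\<xi> t) i l)) \<and>
      \<bar>err (\<xi> (t + h)) i l - err (\<xi> t) i l - h * err_rate N n G sflg A_dual \<kappa> \<gamma> \<tau> (err (\<xi> t)) i l\<bar> \<le> \<epsilon> * h"
  proof eventually_elim
    case (elim h)
    \<comment> \<open>The finitely many pairs share a common range of \<open>h\<close>, and for each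
      such \<open>h\<close> the selections of all pairs are joined into a single \<tau>.\<close>
    have P: "?P i l h (SOME \<tau>. ?P i l h \<tau>)" if "i < N" "l < n" for i l
      by (rule someI_ex) (use elim that in blast)
    have a: "zc i l (\<xi> t) - xc l (\<xi> t) - err (\<xi> t) i l = sgn_arg (i, l) (\<xi> t)" for i l
      by (simp add: err_def sgn_arg_def)
    have r: "err_rate N n G sflg A_dual \<kappa> \<gamma> \<tau> (err (\<xi> t)) i l = err_lin \<kappa> \<gamma> (\<xi> t) i l + \<kappa> * sflg i l * \<tau> i l" for \<tau> i l
      by (simp add: err_rate_def err_lin_def)
    show ?case
    proof (intro exI[of _ "\<lambda>i l. SOME \<tau>. ?P i l h \<tau>"] allI impI)
      fix i l assume il: "i < N" "l < n"
      have ne: "zc i l (\<xi> t) - xc l (\<xi> t) \<noteq> err (\<xi> t) i l \<longleftrightarrow> sgn_arg (i, l) (\<xi> t) \<noteq> 0"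
        using a[of i l] by auto
      show "\<bar>sflg i l * (SOME \<tau>. ?P i l h \<tau>)\<bar> \<le> 1 \<and>
      (i \<in> H \<and> sflg i l = 1 \<and> zc i l (\<xi> t) - xc l (\<xi> t) \<noteq> err (\<xi> t) i l \<longrightarrow>
        (SOME \<tau>. ?P i l h \<tau>) = sgn (zc i l (\<xi> t) - xc l (\<xi> t) - err (\<xi> t) i l)) \<and>
      \<bar>err (\<xi> (t + h)) i l - err (\<xi> t) i l - h * err_rate N n G sflg A_dual \<kappa> \<gamma> (\<lambda>i l. SOME \<tau>. ?P i l h \<tau>) (err (\<xi> t)) i l\<bar> \<le> \<epsilon> * h"
        unfolding a r ne using P[OF il] by blast
    qed
  qed
qed

text \<open>A solution is only absolutely continuous, but in the local error the input cancels. The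
  remaining rate is continuous, so the linear equation holds at every time.\<close>

lemma solution_local_error_deriv:
  assumes sol: "filippov_solution I (rhs' \<kappa> \<gamma>) \<xi>" and i: "i < N" and honest: "\<And>t. t \<ge> 0 \<Longrightarrow> a i t = 0\<^sub>v (m i)"
    and k: "k < od i" and t: "t \<ge> 0"
  defines "M \<equiv> W i * A * V i - L i * C i * V i"
  defines "d \<equiv> (\<lambda>k t. \<xi> t (IZ i k) - xc (sel n (U i) v ! k) (\<xi> t))"
  shows "(d k has_real_derivative (\<Sum>j<od i. M $$ (k, j) * d j t)) (at t within {0..})"
proof -
  obtain g where g: "\<And>T k. T \<ge> 0 \<Longrightarrow> k \<in> I \<Longrightarrow> (\<lambda>s. g s k) absolutely_integrable_on {0..T}"
      "\<And>T k. T \<ge> 0 \<Longrightarrow> k \<in> I \<Longrightarrow> \<xi> T k = \<xi> 0 k + integral {0..T} (\<lambda>s. g s k)"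
    and ae: "AE s in lborel. 0 \<le> s \<longrightarrow> g s \<in> filippov_set I (rhs' \<kappa> \<gamma>) s (\<xi> s)"
    using sol unfolding filippov_solution_def by blast
  have gi: "(\<lambda>s. g s k) integrable_on {0..T}" if "T \<ge> 0" "k \<in> I" for T k
    using set_lebesgue_integral_eq_integral(1)[OF g(1)[OF that]] .
  let ?l = "sel n (U i) v ! k"
  have l: "?l < n" using nth_sel[of k n "U i" v] k by (simp add: od_def)
  let ?g = "\<lambda>s. g s (IZ i k) - (\<Sum>r<n. w ?l $ r * g s (IX r))"
  obtain S where S: "S \<subseteq> {..<n}" "U i = span_of n v S" using A4[OF i] by blast
  interpret node: observed_node n v w A "C i" "m i" "U i" S
    by unfold_locales (use A_dim C_dim[OF i] S in \<open>auto simp: U_def\<close>)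
  show ?thesis
  proof (rule deriv_of_AE_integral[OF _ _ _ t])
    show "d k T = d k 0 + integral {0..T} ?g" if T: "T \<ge> 0" for T
    proof -
      have "integral {0..T} ?g = integral {0..T} (\<lambda>s. g s (IZ i k)) - integral {0..T} (\<lambda>s. \<Sum>r<n. w ?l $ r * g s (IX r))"
        by (intro Henstock_Kurzweil_Integration.integral_diff gi T integrable_sum integrable_on_mult_right) (use i k in auto)
      also have "integral {0..T} (\<lambda>s. \<Sum>r<n. w ?l $ r * g s (IX r)) = (\<Sum>r<n. integral {0..T} (\<lambda>s. w ?l $ r * g s (IX r)))"
        by (intro integral_sum integrable_on_mult_right gi T) auto
      also have "\<dots> = (\<Sum>r<n. w ?l $ r * (\<xi> T (IX r) - \<xi> 0 (IX r)))"
        by (intro sum.cong refl) (simp add: g(2)[OF T])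
      finally show ?thesis
        using g(2)[OF T, of "IZ i k"] i k by (simp add: d_def xc_sum sum_subtractf right_diff_distrib)
    qed
    show "AE s in lborel. 0 \<le> s \<longrightarrow> ?g s = (\<Sum>j<od i. M $$ (k, j) * d j s)"
      using ae
    proof eventually_elim
      case (elim s)
      show ?case
      proof
        assume s: "0 \<le> s"
        have G: "g s \<in> filippov_set I (rhs' \<kappa> \<gamma>) s (\<xi> s)" using elim s by blast
        have Ax: "A *\<^sub>v xof n (\<xi> s) + B *\<^sub>v u s \<in> carrier_vec n"
          using mult_mat_vec_carrier[OF A_dim xof_carrier[of n "\<xi> s"]] Bu_dim[of s] by (rule add_carrier_vec)
        have "(\<Sum>r<n. w ?l $ r * g s (IX r)) = w ?l \<bullet> (A *\<^sub>v xof n (\<xi> s) + B *\<^sub>v u s)"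
          unfolding scalar_prod_eq_sum[OF Ax] using filippov_exact[OF G]
          by (intro sum.cong refl) (simp add: lin_part_def)
        moreover have "g s (IZ i k) = lin_part \<kappa> \<gamma> s (IZ i k) (\<xi> s)"
          using filippov_exact[OF G, of "IZ i k"] i k by simp
        ultimately have "?g s = (W i *\<^sub>v (A *\<^sub>v (V i *\<^sub>v zof (od i) i (\<xi> s)) + B *\<^sub>v u s)
            + L i *\<^sub>v (C i *\<^sub>v xof n (\<xi> s) + 0\<^sub>v (m i) - C i *\<^sub>v (V i *\<^sub>v zof (od i) i (\<xi> s)))) $ k
            - w ?l \<bullet> (A *\<^sub>v xof n (\<xi> s) + B *\<^sub>v u s)"
          unfolding lin_part_def idx.case honest[OF s] by simp
        also have "\<dots> = (\<Sum>j<od i. M $$ (k, j) * (zof (od i) i (\<xi> s) $ j - w (sel n (U i) v ! j) \<bullet> xof n (\<xi> s)))"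
          unfolding M_def using node.local_error_rate[of "L i" "xof n (\<xi> s)" "zof (od i) i (\<xi> s)" "B *\<^sub>v u s" k]
            L_dim[OF i] Bu_dim k by (simp add: od_def)
        also have "\<dots> = (\<Sum>j<od i. M $$ (k, j) * d j s)"
          by (intro sum.cong refl) (simp add: d_def zof_def xc_def)
        finally show "?g s = (\<Sum>j<od i. M $$ (k, j) * d j s)" .
      qed
    qed
    show "continuous_on {0..} (\<lambda>s. \<Sum>j<od i. M $$ (k, j) * d j s)"
      unfolding d_def
      by (intro continuous_intros continuous_on_coords filippov_solution_continuous[OF sol]) (use i in auto)
  qed
qed

end

section \<open>Existence of a Filippov solution\<close>

lemma absolutely_integrable_bounded_borel:
  fixes f :: "real \<Rightarrow> real"
  assumes "f \<in> borel_measurable borel" "\<And>x. \<bar>f x\<bar> \<le> K"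
  shows "f absolutely_integrable_on {a..b}"
proof (rule measurable_bounded_by_integrable_imp_absolutely_integrable)
  have "f \<in> borel_measurable lebesgue"
    using assms(1) by (metis measurable_completion measurable_lborel2 borel_measurable_subalgebra sets_lborel order_refl space_lborel space_borel)
  then show "f \<in> borel_measurable (lebesgue_on {a..b})" by (rule measurable_restrict_space1)
  show "(\<lambda>_. K) integrable_on {a..b}" by (rule integrable_const_ivl)
qed (use assms in auto)

locale observer_signals = observer +
  assumes u_loc_int: "\<And>T k. T \<ge> 0 \<Longrightarrow> k < p \<Longrightarrow> (\<lambda>t. u t $ k) absolutely_integrable_on {0..T}"
    and a_loc_int: "\<And>i T k. i < N \<Longrightarrow> T \<ge> 0 \<Longrightarrow> k < m i \<Longrightarrow> (\<lambda>t. a i t $ k) absolutely_integrable_on {0..T}"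
begin

text \<open>The rows of plant and local observers form a closed affine system with this matrix. The
  rows of \<open>xhat\<close> are filled with zeros, so that the same index set can be used
  throughout.\<close>

definition plant_coeff :: "idx \<Rightarrow> idx \<Rightarrow> real" where
  "plant_coeff k j = (case (k, j) of
      (IX r, IX c) \<Rightarrow> A $$ (r, c)
    | (IZ i k, IZ i' j) \<Rightarrow> if i = i' then (W i * A * V i - L i * C i * V i) $$ (k, j) else 0
    | (IZ i k, IX c) \<Rightarrow> (L i * C i) $$ (k, c)
    | _ \<Rightarrow> 0)"

definition plant_forcing :: "idx \<Rightarrow> real \<Rightarrow> real" where
  "plant_forcing k s = (case k of
      IX r \<Rightarrow> (\<Sum>j<p. B $$ (r, j) * u s $ j)
    | IZ i k \<Rightarrow> (\<Sum>r<n. W i $$ (k, r) * (\<Sum>j<p. B $$ (r, j) * u s $ j)) + (\<Sum>j<m i. L i $$ (k, j) * a i s $ j)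
    | _ \<Rightarrow> 0)"

lemma Bu_index: "r < n \<Longrightarrow> (B *\<^sub>v u s) $ r = (\<Sum>j<p. B $$ (r, j) * u s $ j)"
  by (rule mult_mat_vec_index[OF B_dim u_dim])

lemma Bu_absolutely_integrable: "T \<ge> 0 \<Longrightarrow> (\<lambda>s. \<Sum>j<p. B $$ (r, j) * u s $ j) absolutely_integrable_on {0..T}"
  by (intro absolutely_integrable_sum set_integrable_mult_right u_loc_int) auto

lemma plant_forcing_absolutely_integrable:
  assumes "k \<in> I" "T \<ge> 0"
  shows "plant_forcing k absolutely_integrable_on {0..T}"
proof (cases k)
  case (IX r)
  have e: "plant_forcing k = (\<lambda>s. \<Sum>j<p. B $$ (r, j) * u s $ j)" by (auto simp: plant_forcing_def IX)
  show ?thesis unfolding e by (rule Bu_absolutely_integrable[OF assms(2)])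
next
  case (IZ i j)
  have e: "plant_forcing k = (\<lambda>s. (\<Sum>r<n. W i $$ (j, r) * (\<Sum>j<p. B $$ (r, j) * u s $ j)) + (\<Sum>l<m i. L i $$ (j, l) * a i s $ l))"
    by (auto simp: plant_forcing_def IZ)
  show ?thesis unfolding e
    by (intro set_integral_add(1) absolutely_integrable_sum set_integrable_mult_right Bu_absolutely_integrable a_loc_int)
       (use assms IZ in auto)
next
  case (IXH i r)
  have e: "plant_forcing k = (\<lambda>s. 0)" by (auto simp: plant_forcing_def IXH)
  show ?thesis unfolding e by simp
qed

lemma lin_part_plant:
  assumes "k \<in> I" "\<And>i r. k \<noteq> IXH i r"
  shows "lin_part \<kappa> \<gamma> s k \<zeta> = (\<Sum>j\<in>I. plant_coeff k j * \<zeta> j) + plant_forcing k s"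
proof (cases k)
  case (IX r)
  then have r: "r < n" using assms by simp
  have "(A *\<^sub>v xof n \<zeta> + B *\<^sub>v u s) $ r = (A *\<^sub>v xof n \<zeta>) $ r + (B *\<^sub>v u s) $ r"
    using carrier_vecD[OF Bu_dim[of s]] r by (simp del: index_mult_mat_vec dim_mult_mat_vec)
  also have "\<dots> = (\<Sum>j<n. A $$ (r, j) * \<zeta> (IX j)) + (\<Sum>j<p. B $$ (r, j) * u s $ j)"
    unfolding mult_mat_vec_index[OF A_dim xof_carrier r] Bu_index[OF r] by (simp add: xof_def)
  finally show ?thesis by (simp add: IX lin_part_def sum_idxset plant_coeff_def plant_forcing_def)
next
  case (IZ i k')
  then have i: "i < N" and k: "k' < od i" using assms by auto
  define z x where "z = zof (od i) i \<zeta>" and "x = xof n \<zeta>"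
  have z: "z \<in> carrier_vec (od i)" and x: "x \<in> carrier_vec n" by (simp_all add: z_def x_def)
  note V = V_dim[of i] note W = W_dim[of i] note Li = L_dim[OF i] note Ci = C_dim[OF i] note ai = a_dim[OF i, of s]
  have WA: "W i * A \<in> carrier_mat (od i) n" and LC: "L i * C i \<in> carrier_mat (od i) n"
    by (rule mult_carrier_mat[OF W A_dim], rule mult_carrier_mat[OF Li Ci])
  have WAV: "W i * A * V i \<in> carrier_mat (od i) (od i)" and LCV: "L i * C i * V i \<in> carrier_mat (od i) (od i)"
    by (rule mult_carrier_mat[OF WA V], rule mult_carrier_mat[OF LC V])
  have M: "W i * A * V i - L i * C i * V i \<in> carrier_mat (od i) (od i)" by (rule minus_carrier_mat[OF LCV])
  have Vz: "V i *\<^sub>v z \<in> carrier_vec n" by (rule mult_mat_vec_carrier[OF V z])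
  have AVz: "A *\<^sub>v (V i *\<^sub>v z) \<in> carrier_vec n" by (rule mult_mat_vec_carrier[OF A_dim Vz])
  have CVz: "C i *\<^sub>v (V i *\<^sub>v z) \<in> carrier_vec (m i)" and Cx: "C i *\<^sub>v x \<in> carrier_vec (m i)"
    by (rule mult_mat_vec_carrier[OF Ci Vz], rule mult_mat_vec_carrier[OF Ci x])
  have e1: "W i *\<^sub>v (A *\<^sub>v (V i *\<^sub>v z) + B *\<^sub>v u s) = (W i * A * V i) *\<^sub>v z + W i *\<^sub>v (B *\<^sub>v u s)"
    unfolding mult_add_distrib_mat_vec[OF W AVz Bu_dim] assoc_mult_mat_vec[OF WA V z] assoc_mult_mat_vec[OF W A_dim Vz] ..
  have Cxa: "C i *\<^sub>v x + a i s \<in> carrier_vec (m i)" using Cx ai by simp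
  have e2: "L i *\<^sub>v (C i *\<^sub>v x + a i s - C i *\<^sub>v (V i *\<^sub>v z)) = ((L i * C i) *\<^sub>v x + L i *\<^sub>v a i s) - (L i * C i * V i) *\<^sub>v z"
    unfolding mult_minus_distrib_mat_vec[OF Li Cxa CVz] mult_add_distrib_mat_vec[OF Li Cx ai]
      assoc_mult_mat_vec[OF LC V z] assoc_mult_mat_vec[OF Li Ci Vz] assoc_mult_mat_vec[OF Li Ci x] ..
  have Mz: "(W i * A * V i - L i * C i * V i) *\<^sub>v z = (W i * A * V i) *\<^sub>v z - (L i * C i * V i) *\<^sub>v z"
    by (rule minus_mult_distrib_mat_vec[OF WAV LCV z])
  have dims: "dim_vec ((W i * A * V i) *\<^sub>v z) = od i" "dim_vec (W i *\<^sub>v (B *\<^sub>v u s)) = od i"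
     "dim_vec ((L i * C i) *\<^sub>v x) = od i" "dim_vec (L i *\<^sub>v a i s) = od i" "dim_vec ((L i * C i * V i) *\<^sub>v z) = od i"
    using W Li by auto
  have "lin_part \<kappa> \<gamma> s k \<zeta> = ((W i * A * V i) *\<^sub>v z + W i *\<^sub>v (B *\<^sub>v u s) +
      (((L i * C i) *\<^sub>v x + L i *\<^sub>v a i s) - (L i * C i * V i) *\<^sub>v z)) $ k'"
    unfolding lin_part_def IZ idx.case z_def[symmetric] x_def[symmetric] e1 e2 ..
  also have "\<dots> = ((W i * A * V i - L i * C i * V i) *\<^sub>v z) $ k' + ((L i * C i) *\<^sub>v x) $ k'
     + ((W i *\<^sub>v (B *\<^sub>v u s)) $ k' + (L i *\<^sub>v a i s) $ k')"
    unfolding Mz using k dims by (simp del: index_mult_mat_vec dim_mult_mat_vec)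
  also have "((W i * A * V i - L i * C i * V i) *\<^sub>v z) $ k' = (\<Sum>j<od i. (W i * A * V i - L i * C i * V i) $$ (k', j) * \<zeta> (IZ i j))"
    unfolding mult_mat_vec_index[OF M z k] by (simp add: z_def zof_def)
  also have "((L i * C i) *\<^sub>v x) $ k' = (\<Sum>j<n. (L i * C i) $$ (k', j) * \<zeta> (IX j))"
    unfolding mult_mat_vec_index[OF LC x k] by (simp add: x_def xof_def)
  also have "(W i *\<^sub>v (B *\<^sub>v u s)) $ k' = (\<Sum>r<n. W i $$ (k', r) * (\<Sum>j<p. B $$ (r, j) * u s $ j))"
    unfolding mult_mat_vec_index[OF W Bu_dim k] by (intro sum.cong refl) (simp only: Bu_index lessThan_iff)
  also have "(L i *\<^sub>v a i s) $ k' = (\<Sum>j<m i. L i $$ (k', j) * a i s $ j)"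
    by (rule mult_mat_vec_index[OF Li ai k])
  finally have l: "lin_part \<kappa> \<gamma> s k \<zeta> = (\<Sum>j<od i. (W i * A * V i - L i * C i * V i) $$ (k', j) * \<zeta> (IZ i j))
     + (\<Sum>j<n. (L i * C i) $$ (k', j) * \<zeta> (IX j)) + plant_forcing k s" by (simp add: plant_forcing_def IZ)
  have z1: "(\<Sum>i'<N. \<Sum>j<od i'. plant_coeff k (IZ i' j) * \<zeta> (IZ i' j)) =
     (\<Sum>i'<N. if i' = i then (\<Sum>j<od i. (W i * A * V i - L i * C i * V i) $$ (k', j) * \<zeta> (IZ i j)) else 0)"
    by (rule sum.cong[OF refl]) (auto simp: plant_coeff_def IZ simp del: index_minus_mat)
  have z2: "(\<Sum>r<n. plant_coeff k (IX r) * \<zeta> (IX r)) = (\<Sum>j<n. (L i * C i) $$ (k', j) * \<zeta> (IX j))"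
    by (simp add: plant_coeff_def IZ del: index_mult_mat)
  have z3: "(\<Sum>i'<N. \<Sum>r<n. plant_coeff k (IXH i' r) * \<zeta> (IXH i' r)) = 0"
    by (simp add: plant_coeff_def IZ)
  show ?thesis unfolding l sum_idxset z1 z2 z3 using i by simp
next
  case (IXH i r) then show ?thesis using assms(2) by blast
qed


text \<open>With zero gains the signum theorem solves a linear equation. The integrable forcing is
  hidden in the continuous term \<open>F\<close>, and the \<open>IXH\<close> coordinates stay
  constant as placeholders.\<close>

lemma plant_local_observers_exist:
  obtains y where "\<And>k. k \<in> I \<Longrightarrow> continuous_on {0..} (y k)"
    "\<And>k t. k \<in> I \<Longrightarrow> t \<ge> 0 \<Longrightarrow>
       y k t = \<xi>0 k + integral {0..t} (\<lambda>s. (\<Sum>j\<in>I. plant_coeff k j * y j s) + plant_forcing k s)"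
proof -
  define F where "F k t = \<xi>0 k + integral {0..t} (plant_forcing k)" for k t
  have fi: "plant_forcing k integrable_on {0..T}" if "k \<in> I" "T \<ge> 0" for k T
    using set_lebesgue_integral_eq_integral(1)[OF plant_forcing_absolutely_integrable[OF that]] .
  have Fc: "continuous_on {0..} (F k)" if "k \<in> I" for k
  proof (rule continuous_on_of_integral[where g = "plant_forcing k"])
    show "F k T = F k 0 + integral {0..T} (plant_forcing k)" for T by (simp add: F_def)
  qed (rule fi[OF that])
  obtain y \<rho> where y: "\<And>k. k \<in> I \<Longrightarrow> continuous_on {0..} (y k)"
    and \<rho>: "\<And>k s. k \<in> I \<Longrightarrow> \<bar>\<rho> k s\<bar> \<le> 0"
    and eq: "\<And>k t. k \<in> I \<Longrightarrow> 0 \<le> t \<Longrightarrow>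
       y k t = F k t + integral {0..t} (\<lambda>s. \<Sum>j\<in>I. plant_coeff k j * y j s) + integral {0..t} (\<rho> k)"
  proof (rule sign_inclusion_exists[where J = I and F = F and r = "\<lambda>_ _. 0" and K = "\<lambda>_. 0" and M = plant_coeff])
    fix y \<rho> assume "\<And>k. k \<in> I \<Longrightarrow> continuous_on {0..} (y k)" "\<And>k s. k \<in> I \<Longrightarrow> \<bar>\<rho> k s\<bar> \<le> (0::real)"
      "\<And>k t. k \<in> I \<Longrightarrow> 0 \<le> t \<Longrightarrow>
       y k t = F k t + integral {0..t} (\<lambda>s. \<Sum>j\<in>I. plant_coeff k j * y j s) + integral {0..t} (\<rho> k)"
    then show thesis by (rule that)
  qed (auto intro: Fc)
  show ?thesis
  proof (rule that[of y])
    fix k t assume k: "k \<in> I" and t: "(t::real) \<ge> 0"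
    have r0: "\<rho> k = (\<lambda>s. 0)" using \<rho>[OF k] by auto
    have "(\<lambda>s. \<Sum>j\<in>I. plant_coeff k j * y j s) integrable_on {0..t}"
      by (intro integrable_continuous_real continuous_intros continuous_on_subset[OF y]) auto
    then show "y k t = \<xi>0 k + integral {0..t} (\<lambda>s. (\<Sum>j\<in>I. plant_coeff k j * y j s) + plant_forcing k s)"
      using eq[OF k t] fi[OF k t] by (simp add: Henstock_Kurzweil_Integration.integral_add r0 F_def)
  qed (rule y)
qed

text \<open>Block matrix on pairs of node and coordinate: the plant matrix in the basis
  \<open>v\<close> at each node, minus \<kappa> \<gamma> times the graph Laplacian acting on the
  nodes.\<close>

definition coupling :: "real \<Rightarrow> real \<Rightarrow> nat \<times> nat \<Rightarrow> nat \<times> nat \<Rightarrow> real" where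
  "coupling \<kappa> \<gamma> z z' = (if fst z = fst z' then A_dual (snd z) (snd z') else 0) +
     \<kappa> * \<gamma> * (if snd z = snd z' then (if G (fst z) (fst z') then 1 else 0)
       - (if fst z = fst z' then real (card {j. j < N \<and> G (fst z) j}) else 0) else 0)"

lemma coupling_sum:
  assumes "i < N" "l < n"
  shows "(\<Sum>z\<in>{..<N} \<times> {..<n}. coupling \<kappa> \<gamma> (i, l) z * c z) =
    (\<Sum>k<n. A_dual l k * c (i, k)) + \<kappa> * \<gamma> * (\<Sum>j\<in>{j. j < N \<and> G i j}. c (j, l) - c (i, l))"
proof -
  let ?deg = "real (card {j. j < N \<and> G i j})"
  have "(\<Sum>z\<in>{..<N} \<times> {..<n}. coupling \<kappa> \<gamma> (i, l) z * c z) = (\<Sum>j<N. \<Sum>k<n. coupling \<kappa> \<gamma> (i, l) (j, k) * c (j, k))"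
    by (simp add: sum.cartesian_product split_def)
  also have "\<dots> = (\<Sum>j<N. (if i = j then (\<Sum>k<n. A_dual l k * c (i, k)) else 0)
      + \<kappa> * \<gamma> * ((if G i j then c (j, l) else 0) - (if i = j then ?deg * c (i, l) else 0)))"
  proof (intro sum.cong refl)
    fix j
    have "(\<Sum>k<n. coupling \<kappa> \<gamma> (i, l) (j, k) * c (j, k)) = (\<Sum>k<n. (if i = j then A_dual l k * c (i, k) else 0)
        + (if l = k then \<kappa> * \<gamma> * ((if G i j then c (j, l) else 0) - (if i = j then ?deg * c (i, l) else 0)) else 0))"
      by (intro sum.cong refl) (auto simp: coupling_def algebra_simps)
    then show "(\<Sum>k<n. coupling \<kappa> \<gamma> (i, l) (j, k) * c (j, k)) = (if i = j then (\<Sum>k<n. A_dual l k * c (i, k)) else 0)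
      + \<kappa> * \<gamma> * ((if G i j then c (j, l) else 0) - (if i = j then ?deg * c (i, l) else 0))"
      using assms(2) by (simp add: sum.distrib)
  qed
  also have "\<dots> = (\<Sum>k<n. A_dual l k * c (i, k)) + \<kappa> * \<gamma> * ((\<Sum>j<N. if G i j then c (j, l) else 0) - ?deg * c (i, l))"
    using assms(1) by (simp add: sum.distrib sum_subtractf sum_distrib_left[symmetric])
  also have "(\<Sum>j<N. if G i j then c (j, l) else 0) = (\<Sum>j\<in>{j. j < N \<and> G i j}. c (j, l))"
    by (rule sum.mono_neutral_cong_right) auto
  finally show ?thesis by (simp add: sum_subtractf)
qed

text \<open>Transversality for \<open>filippov_set_memI\<close>: the estimate of each node is moved
  along minus the combination of basis vectors with coefficients \<theta>, and duality makes the
  arguments move independently.\<close>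

lemma sgn_arg_shift:
  "\<exists>D. \<forall>\<eta>. \<forall>z\<in>{..<N} \<times> {..<n}. sgn_arg z (\<lambda>k. \<xi> k + \<eta> * D k) = sgn_arg z \<xi> + \<eta> * \<theta> z"
proof (intro exI allI ballI)
  define D where "D k = (case k of IXH i r \<Rightarrow> - (\<Sum>l<n. \<theta> (i, l) * v l $ r) | _ \<Rightarrow> 0)" for k
  fix \<eta> :: real and z assume "z \<in> {..<N} \<times> {..<n}"
  then obtain i l where z: "z = (i, l)" "i < N" "l < n" by auto
  have "xhc i l (\<lambda>k. \<xi> k + \<eta> * D k) = xhc i l \<xi> - \<eta> * (\<Sum>r<n. w l $ r * (\<Sum>l'<n. \<theta> (i, l') * v l' $ r))"
    unfolding xhc_sum by (simp add: D_def algebra_simps sum.distrib sum_subtractf sum_distrib_left[symmetric])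
  also have "(\<Sum>r<n. w l $ r * (\<Sum>l'<n. \<theta> (i, l') * v l' $ r)) = \<theta> (i, l)"
    using w_combination[OF z(3) order.refl, of "\<lambda>l. \<theta> (i, l)"] z(3) by simp
  finally show "sgn_arg z (\<lambda>k. \<xi> k + \<eta> * D k) = sgn_arg z \<xi> + \<eta> * \<theta> z"
    by (simp add: z sgn_arg_def zc_sum D_def)
qed

text \<open>The cascade is solved in its natural order: plant and local observers, which makes the
  targets \<open>R\<close> known continuous functions, and then the dual coordinates of the
  estimates by \<open>sign_inclusion_exists\<close>. Expansion in the basis returns to the original
  coordinates, and \<rho> / \<kappa> is the selection handed to
  \<open>filippov_set_memI\<close>.\<close>

theorem filippov_solution_exists:
  assumes \<kappa>: "\<kappa> > 0"
  shows "\<exists>\<xi>. \<xi> 0 = \<xi>0 \<and> filippov_solution I (rhs' \<kappa> \<gamma>) \<xi>"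
proof -
  obtain y where y: "\<And>k. k \<in> I \<Longrightarrow> continuous_on {0..} (y k)"
    "\<And>k t. k \<in> I \<Longrightarrow> t \<ge> 0 \<Longrightarrow>
       y k t = \<xi>0 k + integral {0..t} (\<lambda>s. (\<Sum>j\<in>I. plant_coeff k j * y j s) + plant_forcing k s)"
  proof (rule plant_local_observers_exist[of \<xi>0])
    fix y assume "\<And>k. k \<in> I \<Longrightarrow> continuous_on {0..} (y k)" "\<And>k t. k \<in> I \<Longrightarrow> t \<ge> 0 \<Longrightarrow>
       y k t = \<xi>0 k + integral {0..t} (\<lambda>s. (\<Sum>j\<in>I. plant_coeff k j * y j s) + plant_forcing k s)"
    then show thesis by (rule that)
  qed
  let ?Z = "{..<N} \<times> {..<n}"
  define wB where "wB l s = (\<Sum>r<n. w l $ r * (\<Sum>j<p. B $$ (r, j) * u s $ j))" for l s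
  have wB: "w l \<bullet> (B *\<^sub>v u s) = wB l s" for l s
    unfolding scalar_prod_eq_sum[OF Bu_dim] wB_def by (intro sum.cong refl) (simp only: Bu_index lessThan_iff)
  have wBai: "wB l absolutely_integrable_on {0..T}" if "T \<ge> 0" for l T
    unfolding wB_def by (intro absolutely_integrable_sum set_integrable_mult_right Bu_absolutely_integrable that) auto
  have wBi: "wB l integrable_on {0..T}" if "T \<ge> 0" for l T
    using set_lebesgue_integral_eq_integral(1)[OF wBai[OF that]] .
  define F where "F z t = xhc (fst z) (snd z) \<xi>0 + integral {0..t} (wB (snd z))" for z :: "nat \<times> nat" and t
  have Fc: "continuous_on {0..} (F z)" for z
  proof (rule continuous_on_of_integral[where g = "wB (snd z)"])
    show "F z T = F z 0 + integral {0..T} (wB (snd z))" for T by (simp add: F_def)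
  qed (rule wBi)
  define R where "R z t = zc (fst z) (snd z) (\<lambda>k. y k t)" for z :: "nat \<times> nat" and t
  have Rc: "continuous_on {0..} (R z)" if "z \<in> ?Z" for z
    unfolding R_def zc_sum by (intro continuous_intros y) (use that in auto)
  \<comment> \<open>Zero for coordinates that the node does not see, so that the corresponding
    density vanishes.\<close>
  define K where "K z = \<kappa> * sflg (fst z) (snd z)" for z
  have K0: "K z \<ge> 0" for z using \<kappa> by (simp add: K_def sflag_def)
  obtain c \<rho> where c: "\<And>z. z \<in> ?Z \<Longrightarrow> continuous_on {0..} (c z)"
    and \<rho>: "\<And>z. z \<in> ?Z \<Longrightarrow> \<rho> z \<in> borel_measurable borel" "\<And>z s. z \<in> ?Z \<Longrightarrow> \<bar>\<rho> z s\<bar> \<le> K z"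
    and ceq: "\<And>z t. z \<in> ?Z \<Longrightarrow> 0 \<le> t \<Longrightarrow>
       c z t = F z t + integral {0..t} (\<lambda>s. \<Sum>j\<in>?Z. coupling \<kappa> \<gamma> z j * c j s) + integral {0..t} (\<rho> z)"
    and \<rho>sgn: "\<And>z. z \<in> ?Z \<Longrightarrow> AE s in lborel. 0 < s \<longrightarrow> c z s \<noteq> R z s \<longrightarrow> \<rho> z s = K z * sgn (R z s - c z s)"
  proof (rule sign_inclusion_exists[where J = ?Z and F = F and r = R and K = K and M = "coupling \<kappa> \<gamma>"])
    fix c \<rho> assume "\<And>z. z \<in> ?Z \<Longrightarrow> continuous_on {0..} (c z)"
      "\<And>z. z \<in> ?Z \<Longrightarrow> \<rho> z \<in> borel_measurable borel" "\<And>z s. z \<in> ?Z \<Longrightarrow> \<bar>\<rho> z s\<bar> \<le> K z"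
      "\<And>z t. z \<in> ?Z \<Longrightarrow> 0 \<le> t \<Longrightarrow>
       c z t = F z t + integral {0..t} (\<lambda>s. \<Sum>j\<in>?Z. coupling \<kappa> \<gamma> z j * c j s) + integral {0..t} (\<rho> z)"
      "\<And>z. z \<in> ?Z \<Longrightarrow> AE s in lborel. 0 < s \<longrightarrow> c z s \<noteq> R z s \<longrightarrow> \<rho> z s = K z * sgn (R z s - c z s)"
    then show thesis by (rule that)
  qed (auto intro: Fc Rc K0)
  have cS: "continuous_on {0..} (\<lambda>s. \<Sum>j\<in>?Z. coupling \<kappa> \<gamma> z j * c j s)" for z
    by (intro continuous_intros c)
  have yS: "continuous_on {0..} (\<lambda>s. \<Sum>j\<in>I. plant_coeff k j * y j s)" for k
    by (intro continuous_intros y)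
  define q where "q z s = wB (snd z) s + (\<Sum>j\<in>?Z. coupling \<kappa> \<gamma> z j * c j s) + \<rho> z s" for z s
  have qai: "q z absolutely_integrable_on {0..T}" if "z \<in> ?Z" "T \<ge> 0" for z T
    unfolding q_def
    by (intro set_integral_add(1) wBai absolutely_integrable_continuous_real continuous_on_subset[OF cS]
        absolutely_integrable_bounded_borel[OF \<rho>]) (use that in auto)
  have cq: "c z T = xhc (fst z) (snd z) \<xi>0 + integral {0..T} (q z)" if z: "z \<in> ?Z" and T: "T \<ge> 0" for z T
  proof -
    have "(\<lambda>s. \<Sum>j\<in>?Z. coupling \<kappa> \<gamma> z j * c j s) integrable_on {0..T}"
      by (intro integrable_continuous_real continuous_on_subset[OF cS]) auto
    moreover have "\<rho> z integrable_on {0..T}"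
      using set_lebesgue_integral_eq_integral(1)[OF absolutely_integrable_bounded_borel[OF \<rho>[OF z]]] .
    ultimately show ?thesis
      unfolding ceq[OF z T] F_def q_def using wBi[OF T]
      by (simp add: Henstock_Kurzweil_Integration.integral_add Henstock_Kurzweil_Integration.integrable_add)
  qed
  \<comment> \<open>Outside the index set the initial value is kept, so that the initial condition
    holds as an equality of functions.\<close>
  define \<xi> where "\<xi> t k = (if k \<in> I then (case k of IXH i r \<Rightarrow> (\<Sum>l<n. c (i, l) t * v l $ r) | _ \<Rightarrow> y k t) else \<xi>0 k)" for t k
  define g where "g s k = (case k of IXH i r \<Rightarrow> (\<Sum>l<n. q (i, l) s * v l $ r)
     | _ \<Rightarrow> (\<Sum>j\<in>I. plant_coeff k j * y j s) + plant_forcing k s)" for s k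
  have xhc\<xi>: "xhc i l (\<xi> t) = c (i, l) t" if "i < N" "l < n" for i l t
    unfolding xhc_sum using w_combination[OF that(2) order.refl, of "\<lambda>l. c (i, l) t"] that by (simp add: \<xi>_def)
  have zc\<xi>: "zc i l (\<xi> t) = R (i, l) t" if "i < N" for i l t
    unfolding R_def zc_sum using that by (simp add: \<xi>_def)
  have "\<xi> 0 k = \<xi>0 k" for k
  proof (cases k)
    case (IXH i r)
    show ?thesis
    proof (cases "k \<in> I")
      case True
      then have "(\<Sum>l<n. c (i, l) 0 * v l $ r) = (\<Sum>l<n. (w l \<bullet> xhof n i \<xi>0) * v l $ r)"
        by (intro sum.cong refl) (simp add: cq xhc_def IXH)
      also have "\<dots> = xhof n i \<xi>0 $ r" using True IXH by (subst dual_expansion[symmetric]) auto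
      finally show ?thesis using True by (simp add: \<xi>_def IXH xhof_def)
    qed (simp add: \<xi>_def)
  qed (use y(2)[of k 0] in \<open>simp_all add: \<xi>_def\<close>)
  then have init: "\<xi> 0 = \<xi>0" by auto
  have "filippov_solution I (rhs' \<kappa> \<gamma>) \<xi>"
    unfolding filippov_solution_def
  proof (intro exI[of _ g] conjI allI impI ballI)
    fix T :: real and k assume T: "0 \<le> T" and k: "k \<in> I"
    have plant: "(\<lambda>s. (\<Sum>j\<in>I. plant_coeff k j * y j s) + plant_forcing k s) absolutely_integrable_on {0..T}"
      by (intro set_integral_add(1) absolutely_integrable_continuous_real continuous_on_subset[OF yS]
          plant_forcing_absolutely_integrable k T) auto
    show "(\<lambda>s. g s k) absolutely_integrable_on {0..T}"
    proof (cases k)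
      case (IXH i r)
      then show ?thesis unfolding g_def IXH idx.case
        by (intro absolutely_integrable_sum set_integrable_mult_left qai T) (use k IXH in auto)
    qed (use plant in \<open>simp_all add: g_def\<close>)
    show "\<xi> T k = \<xi> 0 k + integral {0..T} (\<lambda>s. g s k)"
    proof (cases k)
      case (IXH i r)
      have qi: "q (i, l) integrable_on {0..T}" if "l < n" for l
        using set_lebesgue_integral_eq_integral(1)[OF qai[OF _ T]] that k IXH by simp
      have "integral {0..T} (\<lambda>s. g s k) = (\<Sum>l<n. integral {0..T} (\<lambda>s. q (i, l) s * v l $ r))"
        unfolding g_def IXH idx.case by (intro integral_sum integrable_on_mult_left qi) auto
      also have "\<dots> = (\<Sum>l<n. (c (i, l) T - c (i, l) 0) * v l $ r)"
        using k IXH T by (intro sum.cong refl) (simp add: cq)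
      finally show ?thesis using k by (simp add: \<xi>_def IXH sum_subtractf left_diff_distrib)
    qed (use y(2)[OF k T] y(2)[OF k, of 0] k in \<open>simp_all add: \<xi>_def g_def\<close>)
  next
    have "AE s in lborel. \<forall>z\<in>?Z. 0 < s \<longrightarrow> c z s \<noteq> R z s \<longrightarrow> \<rho> z s = K z * sgn (R z s - c z s)"
      by (subst AE_ball_countable) (auto intro: \<rho>sgn[unfolded atomize_ball] countable_finite)
    \<comment> \<open>The selection is known at positive times only, so time 0 joins the exceptional
      null set.\<close>
    moreover have "AE s in lborel. s \<noteq> (0::real)" by (rule AE_lborel_singleton)
    ultimately show "AE s in lborel. 0 \<le> s \<longrightarrow> g s \<in> filippov_set I (rhs' \<kappa> \<gamma>) s (\<xi> s)"
    proof eventually_elim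
      case (elim s)
      show ?case
      proof
        assume "0 \<le> s"
        with elim have s: "0 < s" and rs: "\<And>z. z \<in> ?Z \<Longrightarrow> c z s \<noteq> R z s \<Longrightarrow> \<rho> z s = K z * sgn (R z s - c z s)" by auto
        have arg: "sgn_arg z (\<xi> s) = R z s - c z s" if "z \<in> ?Z" for z
          using that by (auto simp: sgn_arg_def xhc\<xi> zc\<xi>)
        \<comment> \<open>Where the gain is zero, \<sigma> is given the actual sign: this meets the
          sign condition and contributes nothing to the sum.\<close>
        define \<sigma> where "\<sigma> z = (if K z = 0 then sgn (sgn_arg z (\<xi> s)) else \<rho> z s / \<kappa>)" for z
        have K\<kappa>: "K z = \<kappa>" if "K z \<noteq> 0" for z using that by (auto simp: K_def sflag_def split: if_splits)
        have K\<sigma>: "K z * \<sigma> z = \<rho> z s" if "z \<in> ?Z" for z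
          using K\<kappa>[of z] \<rho>(2)[OF that, of s] \<kappa> by (auto simp: \<sigma>_def)
        show "g s \<in> filippov_set I (rhs' \<kappa> \<gamma>) s (\<xi> s)"
        proof (rule filippov_set_memI[where lin = "lin_part \<kappa> \<gamma> s" and C = "sgn_coeff \<kappa>" and arg = sgn_arg and Z = ?Z and \<sigma> = \<sigma>])
          show "\<bar>\<sigma> z\<bar> \<le> 1" if "z \<in> ?Z" for z
            using K\<kappa>[of z] \<rho>(2)[OF that, of s] \<kappa> by (auto simp: \<sigma>_def sgn_if)
          show "\<sigma> z = sgn (sgn_arg z (\<xi> s))" if "z \<in> ?Z" "sgn_arg z (\<xi> s) \<noteq> 0" for z
            using rs[OF that(1)] that(2) K\<kappa>[of z] \<kappa> unfolding arg[OF that(1)] \<sigma>_def by (auto simp: arg[OF that(1)])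
          show "\<exists>D. \<forall>\<eta>. \<forall>z\<in>?Z. sgn_arg z (\<lambda>k. \<xi> s k + \<eta> * D k) = sgn_arg z (\<xi> s) + \<eta> * \<theta> z" for \<theta>
            by (rule sgn_arg_shift)
          show "g s k = lin_part \<kappa> \<gamma> s k (\<xi> s) + (\<Sum>z\<in>?Z. sgn_coeff \<kappa> k z * \<sigma> z)" if k: "k \<in> I" for k
          proof (cases "\<exists>i r. k = IXH i r")
            case False
            have "lin_part \<kappa> \<gamma> s k (\<xi> s) = (\<Sum>j\<in>I. plant_coeff k j * \<xi> s j) + plant_forcing k s"
              using lin_part_plant[OF k] False by blast
            also have "(\<Sum>j\<in>I. plant_coeff k j * \<xi> s j) = (\<Sum>j\<in>I. plant_coeff k j * y j s)"
              by (intro sum.cong refl) (auto simp: \<xi>_def plant_coeff_def split: idx.splits)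
            finally show ?thesis using False by (cases k) (auto simp: g_def)
          next
            case True
            then obtain i r where IXH: "k = IXH i r" by blast
            then have ir: "i < N" "r < n" using k by auto
            \<comment> \<open>For a fixed node the linear part is read as a vector and expanded in
              the basis, to be compared with the expansion that defines \<open>g\<close>.\<close>
            define x where "x = vec n (\<lambda>r. lin_part \<kappa> \<gamma> s (IXH i r) (\<xi> s))"
            have xd: "x \<in> carrier_vec n" by (simp add: x_def)
            have wx: "w l \<bullet> x = wB l s + (\<Sum>j\<in>?Z. coupling \<kappa> \<gamma> (i, l) j * c j s)" if "l < n" for l
            proof -
              have "w l \<bullet> x = (\<Sum>r<n. w l $ r * lin_part \<kappa> \<gamma> s (IXH i r) (\<xi> s))"
                unfolding scalar_prod_eq_sum[OF xd] by (simp add: x_def)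
              also have "\<dots> = wB l s + (\<Sum>j\<in>?Z. coupling \<kappa> \<gamma> (i, l) j * c j s)"
                unfolding w_lin_part_IXH[OF ir(1) that] coupling_sum[OF ir(1) that] wB
                using ir that by (simp add: xhc\<xi>)
              finally show ?thesis .
            qed
            have "lin_part \<kappa> \<gamma> s k (\<xi> s) = x $ r" using ir by (simp add: x_def IXH)
            also have "\<dots> = (\<Sum>l<n. (wB l s + (\<Sum>j\<in>?Z. coupling \<kappa> \<gamma> (i, l) j * c j s)) * v l $ r)"
              unfolding dual_expansion[OF xd ir(2)] by (intro sum.cong refl) (simp add: wx)
            finally have l: "lin_part \<kappa> \<gamma> s k (\<xi> s) = \<dots>" .
            have "(\<Sum>z\<in>?Z. sgn_coeff \<kappa> k z * \<sigma> z) = (\<Sum>l<n. \<rho> (i, l) s * v l $ r)"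
              unfolding IXH sgn_sum_IXH[OF ir(1)] using ir K\<sigma>
              by (intro sum.cong refl) (auto simp: K_def)
            then show ?thesis unfolding l by (simp add: g_def IXH q_def sum.distrib distrib_right)
          qed
        qed (rule finite_idxset | rule rhs_decomp tendsto_lin_part tendsto_sgn_arg, assumption | simp)+
      qed
    qed
  qed
  then show ?thesis using init by (intro exI[of _ \<xi>] conjI)
qed

end

section \<open>From compact initial sets to the final bound\<close>

text \<open>Compactness refers to the product topology, which bounds each coordinate separately;
  finiteness of \<open>J\<close> makes the bound uniform.\<close>

lemma compact_coord_bounded:
  fixes K :: "(idx \<Rightarrow> real) set"
  assumes "compact K" "finite J"
  obtains b where "b \<ge> 0" "\<And>\<zeta> k. \<zeta> \<in> K \<Longrightarrow> k \<in> J \<Longrightarrow> \<bar>\<zeta> k\<bar> \<le> b"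
proof -
  have "\<exists>b. \<forall>\<zeta>\<in>K. \<bar>\<zeta> k\<bar> \<le> b" for k
  proof -
    have "compact ((\<lambda>\<zeta>. \<zeta> k) ` K)"
      by (rule compact_continuous_image[OF continuous_on_subset[OF continuous_on_product_coordinates] assms(1)]) simp
    then have "bounded ((\<lambda>\<zeta>. \<zeta> k) ` K)" by (rule compact_imp_bounded)
    then show ?thesis unfolding bounded_iff by auto
  qed
  then obtain b where b: "\<And>k \<zeta>. \<zeta> \<in> K \<Longrightarrow> \<bar>\<zeta> k\<bar> \<le> b k" by metis
  have "\<bar>\<zeta> k\<bar> \<le> (\<Sum>k\<in>J. \<bar>b k\<bar>)" if "\<zeta> \<in> K" "k \<in> J" for \<zeta> k
  proof -
    have "\<bar>\<zeta> k\<bar> \<le> \<bar>b k\<bar>" using b[OF that(1), of k] by simp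
    also have "\<dots> \<le> (\<Sum>k\<in>J. \<bar>b k\<bar>)" using that assms(2) by (intro member_le_sum) auto
    finally show ?thesis .
  qed
  then show ?thesis by (intro that[of "\<Sum>k\<in>J. \<bar>b k\<bar>"]) (auto intro: sum_nonneg)
qed

lemma abs_sum_mult_le:
  fixes c x :: "nat \<Rightarrow> real"
  assumes "\<And>r. r < n \<Longrightarrow> \<bar>x r\<bar> \<le> b"
  shows "\<bar>\<Sum>r<n. c r * x r\<bar> \<le> (\<Sum>r<n. \<bar>c r\<bar>) * b"
  unfolding sum_distrib_right
  by (rule order.trans[OF sum_abs]) (auto simp: abs_mult intro!: sum_mono mult_left_mono assms)

context observer_signals
begin

text \<open>If N - 2 q nodes missed \<open>v l\<close>, this vector would be unobservable for their
  stack and hence zero, against \<open>w l \<bullet> v l = 1\<close>. So fewer than N - 2 q nodes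
  miss it; strictness also excludes the truncated case N \<le> 2 q and supplies the extra one in 2 q
  + 1.\<close>

lemma honest_observer_count:
  assumes A2: "\<forall>S\<subseteq>{..<N}. card S = N - 2 * q \<longrightarrow> observable_stack n C S A" and l: "l < n"
  shows "2 * q + 1 \<le> card {i. i < N \<and> sflg i l = 1}"
proof -
  define T where "T = {i. i < N \<and> v l \<in> U i}"
  have "card T < N - 2 * q"
  proof (rule ccontr)
    assume "\<not> card T < N - 2 * q"
    then obtain S where S: "S \<subseteq> T" "card S = N - 2 * q" by (meson not_less obtain_subset_with_card_n)
    then have obs: "observable_stack n C S A" using A2 by (auto simp: T_def)
    have "v l = 0\<^sub>v n"
      using obs v_dim[OF l] S(1) unfolding observable_stack_def T_def U_def unobs_space_def by blast
    then have "w l \<bullet> v l = 0" using w_dim[OF l] by simp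
    then show False using w_dual[OF l l] by simp
  qed
  moreover have "card {..<N} = card T + card {i. i < N \<and> sflg i l = 1}"
  proof -
    have "{..<N} = T \<union> {i. i < N \<and> sflg i l = 1}" by (auto simp: T_def sflag_def)
    moreover have "T \<inter> {i. i < N \<and> sflg i l = 1} = {}" by (auto simp: T_def sflag_def)
    ultimately show ?thesis by (simp add: card_Un_disjoint T_def)
  qed
  ultimately show ?thesis by simp
qed

text \<open>The local error does not feel the gains, so its decay constants precede \<kappa>,
  \<gamma> and the solution; the choice of the gains relies on this order.\<close>

lemma local_error_decay:
  assumes i: "i < N" and hw: "hurwitz (W i * A * V i - L i * C i * V i)"
    and honest: "\<And>t. t \<ge> 0 \<Longrightarrow> a i t = 0\<^sub>v (m i)"
  shows "\<exists>c\<ge>0. \<exists>\<beta>>0. \<forall>\<kappa> \<gamma> \<xi>. filippov_solution I (rhs' \<kappa> \<gamma>) \<xi> \<longrightarrow>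
     (\<forall>l<n. sflg i l = 1 \<longrightarrow> (\<forall>t\<ge>0. \<bar>zc i l (\<xi> t) - xc l (\<xi> t)\<bar> \<le>
        c * exp (- \<beta> * t) * (\<Sum>j<od i. \<bar>\<xi> 0 (IZ i j) - xc (sel n (U i) v ! j) (\<xi> 0)\<bar>)))"
proof -
  let ?M = "W i * A * V i - L i * C i * V i"
  have M: "?M \<in> carrier_mat (od i) (od i)"
    by (rule minus_carrier_mat[OF mult_carrier_mat[OF mult_carrier_mat[OF L_dim[OF i] C_dim[OF i]] V_dim]])
  obtain c \<beta> where c: "c \<ge> 0" "\<beta> > 0" and dec: "\<And>y :: nat \<Rightarrow> real \<Rightarrow> real.
    (\<forall>k<od i. \<forall>t\<ge>0. (y k has_real_derivative (\<Sum>j<od i. ?M $$ (k, j) * y j t)) (at t within {0..})) \<Longrightarrow>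
    (\<forall>k<od i. \<forall>t\<ge>0. \<bar>y k t\<bar> \<le> c * exp (- \<beta> * t) * (\<Sum>j<od i. \<bar>y j 0\<bar>))"
    using hurwitz_exp_decay[OF M hw] by blast
  show ?thesis
  proof (rule exI[of _ c], intro conjI c(1), rule exI[of _ \<beta>], intro conjI c(2) allI impI)
    fix \<kappa> \<gamma> \<xi> l t assume sol: "filippov_solution I (rhs' \<kappa> \<gamma>) \<xi>" and l: "l < n" "sflg i l = 1" and t: "0 \<le> (t::real)"
    have "l \<in> set (sel n (U i) v)" using l by (auto simp: sel_def sflag_def split: if_splits)
    then obtain k where k: "k < od i" "sel n (U i) v ! k = l" by (auto simp: od_def in_set_conv_nth)
    have "zc i l (\<xi> t) = \<xi> t (IZ i k)" using zc_sel[OF k(1)] k(2) by simp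
    moreover have "\<bar>\<xi> t (IZ i k) - xc (sel n (U i) v ! k) (\<xi> t)\<bar> \<le>
        c * exp (- \<beta> * t) * (\<Sum>j<od i. \<bar>\<xi> 0 (IZ i j) - xc (sel n (U i) v ! j) (\<xi> 0)\<bar>)"
      using dec[of "\<lambda>k t. \<xi> t (IZ i k) - xc (sel n (U i) v ! k) (\<xi> t)"]
        solution_local_error_deriv[OF sol i honest] k(1) t by blast
    ultimately show "\<bar>zc i l (\<xi> t) - xc l (\<xi> t)\<bar> \<le>
        c * exp (- \<beta> * t) * (\<Sum>j<od i. \<bar>\<xi> 0 (IZ i j) - xc (sel n (U i) v ! j) (\<xi> 0)\<bar>)"
      using k(2) by simp
  qed
qed

lemma estimate_difference:
  assumes "i < N" "r < n"
  shows "(xhof n i \<zeta> - xof n \<zeta>) $ r = (\<Sum>l<n. v l $ r * err \<zeta> i l)"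
proof -
  have "(xhof n i \<zeta> - xof n \<zeta>) $ r = xhof n i \<zeta> $ r - xof n \<zeta> $ r"
    using assms by (simp add: xof_def xhof_def)
  also have "\<dots> = (\<Sum>l<n. xhc i l \<zeta> * v l $ r) - (\<Sum>l<n. xc l \<zeta> * v l $ r)"
    unfolding xhc_def xc_def
    by (simp only: dual_expansion[OF xof_carrier assms(2)] dual_expansion[OF xhof_carrier assms(2)])
  finally show ?thesis by (simp add: err_def sum_subtractf algebra_simps)
qed

text \<open>Translates a bound on the initial coordinates into the data of
  \<open>robust_consensus\<close> and back: dual vectors bound the initial errors, the Hurwitz
  estimate bounds the honest local errors, and the basis vectors carry the result to the original
  coordinates.\<close>

theorem resilient_estimation:
  fixes q :: nat and H :: "nat set" and \<eta> b :: real
  assumes sym: "\<forall>i<N. \<forall>j<N. G i j \<longleftrightarrow> G j i" and conn: "graph_connected N G"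
    and A2: "\<forall>S\<subseteq>{..<N}. card S = N - 2 * q \<longrightarrow> observable_stack n C S A"
    and H: "H \<subseteq> {..<N}" "N \<le> card H + q" and honest: "\<And>i t. i \<in> H \<Longrightarrow> t \<ge> 0 \<Longrightarrow> a i t = 0\<^sub>v (m i)"
    and hw: "\<And>i. i < N \<Longrightarrow> hurwitz (W i * A * V i - L i * C i * V i)"
    and \<eta>: "\<eta> > 0" and b: "b \<ge> 0"
  shows "\<exists>\<kappa>s\<ge>0. \<exists>\<gamma>s. \<forall>\<kappa>>\<kappa>s. \<forall>\<gamma>>\<gamma>s. \<forall>\<xi>.
    filippov_solution I (rhs' \<kappa> \<gamma>) \<xi> \<longrightarrow> (\<forall>k\<in>I. \<bar>\<xi> 0 k\<bar> \<le> b) \<longrightarrow>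
    (\<forall>i<N. eventually (\<lambda>t. linf (xhof n i (\<xi> t) - xof n (\<xi> t)) \<le> \<eta>) at_top)"
proof -
  define P where "P i c \<beta> \<longleftrightarrow> c \<ge> 0 \<and> \<beta> > 0 \<and> (\<forall>\<kappa> \<gamma> \<xi>. filippov_solution I (rhs' \<kappa> \<gamma>) \<xi> \<longrightarrow>
     (\<forall>l<n. sflg i l = 1 \<longrightarrow> (\<forall>t\<ge>0. \<bar>zc i l (\<xi> t) - xc l (\<xi> t)\<bar> \<le>
        c * exp (- \<beta> * t) * (\<Sum>j<od i. \<bar>\<xi> 0 (IZ i j) - xc (sel n (U i) v ! j) (\<xi> 0)\<bar>))))" for i and c \<beta> :: real
  have "\<exists>p. P i (fst p) (snd p)" if "i \<in> H" for i
    using local_error_decay[of i] hw[of i] honest[of i] H that unfolding P_def by auto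
  then have "P i (fst (SOME p. P i (fst p) (snd p))) (snd (SOME p. P i (fst p) (snd p)))" if "i \<in> H" for i
    using that by (intro someI_ex[of "\<lambda>p. P i (fst p) (snd p)"]) auto
  then obtain c \<beta> where P: "\<And>i. i \<in> H \<Longrightarrow> P i (c i) (\<beta> i)" by (rule that)
  define ww where "ww = (\<Sum>l<n. \<Sum>r<n. \<bar>w l $ r\<bar>)"
  have ww: "(\<Sum>r<n. \<bar>w l $ r\<bar>) \<le> ww" if "l < n" for l
    unfolding ww_def using that by (intro member_le_sum[of l "{..<n}" "\<lambda>l. \<Sum>r<n. \<bar>w l $ r\<bar>"] sum_nonneg) auto
  have ww0: "ww \<ge> 0" unfolding ww_def by (intro sum_nonneg) auto
  have Hfin: "finite H" using H finite_subset by blast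
  have c0: "c i \<ge> 0" if "i \<in> H" for i using P[OF that] by (simp add: P_def)
  \<comment> \<open>The first term bounds the initial errors of the estimates in dual coordinates,
    the sum over \<open>H\<close> bounds every honest local error at all times. Neither depends on
    the gains.\<close>
  define M0 where "M0 = 2 * (ww * b) + (\<Sum>i\<in>H. c i * (real (od i) * ((1 + ww) * b)))"
  have nn: "0 \<le> c i * (real (od i) * ((1 + ww) * b))" if "i \<in> H" for i
    using c0[OF that] ww0 b by simp
  have M0: "M0 \<ge> 0" unfolding M0_def using ww0 b nn by (intro add_nonneg_nonneg sum_nonneg) auto
  \<comment> \<open>Bounds the passage from dual to original coordinates; the added 1 makes it
    positive, so that \<eta> / vv is an admissible tolerance.\<close>
  define vv where "vv = (\<Sum>r<n. \<Sum>l<n. \<bar>v l $ r\<bar>) + 1"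
  have vv0: "vv > 0" unfolding vv_def by (intro add_nonneg_pos sum_nonneg) auto
  have vv: "(\<Sum>l<n. \<bar>v l $ r\<bar>) \<le> vv" if "r < n" for r
  proof -
    have "(\<Sum>l<n. \<bar>v l $ r\<bar>) \<le> (\<Sum>r<n. \<Sum>l<n. \<bar>v l $ r\<bar>)"
      using that by (intro member_le_sum[of r "{..<n}" "\<lambda>r. \<Sum>l<n. \<bar>v l $ r\<bar>"] sum_nonneg) auto
    then show ?thesis by (simp add: vv_def)
  qed
  have \<eta>': "\<eta> / vv > 0" using \<eta> vv0 by simp
  have s01: "sflg i l \<in> {0, 1}" for i l by (simp add: sflag_def)
  note maj = honest_observer_count[OF A2]
  have "\<exists>\<kappa>s\<ge>0. \<exists>\<gamma>s\<ge>0. \<forall>\<kappa>>\<kappa>s. \<forall>\<gamma>>\<gamma>s. \<forall>e x.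
     err_inclusion N n G sflg A_dual \<kappa> \<gamma> H e x \<longrightarrow>
     (\<forall>i<N. \<forall>l<n. continuous_on {0..} (\<lambda>t. x t i l) \<and> \<bar>x 0 i l\<bar> \<le> M0) \<longrightarrow>
     (\<forall>i\<in>H. \<forall>l<n. sflg i l = 1 \<longrightarrow> (\<forall>t\<ge>0. \<bar>e i l t\<bar> \<le> M0) \<and> (e i l \<longlongrightarrow> 0) at_top) \<longrightarrow>
     (\<forall>i<N. \<forall>l<n. eventually (\<lambda>t. \<bar>x t i l\<bar> \<le> \<eta> / vv) at_top)"
    by (rule robust_consensus[OF sym conn s01 maj H \<eta>' M0])
  then obtain \<kappa>s \<gamma>s where ks: "\<kappa>s \<ge> 0" and cons: "\<forall>\<kappa>>\<kappa>s. \<forall>\<gamma>>\<gamma>s. \<forall>e x.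
     err_inclusion N n G sflg A_dual \<kappa> \<gamma> H e x \<longrightarrow>
     (\<forall>i<N. \<forall>l<n. continuous_on {0..} (\<lambda>t. x t i l) \<and> \<bar>x 0 i l\<bar> \<le> M0) \<longrightarrow>
     (\<forall>i\<in>H. \<forall>l<n. sflg i l = 1 \<longrightarrow> (\<forall>t\<ge>0. \<bar>e i l t\<bar> \<le> M0) \<and> (e i l \<longlongrightarrow> 0) at_top) \<longrightarrow>
     (\<forall>i<N. \<forall>l<n. eventually (\<lambda>t. \<bar>x t i l\<bar> \<le> \<eta> / vv) at_top)"
    by (elim exE conjE) (rule that, assumption+)
  note cons = cons[THEN spec, THEN mp, THEN spec, THEN mp, THEN spec, THEN spec, THEN mp, THEN mp, THEN mp]
  have main: "eventually (\<lambda>t. linf (xhof n i (\<xi> t) - xof n (\<xi> t)) \<le> \<eta>) at_top"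
    if k: "\<kappa> > \<kappa>s" and g: "\<gamma> > \<gamma>s" and sol: "filippov_solution I (rhs' \<kappa> \<gamma>) \<xi>"
      and init: "\<forall>k\<in>I. \<bar>\<xi> 0 k\<bar> \<le> b" and i: "i < N" for \<kappa> \<gamma> \<xi> i
  proof -
    have k0: "\<kappa> > 0" using k ks by simp
    note cont = continuous_on_coords[OF filippov_solution_continuous[OF sol]]
    have xc0: "\<bar>xc l (\<xi> 0)\<bar> \<le> ww * b" if "l < n" for l
    proof -
      have "\<bar>xc l (\<xi> 0)\<bar> \<le> (\<Sum>r<n. \<bar>w l $ r\<bar>) * b"
        unfolding xc_sum by (rule abs_sum_mult_le) (use init in auto)
      also have "\<dots> \<le> ww * b" using ww[OF that] b by (rule mult_right_mono)
      finally show ?thesis .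
    qed
    have xhc0: "\<bar>xhc j l (\<xi> 0)\<bar> \<le> ww * b" if "j < N" "l < n" for j l
    proof -
      have "\<bar>xhc j l (\<xi> 0)\<bar> \<le> (\<Sum>r<n. \<bar>w l $ r\<bar>) * b"
        unfolding xhc_sum by (rule abs_sum_mult_le) (use init that in auto)
      also have "\<dots> \<le> ww * b" using ww[OF that(2)] b by (rule mult_right_mono)
      finally show ?thesis .
    qed
    have "\<forall>i<N. \<forall>l<n. eventually (\<lambda>t. \<bar>err (\<xi> t) i l\<bar> \<le> \<eta> / vv) at_top"
    proof (rule cons[OF k g solution_err_inclusion[OF sol k0]]; intro allI impI ballI conjI)
      fix j l assume jl: "j < N" "l < n"
      show "continuous_on {0..} (\<lambda>t. err (\<xi> t) j l)"
        unfolding err_def by (intro continuous_intros cont jl)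
      have "0 \<le> (\<Sum>i\<in>H. c i * (real (od i) * ((1 + ww) * b)))" using nn by (rule sum_nonneg)
      then show "\<bar>err (\<xi> 0) j l\<bar> \<le> M0"
        using xc0[OF jl(2)] xhc0[OF jl] unfolding err_def M0_def by linarith
    next
      fix j l assume j: "j \<in> H" and l: "l < n" and s: "sflg j l = 1"
      have jN: "j < N" using j H by auto
      define Y where "Y = (\<Sum>k<od j. \<bar>\<xi> 0 (IZ j k) - xc (sel n (U j) v ! k) (\<xi> 0)\<bar>)"
      have dec: "\<bar>zc j l (\<xi> t) - xc l (\<xi> t)\<bar> \<le> c j * exp (- \<beta> j * t) * Y" if "t \<ge> 0" for t
        using P[OF j] sol l s that unfolding P_def Y_def by blast
      have beta: "\<beta> j > 0" using P[OF j] by (simp add: P_def)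
      have Y: "0 \<le> Y" "Y \<le> real (od j) * ((1 + ww) * b)"
      proof -
        show "0 \<le> Y" unfolding Y_def by (intro sum_nonneg) auto
        have "Y \<le> (\<Sum>k<od j. (1 + ww) * b)"
          unfolding Y_def
        proof (rule sum_mono)
          fix k assume "k \<in> {..<od j}"
          then have k: "k < od j" by simp
          have "sel n (U j) v ! k < n" using nth_sel[of k n "U j" v] k by (simp add: od_def)
          from xc0[OF this] have "\<bar>xc (sel n (U j) v ! k) (\<xi> 0)\<bar> \<le> ww * b" .
          moreover have "\<bar>\<xi> 0 (IZ j k)\<bar> \<le> b" using init k jN by simp
          ultimately show "\<bar>\<xi> 0 (IZ j k) - xc (sel n (U j) v ! k) (\<xi> 0)\<bar> \<le> (1 + ww) * b"
            by (simp add: distrib_right)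
        qed
        then show "Y \<le> real (od j) * ((1 + ww) * b)" by simp
      qed
      show "\<bar>zc j l (\<xi> t) - xc l (\<xi> t)\<bar> \<le> M0" if t: "0 \<le> t" for t
      proof -
        have "c j * exp (- \<beta> j * t) * Y \<le> c j * 1 * (real (od j) * ((1 + ww) * b))"
          using Y c0[OF j] beta t by (intro mult_mono mult_left_mono) auto
        also have "\<dots> \<le> (\<Sum>i\<in>H. c i * (real (od i) * ((1 + ww) * b)))"
          using Hfin j nn by (simp only: mult_1_right) (intro member_le_sum, auto)
        also have "\<dots> \<le> M0" unfolding M0_def using ww0 b by simp
        finally show ?thesis using dec[OF t] by linarith
      qed
      have "((\<lambda>t. c j * exp (- \<beta> j * t) * Y) \<longlongrightarrow> c j * 0 * Y) at_top"
      proof (intro tendsto_intros)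
        have "filterlim (\<lambda>t. - \<beta> j * t) at_bot at_top"
          using filterlim_tendsto_neg_mult_at_bot[OF tendsto_const[of "- \<beta> j"] _ filterlim_ident] beta by simp
        then show "((\<lambda>t. exp (- \<beta> j * t)) \<longlongrightarrow> 0) at_top"
          by (rule filterlim_compose[OF exp_at_bot])
      qed
      then have lim: "((\<lambda>t. c j * exp (- \<beta> j * t) * Y) \<longlongrightarrow> 0) at_top" by simp
      show "((\<lambda>t. zc j l (\<xi> t) - xc l (\<xi> t)) \<longlongrightarrow> 0) at_top"
      proof (rule Lim_null_comparison[OF _ lim])
        show "\<forall>\<^sub>F t in at_top. norm (zc j l (\<xi> t) - xc l (\<xi> t)) \<le> c j * exp (- \<beta> j * t) * Y"
          using eventually_ge_at_top[of "0::real"] by eventually_elim (use dec in simp)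
      qed
    qed
    then have "eventually (\<lambda>t. \<forall>l\<in>{..<n}. \<bar>err (\<xi> t) i l\<bar> \<le> \<eta> / vv) at_top"
      unfolding eventually_ball_finite_distrib[OF finite_lessThan] using i by blast
    then show ?thesis
    proof eventually_elim
      case (elim t)
      have "\<bar>(xhof n i (\<xi> t) - xof n (\<xi> t)) $ r\<bar> \<le> \<eta>" if r: "r < n" for r
      proof -
        have "\<bar>(xhof n i (\<xi> t) - xof n (\<xi> t)) $ r\<bar> \<le> (\<Sum>l<n. \<bar>v l $ r\<bar>) * (\<eta> / vv)"
          unfolding estimate_difference[OF i r] by (rule abs_sum_mult_le) (use elim in auto)
        also have "\<dots> \<le> vv * (\<eta> / vv)" using vv[OF r] \<eta> vv0 by (intro mult_right_mono) auto
        finally show ?thesis using vv0 by simp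
      qed
      then show ?case unfolding linf_def using \<eta> by (subst Max_le_iff) (auto simp: xof_def xhof_def)
    qed
  qed
  show ?thesis
    by (rule exI[of _ \<kappa>s], intro conjI ks, rule exI[of _ \<gamma>s], (rule allI, rule impI)+, rule impI,
        rule allI, rule impI, rule main)
qed

end

theorem theorem2:
  fixes n N p q :: nat
    and m :: "nat \<Rightarrow> nat"
    and A B :: "real mat"
    and C :: "nat \<Rightarrow> real mat"
    and G :: "nat \<Rightarrow> nat \<Rightarrow> bool"
    and v w :: "nat \<Rightarrow> real vec"
    and L :: "nat \<Rightarrow> real mat"
    and u :: "real \<Rightarrow> real vec"
    and a :: "nat \<Rightarrow> real \<Rightarrow> real vec"
  defines "U \<equiv> (\<lambda>i. unobs_space n (C i) A)"
  defines "od \<equiv> (\<lambda>i. length (sel n (U i) v))"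
  assumes A_dim: "A \<in> carrier_mat n n"
    and B_dim: "B \<in> carrier_mat n p"
    and C_dim: "\<forall>i<N. C i \<in> carrier_mat (m i) n"
    and u_dim: "\<forall>t. u t \<in> carrier_vec p"
    and u_loc_int: "\<forall>T\<ge>0. \<forall>k<p. (\<lambda>t. u t $ k) absolutely_integrable_on {0..T}"
    and a_dim: "\<forall>i<N. \<forall>t. a i t \<in> carrier_vec (m i)"
    and a_loc_int: "\<forall>i<N. \<forall>T\<ge>0. \<forall>k<m i. (\<lambda>t. a i t $ k) absolutely_integrable_on {0..T}"
    and A1: "\<exists>S\<subseteq>{..<N}. N - q \<le> card S \<and> (\<forall>i\<in>S. \<forall>t\<ge>0. a i t = 0\<^sub>v (m i))"
    and A2: "\<forall>S\<subseteq>{..<N}. card S = N - 2 * q \<longrightarrow> observable_stack n C S A"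
    and A3_sym: "\<forall>i<N. \<forall>j<N. G i j \<longleftrightarrow> G j i"
    and A3_conn: "graph_connected N G"
    and basis: "is_basis n v"
    and A4: "\<forall>i<N. \<exists>S\<subseteq>{..<n}. U i = span_of n v S"
    and w_dim: "\<forall>l<n. w l \<in> carrier_vec n"
    and w_dual: "\<forall>l<n. \<forall>l'<n. w l \<bullet> v l' = (if l = l' then 1 else 0)"
    and L_dim: "\<forall>i<N. L i \<in> carrier_mat (od i) (m i)"
    and L_hurwitz: "\<forall>i<N. hurwitz (Wmat n (U i) v w * A * Vmat n (U i) v
                                   - L i * C i * Vmat n (U i) v)"
  shows "\<forall>K \<eta>. compact K \<and> \<eta> > 0 \<longrightarrow>
     (\<exists>\<kappa>s \<gamma>s. \<forall>\<kappa> \<gamma> \<xi>0. \<kappa> > \<kappa>s \<and> \<gamma> > \<gamma>s \<and> restrict \<xi>0 (idxset n N od) \<in> K \<longrightarrow>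
        (\<exists>\<xi>. \<xi> 0 = \<xi>0 \<and> filippov_solution (idxset n N od) (rhs n N A B C U v w L G \<kappa> \<gamma> u a) \<xi>) \<and>
        (\<forall>\<xi>. \<xi> 0 = \<xi>0 \<and> filippov_solution (idxset n N od) (rhs n N A B C U v w L G \<kappa> \<gamma> u a) \<xi> \<longrightarrow>
           (\<forall>i<N. Limsup at_top (\<lambda>t. ereal (linf (xhof n i (\<xi> t) - xof n (\<xi> t)))) \<le> ereal \<eta>)))"
proof (intro allI impI)
  fix K :: "(idx \<Rightarrow> real) set" and \<eta> :: real
  assume K: "compact K \<and> \<eta> > 0"
  interpret observer_signals n v w N p m A B C G L u a U od
  proof unfold_locales
    show "U = (\<lambda>i. unobs_space n (C i) A)" by (simp add: U_def)
    show "od = (\<lambda>i. length (sel n (U i) v))" by (simp add: od_def)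
  qed (use assms(3-) in auto)
  obtain H where H: "H \<subseteq> {..<N}" "N - q \<le> card H" "\<forall>i\<in>H. \<forall>t\<ge>0. a i t = 0\<^sub>v (m i)" using A1 by blast
  \<comment> \<open>Written as a sum, since subtraction of naturals truncates when q exceeds
    N.\<close>
  have H2: "N \<le> card H + q" using H(2) by simp
  obtain b where b: "b \<ge> 0" "\<And>\<zeta> k. \<zeta> \<in> K \<Longrightarrow> k \<in> I \<Longrightarrow> \<bar>\<zeta> k\<bar> \<le> b"
    using compact_coord_bounded[OF conjunct1[OF K] finite_idxset] by metis
  from resilient_estimation[OF A3_sym A3_conn A2 H(1) H2 _ _ conjunct2[OF K] b(1)]
  obtain \<kappa>s \<gamma>s where ks: "\<kappa>s \<ge> 0" and est: "\<And>\<kappa> \<gamma> \<xi> i. \<kappa> > \<kappa>s \<Longrightarrow> \<gamma> > \<gamma>s \<Longrightarrow>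
      filippov_solution I (rhs' \<kappa> \<gamma>) \<xi> \<Longrightarrow> \<forall>k\<in>I. \<bar>\<xi> 0 k\<bar> \<le> b \<Longrightarrow> i < N \<Longrightarrow>
      eventually (\<lambda>t. linf (xhof n i (\<xi> t) - xof n (\<xi> t)) \<le> \<eta>) at_top"
    using H(3) L_hurwitz by blast
  show "\<exists>\<kappa>s \<gamma>s. \<forall>\<kappa> \<gamma> \<xi>0. \<kappa> > \<kappa>s \<and> \<gamma> > \<gamma>s \<and> restrict \<xi>0 (idxset n N od) \<in> K \<longrightarrow>
        (\<exists>\<xi>. \<xi> 0 = \<xi>0 \<and> filippov_solution (idxset n N od) (rhs n N A B C U v w L G \<kappa> \<gamma> u a) \<xi>) \<and>
        (\<forall>\<xi>. \<xi> 0 = \<xi>0 \<and> filippov_solution (idxset n N od) (rhs n N A B C U v w L G \<kappa> \<gamma> u a) \<xi> \<longrightarrow>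
           (\<forall>i<N. Limsup at_top (\<lambda>t. ereal (linf (xhof n i (\<xi> t) - xof n (\<xi> t)))) \<le> ereal \<eta>))"
  proof (rule exI[of _ \<kappa>s], rule exI[of _ \<gamma>s], (rule allI)+, rule impI, rule conjI)
    fix \<kappa> \<gamma> \<xi>0 assume *: "\<kappa> > \<kappa>s \<and> \<gamma> > \<gamma>s \<and> restrict \<xi>0 I \<in> K"
    \<comment> \<open>The threshold is nonnegative, so \<kappa> is positive, as the existence
      theorem requires.\<close>
    then show "\<exists>\<xi>. \<xi> 0 = \<xi>0 \<and> filippov_solution I (rhs' \<kappa> \<gamma>) \<xi>"
      using filippov_solution_exists[of \<kappa> \<xi>0 \<gamma>] ks by simp
    show "\<forall>\<xi>. \<xi> 0 = \<xi>0 \<and> filippov_solution I (rhs' \<kappa> \<gamma>) \<xi> \<longrightarrow>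
           (\<forall>i<N. Limsup at_top (\<lambda>t. ereal (linf (xhof n i (\<xi> t) - xof n (\<xi> t)))) \<le> ereal \<eta>)"
    proof (intro allI impI)
      fix \<xi> i assume sol: "\<xi> 0 = \<xi>0 \<and> filippov_solution I (rhs' \<kappa> \<gamma>) \<xi>" and i: "i < N"
      \<comment> \<open>\<open>restrict\<close> leaves \<xi>0 unchanged on the index set, so the
        bound obtained from compactness applies to the initial state.\<close>
      have "\<forall>k\<in>I. \<bar>\<xi> 0 k\<bar> \<le> b" using b(2)[of "restrict \<xi>0 I"] * sol by auto
      then have "eventually (\<lambda>t. linf (xhof n i (\<xi> t) - xof n (\<xi> t)) \<le> \<eta>) at_top"
        using est[of \<kappa> \<gamma> \<xi> i] * sol i by blast
      then show "Limsup at_top (\<lambda>t. ereal (linf (xhof n i (\<xi> t) - xof n (\<xi> t)))) \<le> ereal \<eta>"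
        by (intro Limsup_bounded) (auto elim: eventually_mono)
    qed
  qed
qed

end
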